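(* Let $k_{1},\ldots,k_{r},l_{1},\ldots,l_{s}$ be positive integers. Then the equality \begin{align} &\text{\pounds}_{\widehat{\mathcal{A}},\alpha}\left(\begin{pmatrix}x_{1},\ldots,x_{r}\\ k_{1},\ldots,k_{r}\end{pmatrix}\mathbin{\sqcup\!\sqcup}\begin{pmatrix}y_{1},\ldots,y_{s}\\ l_{1},\ldots,l_{s}\end{pmatrix}\right)\\ &\qquad=(-1)^{l_{1}+\cdots+l_{s}}y_{1}^{\boldsymbol{p}}\sum_{f_{1},\ldots,f_{s}\ge 0}\left(\prod_{i=1}^{s}\binom{l_{i}+f_{i}-1}{f_{i}}\right)\text{\pounds}_{\widehat{\mathcal{A}},\alpha}\begin{pmatrix}x_{1}/y_{1},\ldots,x_{r}/y_{1},1/y_{1},y_{s}/y_{1},\ldots,y_{2}/y_{1}\\ k_{1},\ldots,k_{r},l_{s}+f_{s},\ldots,l_{1}+f_{1}\end{pmatrix}\boldsymbol{p}^{f_{1}+\cdots+f_{s}} \end{align} holds in $\widehat{\mathcal{A}}^{\mathcal{P}(N;\alpha)}_{\mathbb{Z}[\mathbf{x},y_{1},y_{1}^{-1},y_{2},\ldots,y_{s}]}$.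
   Context: $x_{1},\ldots,x_{r},y_{1},\ldots,y_{s}$ are indeterminates, $\mathbf{x}=(x_{1},\ldots,x_{r})$, $N$ a positive integer, $\alpha\in\mathbb{Z}/N\mathbb{Z}$ and $\mathcal{P}(N;\alpha)$ the set of primes $p\equiv\alpha\pmod N$. For a commutative ring $R$ and $\Sigma\subseteq R$, $\mathcal{A}^{\Sigma}_{n,R}=(\prod_{a\in\Sigma}R/a^{n}R)/(\bigoplus_{a\in\Sigma}R/a^{n}R)$ and $\widehat{\mathcal{A}}^{\Sigma}_{R}=\varprojlim_{n}\mathcal{A}^{\Sigma}_{n,R}$, with natural projection $\pi^{\Sigma}_{R}\colon\prod_{a\in\Sigma}\varprojlim_{n}R/a^{n}R\to\widehat{\mathcal{A}}^{\Sigma}_{R}$; $\boldsymbol{p}$ is the image of $(p)_{p\in\mathcal{P}(N;\alpha)}$ and $y_{1}^{\boldsymbol{p}}$ the image of $(y_{1}^{p})_{p}$; the ring is $\boldsymbol{p}$-adically complete. For elements $a_{1},\ldots,a_{n}$ of the coefficient ring and positive integers $k_{i}$, $\text{\pounds}_{<M}\begin{pmatrix}a_{1},\ldots,a_{n}\\ k_{1},\ldots,k_{n}\end{pmatrix}=\sum_{0<m_{1}<\cdots<m_{n}<M}\frac{a_{1}^{m_{1}}a_{2}^{m_{2}-m_{1}}\cdots a_{n}^{m_{n}-m_{n-1}}}{m_{1}^{k_{1}}\cdots m_{n}^{k_{n}}}$ and $\text{\pounds}_{\widehat{\mathcal{A}},\alpha}$ of it is the image under $\pi$ of $(\text{\pounds}_{<p}(\cdot))_{p\in\mathcal{P}(N;\alpha)}$,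 extended $\mathbb{Q}$-linearly. The shuffle of such symbols is defined by identifying $\begin{pmatrix}a_{1},\ldots,a_{n}\\ k_{1},\ldots,k_{n}\end{pmatrix}$ with the word $\prod_{i}e_{a_{i}}e_{0}^{k_{i}-1}$ in the noncommutative polynomial ring over $\mathbb{Q}$ in letters $e_{0},e_{1},e_{x_{i}},e_{y_{j}}$, with shuffle product $1\mathbin{\sqcup\!\sqcup}w=w\mathbin{\sqcup\!\sqcup}1=w$, $we_{z}\mathbin{\sqcup\!\sqcup}w'e_{z'}=(we_{z}\mathbin{\sqcup\!\sqcup}w')e_{z'}+(w\mathbin{\sqcup\!\sqcup}w'e_{z'})e_{z}$, and converting back. *)

theory Defs
  imports
    Complex_Main
    "HOL-Library.Poly_Mapping"
    "HOL-Library.FuncSet"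
    "HOL-Number_Theory.Cong"
    "HOL-Algebra.QuotRing"
begin

section \<open>Products, quotients and projective limits of rings\<close>

definition prod_ring :: "'i set \<Rightarrow> ('i \<Rightarrow> ('a, 'm) ring_scheme) \<Rightarrow> ('i \<Rightarrow> 'a) ring" where
  "prod_ring I S =
    \<lparr>carrier = (\<Pi>\<^sub>E i\<in>I. carrier (S i)),
     mult = (\<lambda>f g. \<lambda>i\<in>I. f i \<otimes>\<^bsub>S i\<^esub> g i), one = (\<lambda>i\<in>I. \<one>\<^bsub>S i\<^esub>),
     zero = (\<lambda>i\<in>I. \<zero>\<^bsub>S i\<^esub>), add = (\<lambda>f g. \<lambda>i\<in>I. f i \<oplus>\<^bsub>S i\<^esub> g i)\<rparr>"

definition dirsum_ideal :: "'i set \<Rightarrow> ('i \<Rightarrow> ('a, 'm) ring_scheme) \<Rightarrow> ('i \<Rightarrow> 'a) set" where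
  "dirsum_ideal I S = {f \<in> carrier (prod_ring I S). finite {i \<in> I. f i \<noteq> \<zero>\<^bsub>S i\<^esub>}}"

text \<open>The limit of \<open>\<dots> \<rightarrow> S 2 \<rightarrow> S 1 \<rightarrow> S 0\<close>, with transition maps \<open>\<phi> n\<close> from \<open>S (Suc n)\<close> to \<open>S n\<close>.\<close>

definition proj_lim_ring ::
    "(nat \<Rightarrow> ('a, 'm) ring_scheme) \<Rightarrow> (nat \<Rightarrow> 'a \<Rightarrow> 'a) \<Rightarrow> (nat \<Rightarrow> 'a) ring" where
  "proj_lim_ring S \<phi> =
    \<lparr>carrier = {z. (\<forall>n. z n \<in> carrier (S n)) \<and> (\<forall>n. \<phi> n (z (Suc n)) = z n)},
     mult = (\<lambda>z w n. z n \<otimes>\<^bsub>S n\<^esub> w n), one = (\<lambda>n. \<one>\<^bsub>S n\<^esub>),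
     zero = (\<lambda>n. \<zero>\<^bsub>S n\<^esub>), add = (\<lambda>z w n. z n \<oplus>\<^bsub>S n\<^esub> w n)\<rparr>"

text \<open>The map \<open>S' Quot J' \<rightarrow> S Quot J\<close> induced by a map \<open>\<phi>\<close> from \<open>S'\<close> to \<open>S\<close> with \<open>\<phi> ` J' \<subseteq> J\<close>:
  the coset \<open>C\<close> of \<open>c\<close> is sent to the coset \<open>J + \<phi> ` C\<close> of \<open>\<phi> c\<close>.\<close>

definition quot_map :: "('b, 'm) ring_scheme \<Rightarrow> 'b set \<Rightarrow> ('a \<Rightarrow> 'b) \<Rightarrow> 'a set \<Rightarrow> 'b set" where
  "quot_map S J \<phi> C = J <+>\<^bsub>S\<^esub> (\<phi> ` C)"

section \<open>The rings \<open>R/a\<^sup>nR\<close>, \<open>\<A>\<^sup>\<Sigma>\<^sub>n\<^sub>,\<^sub>R\<close> and \<open>\<A>\<^sup>\<Sigma>\<^sub>R\<close> hat\<close>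

text \<open>The index \<open>n\<close> runs over all natural numbers; the rings for \<open>n = 0\<close> are zero rings,
  so that they do not affect the limits.\<close>

definition quot_pow :: "('a, 'm) ring_scheme \<Rightarrow> 'a \<Rightarrow> nat \<Rightarrow> 'a set ring" where
  "quot_pow R a n = R Quot (PIdl\<^bsub>R\<^esub> (a [^]\<^bsub>R\<^esub> n))"

definition quot_pow_map :: "('a, 'm) ring_scheme \<Rightarrow> 'a \<Rightarrow> nat \<Rightarrow> 'a set \<Rightarrow> 'a set" where
  "quot_pow_map R a n = quot_map R (PIdl\<^bsub>R\<^esub> (a [^]\<^bsub>R\<^esub> n)) (\<lambda>c. c)"

definition adic_completion :: "('a, 'm) ring_scheme \<Rightarrow> 'a \<Rightarrow> (nat \<Rightarrow> 'a set) ring" where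
  "adic_completion R a = proj_lim_ring (quot_pow R a) (quot_pow_map R a)"

definition to_completion :: "('a, 'm) ring_scheme \<Rightarrow> 'a \<Rightarrow> 'a \<Rightarrow> nat \<Rightarrow> 'a set" where
  "to_completion R a c = (\<lambda>n. PIdl\<^bsub>R\<^esub> (a [^]\<^bsub>R\<^esub> n) +>\<^bsub>R\<^esub> c)"

definition A_prod :: "('a, 'm) ring_scheme \<Rightarrow> 'a set \<Rightarrow> nat \<Rightarrow> ('a \<Rightarrow> 'a set) ring" where
  "A_prod R \<Sigma> n = prod_ring \<Sigma> (\<lambda>a. quot_pow R a n)"

definition A_sum :: "('a, 'm) ring_scheme \<Rightarrow> 'a set \<Rightarrow> nat \<Rightarrow> ('a \<Rightarrow> 'a set) set" where
  "A_sum R \<Sigma> n = dirsum_ideal \<Sigma> (\<lambda>a. quot_pow R a n)"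

definition A_ring :: "('a, 'm) ring_scheme \<Rightarrow> 'a set \<Rightarrow> nat \<Rightarrow> ('a \<Rightarrow> 'a set) set ring" where
  "A_ring R \<Sigma> n = A_prod R \<Sigma> n Quot A_sum R \<Sigma> n"

definition A_map ::
    "('a, 'm) ring_scheme \<Rightarrow> 'a set \<Rightarrow> nat \<Rightarrow> ('a \<Rightarrow> 'a set) set \<Rightarrow> ('a \<Rightarrow> 'a set) set" where
  "A_map R \<Sigma> n =
    quot_map (A_prod R \<Sigma> n) (A_sum R \<Sigma> n) (\<lambda>f. \<lambda>a\<in>\<Sigma>. quot_pow_map R a n (f a))"

definition A_hat :: "('a, 'm) ring_scheme \<Rightarrow> 'a set \<Rightarrow> (nat \<Rightarrow> ('a \<Rightarrow> 'a set) set) ring" where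
  "A_hat R \<Sigma> = proj_lim_ring (A_ring R \<Sigma>) (A_map R \<Sigma>)"

text \<open>The natural projection from the product of the rings \<^term>\<open>adic_completion R a\<close>, \<open>a \<in> \<Sigma>\<close>.\<close>

definition A_proj ::
    "('a, 'm) ring_scheme \<Rightarrow> 'a set \<Rightarrow> ('a \<Rightarrow> nat \<Rightarrow> 'a set) \<Rightarrow> nat \<Rightarrow> ('a \<Rightarrow> 'a set) set" where
  "A_proj R \<Sigma> c = (\<lambda>n. A_sum R \<Sigma> n +>\<^bsub>A_prod R \<Sigma> n\<^esub> (\<lambda>a\<in>\<Sigma>. c a n))"

section \<open>Primes in a residue class\<close>

text \<open>A class in \<open>\<int>/N\<int>\<close> is given by an integer representative \<open>\<alpha>\<close>.\<close>

definition primes_cong :: "nat \<Rightarrow> int \<Rightarrow> nat set" where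
  "primes_cong N \<alpha> = {p. prime p \<and> [int p = \<alpha>] (mod int N)}"

definition nat_elt :: "('a, 'm) ring_scheme \<Rightarrow> nat \<Rightarrow> 'a" where
  "nat_elt R m = [m] \<cdot>\<^bsub>R\<^esub> \<one>\<^bsub>R\<^esub>"

definition prime_elts :: "('a, 'm) ring_scheme \<Rightarrow> nat \<Rightarrow> int \<Rightarrow> 'a set" where
  "prime_elts R N \<alpha> = nat_elt R ` primes_cong N \<alpha>"

text \<open>The prime \<open>p\<close> underlying the element \<open>p \<cdot> 1\<close> of \<open>R\<close> (for \<open>R\<close> of characteristic zero).\<close>

definition prime_of :: "('a, 'm) ring_scheme \<Rightarrow> nat \<Rightarrow> int \<Rightarrow> 'a \<Rightarrow> nat" where
  "prime_of R N \<alpha> = inv_into (primes_cong N \<alpha>) (nat_elt R)"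

abbreviation Ah :: "('a, 'm) ring_scheme \<Rightarrow> nat \<Rightarrow> int \<Rightarrow> (nat \<Rightarrow> ('a \<Rightarrow> 'a set) set) ring" where
  "Ah R N \<alpha> \<equiv> A_hat R (prime_elts R N \<alpha>)"

text \<open>The image in \<^term>\<open>Ah R N \<alpha>\<close> of a family \<open>(c p)\<close> with \<open>c p\<close> in \<open>adic_completion R p\<close>.\<close>

definition family_image ::
    "('a, 'm) ring_scheme \<Rightarrow> nat \<Rightarrow> int \<Rightarrow> (nat \<Rightarrow> nat \<Rightarrow> 'a set) \<Rightarrow> nat \<Rightarrow> ('a \<Rightarrow> 'a set) set" where
  "family_image R N \<alpha> c = A_proj R (prime_elts R N \<alpha>) (\<lambda>a\<in>prime_elts R N \<alpha>. c (prime_of R N \<alpha> a))"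

definition bold_p :: "('a, 'm) ring_scheme \<Rightarrow> nat \<Rightarrow> int \<Rightarrow> nat \<Rightarrow> ('a \<Rightarrow> 'a set) set" where
  "bold_p R N \<alpha> = family_image R N \<alpha> (\<lambda>p. to_completion R (nat_elt R p) (nat_elt R p))"

definition pow_bold_p :: "('a, 'm) ring_scheme \<Rightarrow> nat \<Rightarrow> int \<Rightarrow> 'a \<Rightarrow> nat \<Rightarrow> ('a \<Rightarrow> 'a set) set" where
  "pow_bold_p R N \<alpha> y = family_image R N \<alpha> (\<lambda>p. to_completion R (nat_elt R p) (y [^]\<^bsub>R\<^esub> p))"

section \<open>Finite multiple polylogarithms\<close>

text \<open>The two-row symbol with entries \<open>a\<^sub>1,\<dots>,a\<^sub>n\<close> and \<open>k\<^sub>1,\<dots>,k\<^sub>n\<close> is the list of its columns.\<close>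

type_synonym 'a symbol = "('a \<times> nat) list"

text \<open>The truncated sum, in a ring \<open>S\<close> in which \<open>1, \<dots>, M - 1\<close> are units.
  The convention \<open>m\<^sub>0 = 0\<close> is the entry \<open>0\<close> prepended to \<open>ms\<close>.\<close>

definition polylog_trunc :: "('b, 'm) ring_scheme \<Rightarrow> nat \<Rightarrow> 'b symbol \<Rightarrow> 'b" where
  "polylog_trunc S M \<sigma> =
    (\<Oplus>\<^bsub>S\<^esub> ms \<in> {ms. length ms = length \<sigma> \<and> sorted_wrt (<) ms \<and> set ms \<subseteq> {0<..<M}}.
      \<Otimes>\<^bsub>S\<^esub> i \<in> {..<length \<sigma>}.
        fst (\<sigma> ! i) [^]\<^bsub>S\<^esub> (ms ! i - (0 # ms) ! i)
          \<otimes>\<^bsub>S\<^esub> inv\<^bsub>S\<^esub> (nat_elt S (ms ! i) [^]\<^bsub>S\<^esub> snd (\<sigma> ! i)))"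

definition polylog_hat ::
    "('a, 'm) ring_scheme \<Rightarrow> nat \<Rightarrow> int \<Rightarrow> 'a symbol \<Rightarrow> nat \<Rightarrow> ('a \<Rightarrow> 'a set) set" where
  "polylog_hat R N \<alpha> \<sigma> = family_image R N \<alpha> (\<lambda>p.
    polylog_trunc (adic_completion R (nat_elt R p)) p
      (map (map_prod (to_completion R (nat_elt R p)) id) \<sigma>))"

section \<open>Words and the shuffle product\<close>

text \<open>Words \<open>e\<^bsub>z\<^sub>1\<^esub> \<dots> e\<^bsub>z\<^sub>n\<^esub>\<close>; the letter \<open>e\<^sub>z\<close> is represented by its index \<open>z\<close>, an element of the
  coefficient ring. With concatenation as addition, \<open>'z word \<Rightarrow>\<^sub>0 rat\<close> is the noncommutative
  polynomial ring over the rationals in the letters \<open>e\<^sub>z\<close>.\<close>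

datatype 'z word = Word (letters: "'z list")

instantiation word :: (type) monoid_add
begin

definition zero_word :: "'a word" where "0 = Word []"

definition plus_word :: "'a word \<Rightarrow> 'a word \<Rightarrow> 'a word" where
  "u + v = Word (letters u @ letters v)"

instance
  by standard (simp_all add: zero_word_def plus_word_def)

end

type_synonym 'z ncpoly = "'z word \<Rightarrow>\<^sub>0 rat"

definition word_mono :: "'z word \<Rightarrow> 'z ncpoly" where
  "word_mono w = Poly_Mapping.single w 1"

abbreviation letter :: "'z \<Rightarrow> 'z ncpoly" where
  "letter z \<equiv> word_mono (Word [z])"

text \<open>The recursion for the shuffle product splits off last letters;
  here both words are given with their letters in reverse order.\<close>

fun shuffle_rev :: "'z list \<Rightarrow> 'z list \<Rightarrow> 'z ncpoly" where
  "shuffle_rev [] v = word_mono (Word (rev v))"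
| "shuffle_rev u [] = word_mono (Word (rev u))"
| "shuffle_rev (z # u) (z' # v) =
    shuffle_rev (z # u) v * letter z' + shuffle_rev u (z' # v) * letter z"

definition shuffle_words :: "'z word \<Rightarrow> 'z word \<Rightarrow> 'z ncpoly" where
  "shuffle_words u v = shuffle_rev (rev (letters u)) (rev (letters v))"

definition shuffle :: "'z ncpoly \<Rightarrow> 'z ncpoly \<Rightarrow> 'z ncpoly" where
  "shuffle P Q =
    (\<Sum>u\<in>Poly_Mapping.keys P. \<Sum>v\<in>Poly_Mapping.keys Q.
      Poly_Mapping.single 0 (Poly_Mapping.lookup P u * Poly_Mapping.lookup Q v)
        * shuffle_words u v)"

definition symbol_word :: "'z::zero symbol \<Rightarrow> 'z word" where
  "symbol_word \<sigma> = Word (concat (map (\<lambda>(a, k). a # replicate (k - 1) 0) \<sigma>))"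

definition symbols :: "'z::zero symbol set" where
  "symbols = {\<sigma>. \<forall>(a, k)\<in>set \<sigma>. a \<noteq> 0 \<and> 0 < k}"

definition word_symbol :: "'z::zero word \<Rightarrow> 'z symbol" where
  "word_symbol = inv_into symbols symbol_word"

definition symbol_poly :: "'z::zero symbol \<Rightarrow> 'z ncpoly" where
  "symbol_poly \<sigma> = word_mono (symbol_word \<sigma>)"

text \<open>Multiplication by a rational number \<open>q = m/d\<close> in a ring in which all positive integers are
  units, such as \<^term>\<open>Ah R N \<alpha>\<close>.\<close>

definition rat_scale :: "('b, 'm) ring_scheme \<Rightarrow> rat \<Rightarrow> 'b \<Rightarrow> 'b" where
  "rat_scale A q z =
    (THE u. u \<in> carrier A \<and>
      [snd (quotient_of q)] \<cdot>\<^bsub>A\<^esub> u = [fst (quotient_of q)] \<cdot>\<^bsub>A\<^esub> z)"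

definition polylog_hat_lin ::
    "('a::zero, 'm) ring_scheme \<Rightarrow> nat \<Rightarrow> int \<Rightarrow> 'a ncpoly \<Rightarrow> nat \<Rightarrow> ('a \<Rightarrow> 'a set) set" where
  "polylog_hat_lin R N \<alpha> P =
    (\<Oplus>\<^bsub>Ah R N \<alpha>\<^esub> w \<in> Poly_Mapping.keys P.
      rat_scale (Ah R N \<alpha>) (Poly_Mapping.lookup P w) (polylog_hat R N \<alpha> (word_symbol w)))"

section \<open>Sums in the \<open>t\<close>-adic topology\<close>

text \<open>Unconditional convergence: the net of finite partial sums, indexed by the finite subsets
  of \<open>I\<close>, converges to \<open>s\<close> for the \<open>t\<close>-adic topology of \<open>A\<close>.\<close>

definition adic_has_sum :: "('b, 'm) ring_scheme \<Rightarrow> 'b \<Rightarrow> ('i \<Rightarrow> 'b) \<Rightarrow> 'i set \<Rightarrow> 'b \<Rightarrow> bool" where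
  "adic_has_sum A t g I s \<longleftrightarrow>
    g \<in> I \<rightarrow> carrier A \<and> s \<in> carrier A \<and>
    (\<forall>n::nat. \<exists>F\<^sub>0\<subseteq>I. finite F\<^sub>0 \<and>
      (\<forall>F. finite F \<and> F\<^sub>0 \<subseteq> F \<and> F \<subseteq> I \<longrightarrow> (\<Oplus>\<^bsub>A\<^esub> f \<in> F. g f) \<ominus>\<^bsub>A\<^esub> s \<in> PIdl\<^bsub>A\<^esub> (t [^]\<^bsub>A\<^esub> n)))"

definition adic_summable :: "('b, 'm) ring_scheme \<Rightarrow> 'b \<Rightarrow> ('i \<Rightarrow> 'b) \<Rightarrow> 'i set \<Rightarrow> bool" where
  "adic_summable A t g I \<longleftrightarrow> (\<exists>s. adic_has_sum A t g I s)"

definition adic_sum :: "('b, 'm) ring_scheme \<Rightarrow> 'b \<Rightarrow> ('i \<Rightarrow> 'b) \<Rightarrow> 'i set \<Rightarrow> 'b" where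
  "adic_sum A t g I = (THE s. adic_has_sum A t g I s)"

section \<open>The coefficient ring \<open>\<int>[x\<^sub>1,\<dots>,x\<^sub>r,y\<^sub>1,y\<^sub>1\<inverse>,y\<^sub>2,\<dots>,y\<^sub>s]\<close>\<close>

datatype var = X nat | Y nat

text \<open>Laurent polynomials over the integers in all variables: a monomial is a finitely supported
  family of integer exponents.\<close>

type_synonym laurent = "(var \<Rightarrow>\<^sub>0 int) \<Rightarrow>\<^sub>0 int"

definition var :: "var \<Rightarrow> laurent" where
  "var v = Poly_Mapping.single (Poly_Mapping.single v 1) 1"

text \<open>Only the variables \<open>x\<^sub>1,\<dots>,x\<^sub>r,y\<^sub>1,\<dots>,y\<^sub>s\<close> occur, and only the exponent of \<open>y\<^sub>1\<close> may be negative.\<close>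

definition coeff_ring :: "nat \<Rightarrow> nat \<Rightarrow> laurent ring" where
  "coeff_ring r s =
    \<lparr>carrier = {P. \<forall>m\<in>Poly_Mapping.keys P.
        Poly_Mapping.keys m \<subseteq> X ` {1..r} \<union> Y ` {1..s} \<and>
        (\<forall>v. v \<noteq> Y 1 \<longrightarrow> 0 \<le> Poly_Mapping.lookup m v)},
     mult = (*), one = 1, zero = 0, add = (+)\<rparr>"

end

theory Submission
  imports
    Defs
    "HOL-Library.Function_Algebras"
    "HOL-Computational_Algebra.Formal_Power_Series"
begin

text \<open>
  Both sides are compared for each prime \<open>p\<close> separately, as identities between Laurent
  polynomials with coefficients in the rational numbers without \<open>p\<close> in the denominator; these map
  to the completion at \<open>p\<close>, and families of them to the ring of the theorem.

  The truncated sum of a symbol collects the coefficients up to degree \<open>p - 1\<close> of an iterated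
  integral. As iterated integrals multiply by the shuffle product, the truncated sum of the shuffle
  is the sum over \<open>m\<^sub>1 < \<dots> < m\<^sub>r\<close> and \<open>n\<^sub>1 < \<dots> < n\<^sub>s\<close> with \<open>m\<^sub>r + n\<^sub>s < p\<close>.
  Replacing \<open>n\<^sub>j\<close> by \<open>p - n\<^sub>j\<close> merges both chains into one, and the factors
  \<open>(p - n\<^sub>j)\<^bsup>- l\<^sub>j\<^esup>\<close> that arise are expanded by the binomial series in powers of \<open>p\<close>.
\<close>

section \<open>Products, quotients and projective limits\<close>

text \<open>Integration divides by every degree, including the multiples of p, and this is
  impossible in the completion at p. Shuffling is therefore treated over a ring in which all
  positive integers are units, and integrality is recovered only afterwards: truncated sums use
  indices 0 < m < p alone, so their denominators are prime to p. A chain is built by one step per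
  column, acting on sequences indexed by the last summation index. Reflection then moves one column
  at a time, and the base of the gap between the two chains moves along: the gap before p - n_j
  carries y_(j+1), or 1 when j = s, while y_1 is left for the gap up to p. This remaining gap is the
  source of y_1^p and of the division by y_1. Convergence has to be uniform in the primes: one
  finite set of exponents f must give an error divisible by p^n at all p simultaneously, with
  cofactors that again form a family. Limits are unique because the n-th power of bold p vanishes at
  level n of the projective limit.\<close>

lemma prod_ring_simps:
  "carrier (prod_ring I S) = (\<Pi>\<^sub>E i\<in>I. carrier (S i))"
  "f \<otimes>\<^bsub>prod_ring I S\<^esub> g = (\<lambda>i\<in>I. f i \<otimes>\<^bsub>S i\<^esub> g i)"
  "f \<oplus>\<^bsub>prod_ring I S\<^esub> g = (\<lambda>i\<in>I. f i \<oplus>\<^bsub>S i\<^esub> g i)"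
  "\<one>\<^bsub>prod_ring I S\<^esub> = (\<lambda>i\<in>I. \<one>\<^bsub>S i\<^esub>)"
  "\<zero>\<^bsub>prod_ring I S\<^esub> = (\<lambda>i\<in>I. \<zero>\<^bsub>S i\<^esub>)"
  by (simp_all add: prod_ring_def)

lemma prod_ring_cring:
  assumes "\<And>i. i \<in> I \<Longrightarrow> cring (S i)"
  shows "cring (prod_ring I S)"
proof -
  note simprules = cring.cring_simprules[OF assms]
  show ?thesis
  proof (rule cringI)
    show "abelian_group (prod_ring I S)"
    proof (rule abelian_groupI)
      fix f assume f: "f \<in> carrier (prod_ring I S)"
      show "\<zero>\<^bsub>prod_ring I S\<^esub> \<oplus>\<^bsub>prod_ring I S\<^esub> f = f"
        using f by (intro ext)
          (simp add: prod_ring_simps PiE_iff simprules(8) restrict_def extensional_def)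
      show "\<exists>g\<in>carrier (prod_ring I S). g \<oplus>\<^bsub>prod_ring I S\<^esub> f = \<zero>\<^bsub>prod_ring I S\<^esub>"
        using f by (intro bexI[of _ "\<lambda>i\<in>I. \<ominus>\<^bsub>S i\<^esub> f i"])
          (simp_all add: prod_ring_simps PiE_iff simprules(3,9) cong: restrict_cong)
    qed (simp_all add: prod_ring_simps PiE_iff simprules(1,2,7,10,23) cong: restrict_cong)
    show "comm_monoid (prod_ring I S)"
    proof (rule comm_monoidI)
      fix f assume f: "f \<in> carrier (prod_ring I S)"
      show "\<one>\<^bsub>prod_ring I S\<^esub> \<otimes>\<^bsub>prod_ring I S\<^esub> f = f"
        using f by (intro ext)
          (simp add: prod_ring_simps PiE_iff simprules(12) restrict_def extensional_def)
    qed (simp_all add: prod_ring_simps PiE_iff simprules(5,6,11,14,24) cong: restrict_cong)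
  qed (simp add: prod_ring_simps PiE_iff simprules(13) cong: restrict_cong)
qed

text \<open>\<open>a_inv\<close> is given by a description, so the componentwise formula is obtained
  from the uniqueness of negatives.\<close>

lemma a_inv_prod_ring:
  assumes "\<And>i. i \<in> I \<Longrightarrow> cring (S i)" and f: "f \<in> carrier (prod_ring I S)"
  shows "\<ominus>\<^bsub>prod_ring I S\<^esub> f = (\<lambda>i\<in>I. \<ominus>\<^bsub>S i\<^esub> f i)"
proof (rule abelian_group.minus_equality[symmetric, THEN sym])
  have ab: "abelian_group (S i)" if "i \<in> I" for i
    using assms(1)[OF that] by (auto simp: ring_def cring_def)
  show "abelian_group (prod_ring I S)"
    by (intro ring.is_abelian_group cring.axioms(1) prod_ring_cring assms(1))
  show "(\<lambda>i\<in>I. \<ominus>\<^bsub>S i\<^esub> f i) \<in> carrier (prod_ring I S)"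
    using f by (auto simp: prod_ring_simps PiE_iff intro!: abelian_group.a_inv_closed[OF ab])
  show "(\<lambda>i\<in>I. \<ominus>\<^bsub>S i\<^esub> f i) \<oplus>\<^bsub>prod_ring I S\<^esub> f = \<zero>\<^bsub>prod_ring I S\<^esub>"
    using f abelian_group.l_neg[OF ab] by (auto simp: prod_ring_simps PiE_iff intro!: restrict_ext)
qed (fact f)

lemma dirsum_ideal_ideal:
  assumes "\<And>i. i \<in> I \<Longrightarrow> cring (S i)"
  shows "ideal (dirsum_ideal I S) (prod_ring I S)"
proof -
  interpret P: cring "prod_ring I S" by (rule prod_ring_cring[OF assms])
  have r: "ring (S i)" if "i \<in> I" for i using assms[OF that] by (rule cring.axioms)
  note zero_simps = ring.ring_simprules(2,8,15)[OF r] cring.cring_simprules(26,27)[OF assms]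
  \<comment> \<open>Each closure condition below reduces to naming a finite set outside which the
    element vanishes.\<close>
  have supp: "f \<in> dirsum_ideal I S"
    if "f \<in> carrier (prod_ring I S)" "finite F"
      "\<And>i. i \<in> I \<Longrightarrow> i \<notin> F \<Longrightarrow> f i = \<zero>\<^bsub>S i\<^esub>" for f F
    using that finite_subset[of "{i \<in> I. f i \<noteq> \<zero>\<^bsub>S i\<^esub>}" F] by (auto simp: dirsum_ideal_def)
  show ?thesis
  proof (rule idealI)
    show "subgroup (dirsum_ideal I S) (add_monoid (prod_ring I S))"
    proof (rule P.add.subgroupI)
      show "dirsum_ideal I S \<noteq> {}"
        using supp[of "\<zero>\<^bsub>prod_ring I S\<^esub>" "{}"] P.zero_closed
        by (auto simp: prod_ring_simps(5) simp del: P.zero_closed)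
    next
      fix f assume "f \<in> dirsum_ideal I S"
      then have f: "f \<in> carrier (prod_ring I S)" "finite {i \<in> I. f i \<noteq> \<zero>\<^bsub>S i\<^esub>}"
        by (auto simp: dirsum_ideal_def)
      show "\<ominus>\<^bsub>prod_ring I S\<^esub> f \<in> dirsum_ideal I S"
        by (rule supp[OF P.a_inv_closed[OF f(1)] f(2)])
          (use f(1) in \<open>simp add: a_inv_prod_ring[OF assms] ring.ring_simprules(21)[OF r]\<close>)
    next
      fix f g assume "f \<in> dirsum_ideal I S" "g \<in> dirsum_ideal I S"
      then have f: "f \<in> carrier (prod_ring I S)" "finite {i \<in> I. f i \<noteq> \<zero>\<^bsub>S i\<^esub>}"
        and g: "g \<in> carrier (prod_ring I S)" "finite {i \<in> I. g i \<noteq> \<zero>\<^bsub>S i\<^esub>}"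
        by (auto simp: dirsum_ideal_def)
      show "f \<oplus>\<^bsub>prod_ring I S\<^esub> g \<in> dirsum_ideal I S"
        by (rule supp[OF P.a_closed[OF f(1) g(1)] finite_UnI[OF f(2) g(2)]])
          (use f(1) g(1) in \<open>auto simp: prod_ring_simps(3) zero_simps\<close>)
    qed (auto simp: dirsum_ideal_def)
  next
    fix f h assume "f \<in> dirsum_ideal I S" and h: "h \<in> carrier (prod_ring I S)"
    then have f: "f \<in> carrier (prod_ring I S)" "finite {i \<in> I. f i \<noteq> \<zero>\<^bsub>S i\<^esub>}"
      by (auto simp: dirsum_ideal_def)
    have h': "h i \<in> carrier (S i)" if "i \<in> I" for i
      using h that by (auto simp: prod_ring_simps)
    show "h \<otimes>\<^bsub>prod_ring I S\<^esub> f \<in> dirsum_ideal I S"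
      by (rule supp[OF P.m_closed[OF h f(1)] f(2)])
        (use f(1) h h' in \<open>auto simp: prod_ring_simps(2) zero_simps\<close>)
    show "f \<otimes>\<^bsub>prod_ring I S\<^esub> h \<in> dirsum_ideal I S"
      by (rule supp[OF P.m_closed[OF f(1) h] f(2)])
        (use f(1) h h' in \<open>auto simp: prod_ring_simps(2) zero_simps\<close>)
  qed (rule P.ring_axioms)
qed

lemma proj_lim_ring_simps:
  "carrier (proj_lim_ring S \<phi>) = {z. (\<forall>n. z n \<in> carrier (S n)) \<and> (\<forall>n. \<phi> n (z (Suc n)) = z n)}"
  "z \<otimes>\<^bsub>proj_lim_ring S \<phi>\<^esub> w = (\<lambda>n. z n \<otimes>\<^bsub>S n\<^esub> w n)"
  "z \<oplus>\<^bsub>proj_lim_ring S \<phi>\<^esub> w = (\<lambda>n. z n \<oplus>\<^bsub>S n\<^esub> w n)"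
  "\<one>\<^bsub>proj_lim_ring S \<phi>\<^esub> = (\<lambda>n. \<one>\<^bsub>S n\<^esub>)"
  "\<zero>\<^bsub>proj_lim_ring S \<phi>\<^esub> = (\<lambda>n. \<zero>\<^bsub>S n\<^esub>)"
  by (simp_all add: proj_lim_ring_def)

text \<open>Both projective limits in use are instances: the completion of a ring at one element,
  and the limit of the quotients of products by direct sums.\<close>

locale cring_tower =
  fixes S :: "nat \<Rightarrow> ('a, 'm) ring_scheme" and \<phi> :: "nat \<Rightarrow> 'a \<Rightarrow> 'a"
  assumes level_cring: "\<And>n. cring (S n)"
    and transition_hom: "\<And>n. \<phi> n \<in> ring_hom (S (Suc n)) (S n)"
begin

sublocale level: cring "S n" for n by (rule level_cring)

sublocale transition: ring_hom_cring "S (Suc n)" "S n" "\<phi> n" for n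
  by unfold_locales (rule transition_hom)

lemma proj_lim_cring: "cring (proj_lim_ring S \<phi>)"
proof (rule cringI)
  show "abelian_group (proj_lim_ring S \<phi>)"
  proof (rule abelian_groupI)
    fix z assume z: "z \<in> carrier (proj_lim_ring S \<phi>)"
    show "\<exists>w\<in>carrier (proj_lim_ring S \<phi>). w \<oplus>\<^bsub>proj_lim_ring S \<phi>\<^esub> z = \<zero>\<^bsub>proj_lim_ring S \<phi>\<^esub>"
    proof
      show "(\<lambda>n. \<ominus>\<^bsub>S n\<^esub> z n) \<in> carrier (proj_lim_ring S \<phi>)"
        using z by (auto simp: proj_lim_ring_simps)
      show "(\<lambda>n. \<ominus>\<^bsub>S n\<^esub> z n) \<oplus>\<^bsub>proj_lim_ring S \<phi>\<^esub> z = \<zero>\<^bsub>proj_lim_ring S \<phi>\<^esub>"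
        using z by (auto simp: proj_lim_ring_simps level.l_neg)
    qed
  qed (auto simp: proj_lim_ring_simps level.a_ac)
  show "comm_monoid (proj_lim_ring S \<phi>)"
    by (rule comm_monoidI) (auto simp: proj_lim_ring_simps level.m_ac)
qed (auto simp: proj_lim_ring_simps level.l_distr)

sublocale lim: cring "proj_lim_ring S \<phi>" by (rule proj_lim_cring)

lemma proj_lim_level_hom: "(\<lambda>z. z n) \<in> ring_hom (proj_lim_ring S \<phi>) (S n)"
  by (rule ring_hom_memI) (auto simp: proj_lim_ring_simps)

text \<open>Ring homomorphisms preserve inverses and inverses are unique, so the levelwise inverses
  are compatible with the transition maps.\<close>

lemma proj_lim_Units:
  assumes z: "z \<in> carrier (proj_lim_ring S \<phi>)" and u: "\<And>n. z n \<in> Units (S n)"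
  shows "z \<in> Units (proj_lim_ring S \<phi>)"
proof -
  define w where "w = (\<lambda>n. inv\<^bsub>S n\<^esub> (z n))"
  have zc: "z n \<in> carrier (S n)" and zt: "\<phi> n (z (Suc n)) = z n" for n
    using z by (auto simp: proj_lim_ring_simps)
  have wc: "w n \<in> carrier (S n)" for n using u by (simp add: w_def)
  have wz: "w n \<otimes>\<^bsub>S n\<^esub> z n = \<one>\<^bsub>S n\<^esub>" for n
    using u by (simp add: w_def)
  have "\<phi> n (w (Suc n)) = w n" for n
  proof -
    have "\<phi> n (w (Suc n)) \<otimes>\<^bsub>S n\<^esub> z n = \<phi> n (w (Suc n) \<otimes>\<^bsub>S (Suc n)\<^esub> z (Suc n))"
      using wc zc zt by (simp add: transition.hom_mult)
    then have "\<phi> n (w (Suc n)) \<otimes>\<^bsub>S n\<^esub> z n = \<one>\<^bsub>S n\<^esub>"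
      using wz by simp
    moreover have "z n \<otimes>\<^bsub>S n\<^esub> w n = \<one>\<^bsub>S n\<^esub>"
      using wz wc zc by (simp add: level.m_comm)
    ultimately show ?thesis
      using level.inv_unique wc zc transition.hom_closed by metis
  qed
  then have w: "w \<in> carrier (proj_lim_ring S \<phi>)" using wc by (simp add: proj_lim_ring_simps)
  then show ?thesis
    using z lim.m_comm[OF z w] wz unfolding Units_def
    by (auto simp: proj_lim_ring_simps(2,4) intro!: bexI[of _ w])
qed

end

text \<open>As \<open>quot_map\<close> acts on cosets as sets, no representative has to be chosen;
  \<open>J\<close> absorbs the images of the elements of \<open>J'\<close>, which leaves the coset
  of \<open>\<phi> c\<close>.\<close>

lemma quot_map_coset:
  assumes "ring S'" "ring S" "ideal J' S'" "ideal J S" "\<phi> \<in> ring_hom S' S" "\<phi> ` J' \<subseteq> J"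
    and c: "c \<in> carrier S'"
  shows "quot_map S J \<phi> (J' +>\<^bsub>S'\<^esub> c) = J +>\<^bsub>S\<^esub> \<phi> c"
proof -
  interpret S': ring S' by fact
  interpret S: ring S by fact
  interpret J': ideal J' S' by fact
  interpret J: ideal J S by fact
  interpret h: ring_hom_ring S' S \<phi> by (rule ring_hom_ringI2) fact+
  have coset: "j \<oplus>\<^bsub>S\<^esub> \<phi> (j' \<oplus>\<^bsub>S'\<^esub> c) = (j \<oplus>\<^bsub>S\<^esub> \<phi> j') \<oplus>\<^bsub>S\<^esub> \<phi> c" "j \<oplus>\<^bsub>S\<^esub> \<phi> j' \<in> J" if "j \<in> J" "j' \<in> J'" for j j'
    using that c assms(6) J.a_closed[of j "\<phi> j'"] by (auto simp: S.a_assoc)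
  show ?thesis
  proof (intro equalityI subsetI)
    fix z assume "z \<in> quot_map S J \<phi> (J' +>\<^bsub>S'\<^esub> c)"
    then obtain j j' where "j \<in> J" "j' \<in> J'" "z = j \<oplus>\<^bsub>S\<^esub> \<phi> (j' \<oplus>\<^bsub>S'\<^esub> c)"
      unfolding quot_map_def set_add_def' a_r_coset_def' by blast
    then show "z \<in> J +>\<^bsub>S\<^esub> \<phi> c"
      using coset[of j j'] unfolding a_r_coset_def' by auto
  next
    fix z assume "z \<in> J +>\<^bsub>S\<^esub> \<phi> c"
    then obtain j where j: "j \<in> J" "z = j \<oplus>\<^bsub>S\<^esub> \<phi> c"
      unfolding a_r_coset_def' by blast
    then have "z = j \<oplus>\<^bsub>S\<^esub> \<phi> (\<zero>\<^bsub>S'\<^esub> \<oplus>\<^bsub>S'\<^esub> c)" using c by simp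
    then show "z \<in> quot_map S J \<phi> (J' +>\<^bsub>S'\<^esub> c)"
      unfolding quot_map_def set_add_def' a_r_coset_def' using j(1) J'.zero_closed by blast
  qed
qed

lemma quot_map_hom:
  assumes "ring S'" "ring S" "ideal J' S'" "ideal J S" "\<phi> \<in> ring_hom S' S" "\<phi> ` J' \<subseteq> J"
  shows "quot_map S J \<phi> \<in> ring_hom (S' Quot J') (S Quot J)"
proof (rule ring_hom_memI)
  note qc = quot_map_coset[OF assms]
  note hJ = ideal.rcos_ring_hom[OF assms(4)] and hJ' = ideal.rcos_ring_hom[OF assms(3)]
  interpret S': ring S' by fact
  interpret h: ring_hom_ring S' S \<phi> by (rule ring_hom_ringI2) fact+
  have rep: "\<exists>c\<in>carrier S'. C = J' +>\<^bsub>S'\<^esub> c" if "C \<in> carrier (S' Quot J')" for C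
    using that by (auto simp: FactRing_simps)
  {
    fix C assume "C \<in> carrier (S' Quot J')"
    then show "quot_map S J \<phi> C \<in> carrier (S Quot J)"
      using rep[of C] qc ring_hom_closed[OF hJ] by auto
    fix D assume "D \<in> carrier (S' Quot J')"
    with \<open>C \<in> _\<close> obtain c d where cd: "c \<in> carrier S'" "d \<in> carrier S'"
      "C = J' +>\<^bsub>S'\<^esub> c" "D = J' +>\<^bsub>S'\<^esub> d" using rep by meson
    then show "quot_map S J \<phi> (C \<otimes>\<^bsub>S' Quot J'\<^esub> D) = quot_map S J \<phi> C \<otimes>\<^bsub>S Quot J\<^esub> quot_map S J \<phi> D"
      "quot_map S J \<phi> (C \<oplus>\<^bsub>S' Quot J'\<^esub> D) = quot_map S J \<phi> C \<oplus>\<^bsub>S Quot J\<^esub> quot_map S J \<phi> D"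
      by (simp_all add: qc flip: ring_hom_mult[OF hJ'] ring_hom_add[OF hJ']
          ring_hom_mult[OF hJ] ring_hom_add[OF hJ])
  }
  show "quot_map S J \<phi> \<one>\<^bsub>S' Quot J'\<^esub> = \<one>\<^bsub>S Quot J\<^esub>"
    by (simp add: qc flip: ring_hom_one[OF hJ'] ring_hom_one[OF hJ])
qed

section \<open>Completions and the rings of families over a commutative base ring\<close>

context cring
begin

lemma pow_ideal: "a \<in> carrier R \<Longrightarrow> ideal (PIdl (a [^] (n::nat))) R"
  by (simp add: cgenideal_ideal)

lemma quot_pow_cring: "a \<in> carrier R \<Longrightarrow> cring (quot_pow R a n)"
  unfolding quot_pow_def by (intro ideal.quotient_is_cring pow_ideal is_cring)

text \<open>This inclusion is what makes reduction from level \<open>Suc n\<close> to level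
  \<open>n\<close> well defined.\<close>

lemma pow_ideal_Suc_subset:
  assumes "a \<in> carrier R" shows "PIdl (a [^] Suc n) \<subseteq> PIdl (a [^] n)"
proof (rule cgenideal_minimal[OF pow_ideal[OF assms]])
  show "a [^] Suc n \<in> PIdl (a [^] n)"
    using assms ideal.I_r_closed[OF pow_ideal[OF assms] cgenideal_self] by simp
qed

lemma quot_pow_map_coset:
  assumes "a \<in> carrier R" "c \<in> carrier R"
  shows "quot_pow_map R a n (PIdl (a [^] Suc n) +> c) = PIdl (a [^] n) +> c"
  using quot_map_coset[OF ring_axioms ring_axioms pow_ideal pow_ideal, of a a "\<lambda>c. c" "Suc n" n c]
    pow_ideal_Suc_subset[OF assms(1), of n] assms
  by (auto simp: quot_pow_map_def ring_hom_def)

lemma quot_pow_map_hom: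
  assumes "a \<in> carrier R"
  shows "quot_pow_map R a n \<in> ring_hom (quot_pow R a (Suc n)) (quot_pow R a n)"
  unfolding quot_pow_map_def quot_pow_def
  using assms pow_ideal_Suc_subset[OF assms, of n]
  by (intro quot_map_hom ring_axioms pow_ideal) (auto simp: ring_hom_def)

lemma completion_tower: "a \<in> carrier R \<Longrightarrow> cring_tower (quot_pow R a) (quot_pow_map R a)"
  by (simp add: cring_tower_def quot_pow_cring quot_pow_map_hom)

lemma adic_completion_cring: "a \<in> carrier R \<Longrightarrow> cring (adic_completion R a)"
  unfolding adic_completion_def by (rule cring_tower.proj_lim_cring[OF completion_tower])

lemma quot_pow_coset_hom:
  "a \<in> carrier R \<Longrightarrow> (+>) (PIdl (a [^] (n::nat))) \<in> ring_hom R (quot_pow R a n)"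
  unfolding quot_pow_def by (intro ideal.rcos_ring_hom pow_ideal)

lemma to_completion_hom:
  assumes a: "a \<in> carrier R"
  shows "to_completion R a \<in> ring_hom R (adic_completion R a)"
proof -
  note h = quot_pow_coset_hom[OF a]
  show ?thesis
    unfolding to_completion_def adic_completion_def
    using quot_pow_map_coset[OF a]
    by (intro ring_hom_memI)
      (simp_all add: proj_lim_ring_simps ring_hom_closed[OF h] ring_hom_mult[OF h]
        ring_hom_add[OF h] ring_hom_one[OF h])
qed

context
  fixes \<Sigma> assumes \<Sigma>: "\<Sigma> \<subseteq> carrier R"
begin

lemma A_prod_cring: "cring (A_prod R \<Sigma> n)"
  unfolding A_prod_def using \<Sigma> by (intro prod_ring_cring quot_pow_cring) auto

lemma A_sum_ideal: "ideal (A_sum R \<Sigma> n) (A_prod R \<Sigma> n)"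
  unfolding A_prod_def A_sum_def using \<Sigma> by (intro dirsum_ideal_ideal quot_pow_cring) auto

lemma A_ring_cring: "cring (A_ring R \<Sigma> n)"
  unfolding A_ring_def by (intro ideal.quotient_is_cring A_sum_ideal A_prod_cring)

abbreviation A_prod_map where
  "A_prod_map n f \<equiv> \<lambda>a\<in>\<Sigma>. quot_pow_map R a n (f a)"

lemma A_prod_map_hom: "A_prod_map n \<in> ring_hom (A_prod R \<Sigma> (Suc n)) (A_prod R \<Sigma> n)"
proof -
  have h: "quot_pow_map R a n \<in> ring_hom (quot_pow R a (Suc n)) (quot_pow R a n)" if "a \<in> \<Sigma>" for a
    using that \<Sigma> by (intro quot_pow_map_hom) auto
  show ?thesis
    unfolding A_prod_def prod_ring_simps
    by (rule ring_hom_memI; unfold prod_ring_simps)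
      (auto simp: PiE_iff ring_hom_mult[OF h] ring_hom_add[OF h] ring_hom_one[OF h]
        intro!: restrict_ext ring_hom_closed[OF h])
qed

text \<open>The map at each place sends zero to zero, so supports can only shrink.\<close>

lemma A_prod_map_A_sum: "A_prod_map n ` A_sum R \<Sigma> (Suc n) \<subseteq> A_sum R \<Sigma> n"
proof
  fix g assume "g \<in> A_prod_map n ` A_sum R \<Sigma> (Suc n)"
  then obtain f where f: "f \<in> A_sum R \<Sigma> (Suc n)" "g = A_prod_map n f" by auto
  have "quot_pow_map R a n \<zero>\<^bsub>quot_pow R a (Suc n)\<^esub> = \<zero>\<^bsub>quot_pow R a n\<^esub>" if "a \<in> \<Sigma>" for a
  proof (rule ring_hom_zero[OF quot_pow_map_hom])
  qed (use that \<Sigma> in \<open>auto intro: cring.axioms(1) quot_pow_cring\<close>)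
  then have "{a \<in> \<Sigma>. g a \<noteq> \<zero>\<^bsub>quot_pow R a n\<^esub>} \<subseteq> {a \<in> \<Sigma>. f a \<noteq> \<zero>\<^bsub>quot_pow R a (Suc n)\<^esub>}"
    using f(2) by auto
  then show "g \<in> A_sum R \<Sigma> n"
    using f ring_hom_closed[OF A_prod_map_hom, of f n]
      finite_subset[of _ "{a \<in> \<Sigma>. f a \<noteq> \<zero>\<^bsub>quot_pow R a (Suc n)\<^esub>}"]
    by (simp add: A_sum_def dirsum_ideal_def A_prod_def)
qed

lemma A_map_coset:
  assumes "f \<in> carrier (A_prod R \<Sigma> (Suc n))"
  shows "A_map R \<Sigma> n (A_sum R \<Sigma> (Suc n) +>\<^bsub>A_prod R \<Sigma> (Suc n)\<^esub> f) =
    A_sum R \<Sigma> n +>\<^bsub>A_prod R \<Sigma> n\<^esub> A_prod_map n f"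
  unfolding A_map_def
  by (intro quot_map_coset A_prod_cring[THEN cring.axioms(1)] A_sum_ideal A_prod_map_hom A_prod_map_A_sum assms)

lemma A_hat_tower: "cring_tower (A_ring R \<Sigma>) (A_map R \<Sigma>)"
proof (rule cring_tower.intro)
  show "A_map R \<Sigma> n \<in> ring_hom (A_ring R \<Sigma> (Suc n)) (A_ring R \<Sigma> n)" for n
    unfolding A_map_def A_ring_def
    by (intro quot_map_hom A_prod_cring[THEN cring.axioms(1)] A_sum_ideal A_prod_map_hom A_prod_map_A_sum)
qed (rule A_ring_cring)

lemma A_hat_cring: "cring (A_hat R \<Sigma>)"
  unfolding A_hat_def by (rule cring_tower.proj_lim_cring[OF A_hat_tower])

lemma A_ring_coset_hom:
  "(+>\<^bsub>A_prod R \<Sigma> n\<^esub>) (A_sum R \<Sigma> n) \<in> ring_hom (A_prod R \<Sigma> n) (A_ring R \<Sigma> n)"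
  unfolding A_ring_def by (intro ideal.rcos_ring_hom A_sum_ideal)

lemma A_prod_level_hom:
  "(\<lambda>c. \<lambda>a\<in>\<Sigma>. c a n) \<in> ring_hom (prod_ring \<Sigma> (adic_completion R)) (A_prod R \<Sigma> n)"
  by (rule ring_hom_memI)
    (simp_all add: A_prod_def adic_completion_def prod_ring_simps proj_lim_ring_simps PiE_iff cong: restrict_cong)

text \<open>At each level the projection is evaluation at that level followed by passage to the
  quotient by the direct sum; compatibility with the transition maps is inherited from the coherent
  sequences at the individual places.\<close>

lemma A_proj_hom: "A_proj R \<Sigma> \<in> ring_hom (prod_ring \<Sigma> (adic_completion R)) (A_hat R \<Sigma>)"
proof -
  note comp = ring_hom_trans[OF A_prod_level_hom A_ring_coset_hom, unfolded o_def]
  show ?thesis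
  proof (rule ring_hom_memI)
    fix c assume c: "c \<in> carrier (prod_ring \<Sigma> (adic_completion R))"
    have "A_map R \<Sigma> n (A_proj R \<Sigma> c (Suc n)) = A_proj R \<Sigma> c n" for n
    proof -
      have "A_prod_map n (\<lambda>a\<in>\<Sigma>. c a (Suc n)) = (\<lambda>a\<in>\<Sigma>. c a n)"
        using c by (simp add: prod_ring_simps adic_completion_def proj_lim_ring_simps PiE_iff cong: restrict_cong)
      then show ?thesis
        unfolding A_proj_def using A_map_coset ring_hom_closed[OF A_prod_level_hom c] by simp
    qed
    then show "A_proj R \<Sigma> c \<in> carrier (A_hat R \<Sigma>)"
      using ring_hom_closed[OF comp c] by (simp add: A_proj_def A_hat_def proj_lim_ring_simps)
    fix d assume d: "d \<in> carrier (prod_ring \<Sigma> (adic_completion R))"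
    show "A_proj R \<Sigma> (c \<otimes>\<^bsub>prod_ring \<Sigma> (adic_completion R)\<^esub> d) = A_proj R \<Sigma> c \<otimes>\<^bsub>A_hat R \<Sigma>\<^esub> A_proj R \<Sigma> d"
      using ring_hom_mult[OF comp c d] by (simp add: A_proj_def A_hat_def proj_lim_ring_simps)
    show "A_proj R \<Sigma> (c \<oplus>\<^bsub>prod_ring \<Sigma> (adic_completion R)\<^esub> d) = A_proj R \<Sigma> c \<oplus>\<^bsub>A_hat R \<Sigma>\<^esub> A_proj R \<Sigma> d"
      using ring_hom_add[OF comp c d] by (simp add: A_proj_def A_hat_def proj_lim_ring_simps)
  next
    show "A_proj R \<Sigma> \<one>\<^bsub>prod_ring \<Sigma> (adic_completion R)\<^esub> = \<one>\<^bsub>A_hat R \<Sigma>\<^esub>"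
      using ring_hom_one[OF comp] by (simp add: A_proj_def A_hat_def proj_lim_ring_simps)
  qed
qed

end

end

section \<open>Sums over chains\<close>

text \<open>If \<open>\<phi> j\<close> collects the chains ending in \<open>j\<close>, the result
  collects their extensions by one column. A column has a weight function instead of an exponent,
  because reflection produces the weights (p - m)^(-l) and expansion produces sums of weights. The
  value at 0 vanishes since summation indices are positive.\<close>

definition col_step :: "'k \<times> (nat \<Rightarrow> 'k) \<Rightarrow> (nat \<Rightarrow> 'k) \<Rightarrow> nat \<Rightarrow> 'k::comm_ring_1" where
  "col_step c \<phi> m = (if m = 0 then 0 else snd c m * (\<Sum>j<m. \<phi> j * fst c ^ (m - j)))"

text \<open>The starting sequence: the empty chain ends at the conventional index m_0 = 0.\<close>

abbreviation delta :: "nat \<Rightarrow> 'k::comm_ring_1" where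
  "delta \<equiv> \<lambda>m. if m = 0 then 1 else 0"

definition increasing :: "nat \<Rightarrow> nat \<Rightarrow> nat list set" where
  "increasing n M = {ms. length ms = n \<and> sorted_wrt (<) ms \<and> set ms \<subseteq> {0<..<M}}"

lemma finite_increasing: "finite (increasing n M)"
  by (rule finite_subset[OF _ finite_lists_length_eq[of "{0<..<M}" n]]) (auto simp: increasing_def)

text \<open>Splitting off the largest index matches \<open>fold\<close>, which processes the last
  column last.\<close>

lemma sum_increasing_Suc:
  "(\<Sum>ms\<in>increasing (Suc n) M. f ms) = (\<Sum>m\<in>{0<..<M}. \<Sum>ms\<in>increasing n m. f (ms @ [m]))"
proof -
  let ?app = "\<lambda>(m, ms). ms @ [m]"
  have "ms \<in> ?app ` Sigma {0<..<M} (increasing n)" if ms_mem: "ms \<in> increasing (Suc n) M" for ms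
  proof -
    obtain ms' m where ms: "ms = ms' @ [m]"
      using ms_mem by (cases ms rule: rev_cases) (simp_all add: increasing_def)
    show ?thesis
      using ms_mem unfolding ms
      by (auto simp: increasing_def sorted_wrt_append subset_iff intro!: image_eqI[of _ _ "(m, ms')"])
  qed
  then have img: "increasing (Suc n) M = ?app ` Sigma {0<..<M} (increasing n)"
    by (fastforce simp: increasing_def sorted_wrt_append)
  have "(\<Sum>ms\<in>increasing (Suc n) M. f ms) = (\<Sum>(m, ms)\<in>Sigma {0<..<M} (increasing n). f (ms @ [m]))"
    unfolding img by (subst sum.reindex) (auto simp: inj_on_def case_prod_unfold)
  then show ?thesis by (simp add: sum.Sigma finite_increasing)
qed

text \<open>Weighting by a function of the last index makes the induction on the number of columns go through.\<close>

lemma sum_increasing_chain: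
  assumes "0 < M"
  shows "(\<Sum>ms\<in>increasing (length cols) M.
      (\<Prod>i<length cols. fst (cols ! i) ^ (ms ! i - (0 # ms) ! i) * snd (cols ! i) (ms ! i)) * \<psi> (last (0 # ms)))
    = (\<Sum>j<M. fold col_step cols delta j * \<psi> j)"
  using assms
proof (induction cols arbitrary: M \<psi> rule: rev_induct)
  case Nil
  \<comment> \<open>\<open>0 < M\<close> makes the index 0, where the empty chain ends, count on the
    right.\<close>
  have "increasing 0 M = {[]}" by (auto simp: increasing_def)
  then show ?case using Nil by (simp add: if_distrib[of "\<lambda>x. x * _"] sum.delta cong: if_cong)
next
  case (snoc c cols)
  let ?t = "\<lambda>ms. \<Prod>i<length cols. fst (cols ! i) ^ (ms ! i - (0 # ms) ! i) * snd (cols ! i) (ms ! i)"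
  have "(\<Prod>i<length (cols @ [c]). fst ((cols @ [c]) ! i) ^ ((ms @ [m]) ! i - (0 # ms @ [m]) ! i) *
          snd ((cols @ [c]) ! i) ((ms @ [m]) ! i)) * \<psi> (last (0 # ms @ [m]))
      = ?t ms * (fst c ^ (m - last (0 # ms)) * snd c m * \<psi> m)"
    if "ms \<in> increasing (length cols) m" for m ms
  proof -
    have len: "length ms = length cols" using that by (simp add: increasing_def)
    have "(0 # ms @ [m]) ! length cols = last (0 # ms)"
      using len by (cases ms rule: rev_cases) (auto simp: nth_append nth_Cons split: nat.splits)
    moreover have "(0 # ms @ [m]) ! i = (0 # ms) ! i" if "i < length cols" for i
      using len that by (cases i) (auto simp: nth_append)
    ultimately show ?thesis
      using len by (simp add: nth_append mult_ac)
  qed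
  then have "(\<Sum>ms\<in>increasing (length (cols @ [c])) M.
      (\<Prod>i<length (cols @ [c]). fst ((cols @ [c]) ! i) ^ (ms ! i - (0 # ms) ! i) *
          snd ((cols @ [c]) ! i) (ms ! i)) * \<psi> (last (0 # ms))) =
      (\<Sum>m\<in>{0<..<M}. \<Sum>ms\<in>increasing (length cols) m. ?t ms * (fst c ^ (m - last (0 # ms)) * snd c m * \<psi> m))"
    by (simp add: sum_increasing_Suc del: prod.lessThan_Suc)
  \<comment> \<open>Everything that depends on the new index \<open>m\<close> goes into the weight,
    so the induction hypothesis applies with bound \<open>m\<close> in place of
    \<open>M\<close>.\<close>
  also have "\<dots> = (\<Sum>m\<in>{0<..<M}. \<Sum>j<m. fold col_step cols delta j * (fst c ^ (m - j) * snd c m * \<psi> m))"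
    by (intro sum.cong refl snoc.IH) auto
  also have "\<dots> = (\<Sum>m\<in>{0<..<M}. fold col_step (cols @ [c]) delta m * \<psi> m)"
    by (intro sum.cong refl)
      (auto simp: col_step_def sum_distrib_left sum_distrib_right mult_ac)
  also have "\<dots> = (\<Sum>m<M. fold col_step (cols @ [c]) delta m * \<psi> m)"
    by (rule sum.mono_neutral_left) (auto simp: col_step_def)
  finally show ?case .
qed

text \<open>The truncated sum with values in a type-class ring: \<open>iv m\<close> plays the role
  of 1/m, and \<open>h\<close> interprets the entries, which themselves stay in the coefficient
  ring.\<close>

definition polylog_sum :: "(nat \<Rightarrow> 'k) \<Rightarrow> ('z \<Rightarrow> 'k) \<Rightarrow> nat \<Rightarrow> 'z symbol \<Rightarrow> 'k::comm_ring_1" where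
  "polylog_sum iv h M \<sigma> = (\<Sum>ms\<in>increasing (length \<sigma>) M.
     \<Prod>i<length \<sigma>. h (fst (\<sigma> ! i)) ^ (ms ! i - (0 # ms) ! i) * iv (ms ! i) ^ snd (\<sigma> ! i))"

abbreviation symbol_cols :: "(nat \<Rightarrow> 'k) \<Rightarrow> ('z \<Rightarrow> 'k) \<Rightarrow> 'z symbol \<Rightarrow> ('k \<times> (nat \<Rightarrow> 'k::comm_ring_1)) list" where
  "symbol_cols iv h \<equiv> map (\<lambda>(a, k). (h a, \<lambda>m. iv m ^ k))"

lemma polylog_sum_chain:
  assumes "0 < M"
  shows "polylog_sum iv h M \<sigma> = (\<Sum>m<M. fold col_step (symbol_cols iv h \<sigma>) delta m)"
  using sum_increasing_chain[OF assms, of "symbol_cols iv h \<sigma>" "\<lambda>_. 1"]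
  by (simp add: polylog_sum_def case_prod_unfold)

section \<open>Shuffles\<close>

text \<open>The shuffle as a list in which a word occurs as often as it arises; words are written in
  reverse order throughout.\<close>

fun shuffle_list :: "'z list \<Rightarrow> 'z list \<Rightarrow> 'z list list" where
  "shuffle_list [] v = [v]"
| "shuffle_list u [] = [u]"
| "shuffle_list (z # u) (z' # v) =
    map ((#) z') (shuffle_list (z # u) v) @ map ((#) z) (shuffle_list u (z' # v))"

lemma set_shuffle_list:
  "w \<in> set (shuffle_list u v) \<Longrightarrow> set w = set u \<union> set v"
  by (induction u v arbitrary: w rule: shuffle_list.induct) auto

text \<open>In reverse order the last entry is the first letter of the word. Words that do not start
  with e_0 are those of symbols, and shuffling does not leave this class.\<close>

lemma last_shuffle_list:
  assumes "u = [] \<or> last u \<noteq> z0" "v = [] \<or> last v \<noteq> z0" "w \<in> set (shuffle_list u v)"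
  shows "w = [] \<or> last w \<noteq> z0"
  using assms
proof (induction u v arbitrary: w rule: shuffle_list.induct)
  case (3 z u z' v)
  from 3(5) consider w' where "w = z' # w'" "w' \<in> set (shuffle_list (z # u) v)"
    | w' where "w = z # w'" "w' \<in> set (shuffle_list u (z' # v))" by auto
  then show ?case
  proof cases
    case 1
    with 3(3,4) 3(1)[of w'] set_shuffle_list[OF 1(2)] show ?thesis by (auto split: if_splits)
  next
    case 2
    with 3(3,4) 3(2)[of w'] set_shuffle_list[OF 2(2)] show ?thesis by (auto split: if_splits)
  qed
qed auto

lemma shuffle_rev_list:
  "shuffle_rev u v = (\<Sum>w\<leftarrow>shuffle_list u v. word_mono (Word (rev w)))"
proof -
  have app: "word_mono (Word (rev w)) * letter z = word_mono (Word (rev (z # w)))" for z :: 'a and w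
    by (simp add: word_mono_def mult_single plus_word_def)
  show ?thesis
    by (induction u v rule: shuffle_list.induct)
      (simp_all add: app o_def flip: sum_list_mult_const del: rev.simps)
qed

text \<open>The coefficients of the iterated integral of a word, whose letters are given in reverse order;
  \<open>e\<^sub>0\<close> stands for \<open>dt/t\<close> and \<open>e\<^sub>z\<close> for \<open>h z dt/(1 - h z t)\<close>.\<close>

fun wcoef :: "(nat \<Rightarrow> 'k) \<Rightarrow> ('z::zero \<Rightarrow> 'k) \<Rightarrow> 'z list \<Rightarrow> nat \<Rightarrow> 'k::comm_ring_1" where
  "wcoef iv h [] m = delta m"
| "wcoef iv h (z # u) m = (if m = 0 then 0 else
    iv m * (if z = 0 then wcoef iv h u m else \<Sum>j<m. wcoef iv h u j * h z ^ (m - j)))"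

text \<open>A column contributes e_a e_0^(k-1): the letter e_a performs the chain step with weight
  1/m, and each e_0 adds a further factor 1/m.\<close>

lemma wcoef_symbol:
  assumes "\<sigma> \<in> symbols"
  shows "wcoef iv h (rev (letters (symbol_word \<sigma>))) = fold col_step (symbol_cols iv h \<sigma>) delta"
  using assms
proof (induction \<sigma> rule: rev_induct)
  case Nil
  show ?case by (rule ext) (simp add: symbol_word_def)
next
  case (snoc c \<sigma>)
  obtain a k where c: "c = (a, Suc k)" "a \<noteq> 0"
    using snoc.prems by (cases c) (auto simp: symbols_def gr0_conv_Suc)
  have IH: "wcoef iv h (rev (letters (symbol_word \<sigma>))) = fold col_step (symbol_cols iv h \<sigma>) delta"
    using snoc by (simp add: symbols_def)
  have "wcoef iv h (replicate j 0 @ a # u) m = col_step (h a, \<lambda>m. iv m ^ Suc j) (wcoef iv h u) m" for j u m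
    by (induction j) (simp_all add: c(2) col_step_def)
  then show ?case
    by (intro ext) (simp add: c symbol_word_def flip: IH del: power_Suc)
qed

text \<open>Inverses of all positive integers are required, as the series of iterated integrals have
  coefficients in every degree.\<close>

locale nat_inverses =
  fixes iv :: "nat \<Rightarrow> 'k::comm_ring_1"
  assumes of_nat_inverse: "0 < m \<Longrightarrow> of_nat m * iv m = 1"
begin

text \<open>The operator t d/dt multiplies the coefficient of degree n by n, which can be cancelled
  for n > 0; only the constant term is lost.\<close>

lemma fps_eqI_deriv:
  assumes "fps_nth F 0 = fps_nth G 0" "fps_X * fps_deriv F = fps_X * fps_deriv (G :: 'k fps)"
  shows "F = G"
proof (rule fps_ext)
  fix n
  show "fps_nth F n = fps_nth G n"
  proof (cases n)
    case (Suc m)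
    have "of_nat n * fps_nth F n = of_nat n * fps_nth G n"
      using arg_cong[OF assms(2), of "\<lambda>F. fps_nth F n"] Suc by simp
    then have "(iv n * of_nat n) * fps_nth F n = (iv n * of_nat n) * fps_nth G n" by (simp only: mult.assoc)
    then show ?thesis using of_nat_inverse[of n] Suc by (simp add: mult.commute)
  qed (simp add: assms(1))
qed

context
  fixes h :: "'z::zero \<Rightarrow> 'k"
begin

abbreviation word_series :: "'z list \<Rightarrow> 'k fps" where
  "word_series u \<equiv> Abs_fps (wcoef iv h u)"

text \<open>The differential form of the letter divided by dt/t: 1 for e_0, and h z t/(1 - h z t)
  otherwise.\<close>

definition letter_series :: "'z \<Rightarrow> 'k fps" where
  "letter_series z = (if z = 0 then 1 else Abs_fps (\<lambda>j. if j = 0 then 0 else h z ^ j))"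

text \<open>In degree 0 the two sides would differ for the single letter e_0, since dt/t has no
  integral among power series; the assumption excludes it.\<close>

lemma deriv_word_series:
  assumes "last (z # u) \<noteq> 0"
  shows "fps_X * fps_deriv (word_series (z # u)) = word_series u * letter_series z"
proof (rule fps_ext)
  fix m
  have lhs: "fps_nth (fps_X * fps_deriv (word_series (z # u))) m = of_nat m * wcoef iv h (z # u) m"
    by (cases m) simp_all
  show "fps_nth (fps_X * fps_deriv (word_series (z # u))) m = fps_nth (word_series u * letter_series z) m"
  proof (cases "m = 0")
    case True
    then show ?thesis using assms by (cases u) (auto simp: letter_series_def)
  next
    case False
    have "(\<Sum>j=0..m. wcoef iv h u j * (if m - j = 0 then 0 else h z ^ (m - j)))
        = (\<Sum>j<m. wcoef iv h u j * h z ^ (m - j))"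
      by (rule sum.mono_neutral_cong_right) auto
    moreover have "of_nat m * (iv m * y) = y" for y
      using of_nat_inverse[of m] False by (simp flip: mult.assoc)
    ultimately show ?thesis
      using False unfolding lhs
      by (cases "z = 0") (simp_all add: letter_series_def, simp add: fps_mult_nth)
  qed
qed

text \<open>Induction via the product rule: the derivation \<open>t d/dt\<close> splits off the last letter.\<close>

lemma word_series_mult:
  assumes "u = [] \<or> last u \<noteq> 0" "v = [] \<or> last v \<noteq> 0"
  shows "word_series u * word_series v = (\<Sum>w\<leftarrow>shuffle_list u v. word_series w)"
  using assms
proof (induction u v rule: shuffle_list.induct)
  case (1 v)
  have one: "word_series [] = 1" by (rule fps_ext) simp
  show ?case by (simp add: one del: wcoef.simps)
next
  case (2 z u)
  have one: "word_series [] = 1" by (rule fps_ext) simp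
  show ?case by (simp add: one del: wcoef.simps)
next
  case (3 z u z' v)
  have u: "u = [] \<or> last u \<noteq> 0" and v: "v = [] \<or> last v \<noteq> 0"
    and zu: "last (z # u) \<noteq> 0" and zv: "last (z' # v) \<noteq> 0"
    using 3(3,4) by auto
  let ?W = "word_series" and ?D = "\<lambda>F. fps_X * fps_deriv F"
  have D_sum: "?D (\<Sum>w\<leftarrow>ws. F w) = (\<Sum>w\<leftarrow>ws. ?D (F w))" for ws and F :: "'z list \<Rightarrow> 'k fps"
    by (induction ws) (simp_all add: ring_distribs)
  have L: "?D (?W (y # w)) = ?W w * letter_series y"
    if "y # w \<in> set (shuffle_list (z # u) (z' # v))" for y w
    using deriv_word_series last_shuffle_list[OF 3(3,4) that] by auto
  have "?D (\<Sum>w\<leftarrow>shuffle_list (z # u) (z' # v). ?W w) =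
      (\<Sum>w\<leftarrow>shuffle_list (z # u) v. ?D (?W (z' # w))) + (\<Sum>w\<leftarrow>shuffle_list u (z' # v). ?D (?W (z # w)))"
    by (simp only: D_sum) (simp add: o_def del: wcoef.simps)
  also have "\<dots> = (\<Sum>w\<leftarrow>shuffle_list (z # u) v. ?W w * letter_series z') +
      (\<Sum>w\<leftarrow>shuffle_list u (z' # v). ?W w * letter_series z)"
    by (intro arg_cong2[where f = "(+)"] arg_cong[where f = sum_list] map_cong refl L) auto
  also have "\<dots> = ?W (z # u) * ?W v * letter_series z' + ?W u * ?W (z' # v) * letter_series z"
    using 3 u v by (simp add: sum_list_mult_const del: wcoef.simps)
  also have "\<dots> = (?W u * letter_series z) * ?W (z' # v) + ?W (z # u) * (?W v * letter_series z')"
    by (simp only: ac_simps)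
  also have "\<dots> = ?D (?W (z # u)) * ?W (z' # v) + ?W (z # u) * ?D (?W (z' # v))"
    by (simp only: deriv_word_series[OF zu] deriv_word_series[OF zv])
  also have "\<dots> = ?D (?W (z # u) * ?W (z' # v))"
    unfolding fps_deriv_mult by (simp only: ring_distribs ac_simps)
  finally have D: "?D (?W (z # u) * ?W (z' # v)) = ?D (\<Sum>w\<leftarrow>shuffle_list (z # u) (z' # v). ?W w)" ..
  \<comment> \<open>It remains to compare constant terms; they vanish because all words involved are
    nonempty.\<close>
  have "fps_nth (\<Sum>w\<leftarrow>ws. ?W (f w)) 0 = (\<Sum>w\<leftarrow>ws. wcoef iv h (f w) 0)" for f and ws :: "'z list list"
    by (induction ws) simp_all
  then show ?case
    by (intro fps_eqI_deriv[OF _ D]) (simp add: o_def)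
qed

text \<open>The coefficients of degree below \<open>M\<close> of a product are convolutions over i +
  j < M; for \<open>M\<close> = p this is where the coupling of the two chains comes from.\<close>

lemma sum_wcoef_shuffle:
  assumes "u = [] \<or> last u \<noteq> 0" "v = [] \<or> last v \<noteq> 0"
  shows "(\<Sum>w\<leftarrow>shuffle_list u v. \<Sum>m<M. wcoef iv h w m) =
    (\<Sum>(i, j)\<in>{(i, j). i + j < M}. wcoef iv h u i * wcoef iv h v j)"
proof -
  have "(\<Sum>w\<leftarrow>ws. \<Sum>m<M. wcoef iv h w m) = (\<Sum>m<M. fps_nth (\<Sum>w\<leftarrow>ws. word_series w) m)" for ws
    by (induction ws) (simp_all add: sum.distrib)
  then show ?thesis
    by (simp add: sum.triangle_reindex fps_mult_nth atLeast0AtMost flip: word_series_mult[OF assms])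
qed

end

end

section \<open>Reflection\<close>

text \<open>Two chains approach each other: the first ends in i, the reflected second one would
  continue with p - j > i, and \<open>z\<close> is the base belonging to the gap between
  them.\<close>

definition paired_sum :: "nat \<Rightarrow> 'k \<Rightarrow> (nat \<Rightarrow> 'k) \<Rightarrow> (nat \<Rightarrow> 'k) \<Rightarrow> 'k::comm_ring_1" where
  "paired_sum p z \<phi> \<psi> = (\<Sum>(i, j)\<in>{(i, j). i + j < p}. \<phi> i * \<psi> j * z ^ (p - i - j))"

lemma finite_triangle: "finite {(i, j). i + j < (p::nat)}"
  by (rule finite_subset[of _ "{..<p} \<times> {..<p}"]) auto

text \<open>Substituting \<open>j \<mapsto> p - j\<close> for the last index of the second chain makes it the next index
  of the first chain.\<close>

lemma paired_sum_col_step: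
  "paired_sum p z \<phi> (col_step (y, w) \<psi>) = paired_sum p y (col_step (z, \<lambda>m. w (p - m)) \<phi>) \<psi>"
proof -
  let ?T = "{(i, j). i + j < p}"
  have "paired_sum p z \<phi> (col_step (y, w) \<psi>) =
      (\<Sum>((i, j), h)\<in>Sigma ?T (\<lambda>(i, j). {..<j}). \<phi> i * z ^ (p - i - j) * w j * \<psi> h * y ^ (j - h))"
    unfolding paired_sum_def
    by (subst sum.Sigma[symmetric])
      (auto simp: finite_triangle col_step_def sum_distrib_left sum_distrib_right mult_ac intro!: sum.cong)
  \<comment> \<open>With n = p - j, the condition i + j < p becomes i < n, and h < j becomes n + h <
    p.\<close>
  also have "\<dots> = (\<Sum>((n, h), i)\<in>Sigma ?T (\<lambda>(n, h). {..<n}).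
      \<phi> i * z ^ (n - i) * w (p - n) * \<psi> h * y ^ (p - n - h))"
    by (rule sum.reindex_bij_witness[of _ "\<lambda>((n, h), i). ((i, p - n), h)" "\<lambda>((i, j), h). ((p - j, h), i)"])
      (auto simp: algebra_simps)
  also have "\<dots> = paired_sum p y (col_step (z, \<lambda>m. w (p - m)) \<phi>) \<psi>"
    unfolding paired_sum_def
    by (subst sum.Sigma[symmetric])
      (auto simp: finite_triangle col_step_def sum_distrib_left sum_distrib_right mult_ac intro!: sum.cong)
  finally show ?thesis .
qed

text \<open>Once the second chain is used up, only the gap up to p remains, with base
  \<open>z\<close>.\<close>

lemma paired_sum_delta: "paired_sum p z \<phi> delta = (\<Sum>i<p. \<phi> i * z ^ (p - i))"
proof -
  have "paired_sum p z \<phi> delta = (\<Sum>(i, j)\<in>{..<p} \<times> {0}. \<phi> i * z ^ (p - i - j))"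
    unfolding paired_sum_def by (rule sum.mono_neutral_cong_right) (auto simp: finite_triangle split: if_splits)
  also have "\<dots> = (\<Sum>i<p. \<phi> i * z ^ (p - i))" by (simp flip: sum.cartesian_product)
  finally show ?thesis .
qed

text \<open>The columns of the second chain are moved from last to first, which reverses their
  order. Each transfer leaves the base of the moved column behind for the next gap; hence the shift
  from \<open>y j\<close> to \<open>y (j + 1)\<close>, with \<open>z\<close> in the first gap and
  \<open>y 1\<close> in the gap up to p.\<close>

lemma paired_sum_chain:
  "paired_sum p z \<phi> (fold col_step (map (\<lambda>j. (y j, w j)) [1..<s + 1]) delta) =
    (\<Sum>i<p. fold col_step (map (\<lambda>j. (if j = s then z else y (j + 1), \<lambda>m. w j (p - m))) (rev [1..<s + 1])) \<phi> i
      * (if s = 0 then z else y 1) ^ (p - i))"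
proof (induction s arbitrary: z \<phi>)
  case 0
  then show ?case by (simp add: paired_sum_delta)
next
  case (Suc s)
  have upt: "[1..<Suc s + 1] = [1..<s + 1] @ [Suc s]" by simp
  have cols: "map (\<lambda>j. (if j = s then y (Suc s) else y (j + 1), \<lambda>m. w j (p - m))) (rev [1..<s + 1]) =
      map (\<lambda>j. (if j = Suc s then z else y (j + 1), \<lambda>m. w j (p - m))) (rev [1..<s + 1])"
    by (rule map_cong) auto
  have y1: "(if s = 0 then y (Suc s) else y 1) = (if Suc s = 0 then z else y 1)" by simp
  have "paired_sum p z \<phi> (fold col_step (map (\<lambda>j. (y j, w j)) [1..<Suc s + 1]) delta) =
      paired_sum p (y (Suc s)) (col_step (z, \<lambda>m. w (Suc s) (p - m)) \<phi>)
        (fold col_step (map (\<lambda>j. (y j, w j)) [1..<s + 1]) delta)"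
    unfolding upt by (simp add: paired_sum_col_step del: upt_Suc)
  then show ?case
    unfolding Suc.IH cols y1 upt by (simp del: upt_Suc)
qed

text \<open>The gaps of a chain ending in \<open>m\<close> add up to \<open>m\<close>, so a factor
  \<open>c\<close> in every base amounts to \<open>c ^ m\<close>.\<close>

lemma fold_col_step_rescale:
  assumes "\<And>m. \<phi>' m = c ^ m * \<phi> m"
  shows "fold col_step (map (\<lambda>(a, w). (a * c, w)) cols) \<phi>' m = c ^ m * fold col_step cols \<phi> m"
  using assms
proof (induction cols arbitrary: \<phi> \<phi>')
  case (Cons col cols)
  obtain a w where col: "col = (a, w)" by fastforce
  have "c ^ j * (a * c) ^ (m - j) = a ^ (m - j) * c ^ m" if "j < m" for j m
  proof -
    have "c ^ j * (a * c) ^ (m - j) = a ^ (m - j) * (c ^ j * c ^ (m - j))"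
      by (simp add: power_mult_distrib mult_ac)
    then show ?thesis using that by (simp flip: power_add)
  qed
  then have "col_step (a * c, w) \<phi>' m = c ^ m * col_step (a, w) \<phi> m" for m
    using Cons.prems
    by (auto simp: col_step_def sum_distrib_left mult_ac intro!: sum.cong)
  then have "fold col_step (map (\<lambda>(a, w). (a * c, w)) cols) (col_step (a * c, w) \<phi>') m =
      c ^ m * fold col_step cols (col_step (a, w) \<phi>) m"
    by (rule Cons.IH)
  then show ?case by (simp add: col)
qed simp

text \<open>As \<open>c\<close> is inverse to \<open>y 1\<close>, the gap up to p gives
  \<open>y 1 ^ (p - i) = y 1 ^ p * c ^ i\<close>, and \<open>c ^ i\<close> can be spread over the
  bases of all columns.\<close>

lemma paired_sum_chain_rescale:
  assumes "1 \<le> s" "y 1 * c = (1 :: 'k::comm_ring_1)"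
  shows "paired_sum p 1 (fold col_step cols delta) (fold col_step (map (\<lambda>j. (y j, w j)) [1..<s + 1]) delta) =
    y 1 ^ p * (\<Sum>i<p. fold col_step (map (\<lambda>(a, w). (a * c, w)) cols @
      map (\<lambda>j. ((if j = s then 1 else y (j + 1)) * c, \<lambda>m. w j (p - m))) (rev [1..<s + 1])) delta i)"
proof -
  let ?tail = "map (\<lambda>j. (if j = s then 1 else y (j + 1), \<lambda>m. w j (p - m))) (rev [1..<s + 1])"
  have tail: "map (\<lambda>j. ((if j = s then 1 else y (j + 1)) * c, \<lambda>m. w j (p - m))) (rev [1..<s + 1]) =
      map (\<lambda>(a, w). (a * c, w)) ?tail" by simp
  have "y 1 ^ (p - i) = y 1 ^ p * c ^ i" if "i < p" for i
  proof -
    have "y 1 ^ p * c ^ i = y 1 ^ (p - i) * (y 1 * c) ^ i"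
      using that by (simp add: power_mult_distrib flip: mult.assoc power_add)
    then show ?thesis using assms(2) by simp
  qed
  moreover have "fold col_step (map (\<lambda>(a, w). (a * c, w)) cols @
      map (\<lambda>j. ((if j = s then 1 else y (j + 1)) * c, \<lambda>m. w j (p - m))) (rev [1..<s + 1])) delta i =
      c ^ i * fold col_step (cols @ ?tail) delta i" for i
    unfolding tail map_append[symmetric] by (rule fold_col_step_rescale) simp
  ultimately show ?thesis
    unfolding paired_sum_chain using assms(1)
    by (auto simp: sum_distrib_left mult_ac intro!: sum.cong)
qed

section \<open>Multilinearity and congruences\<close>

lemma fold_col_step_scale:
  "fold col_step (map (\<lambda>(a, j). (a, \<lambda>m. c j * w j m)) \<tau>) \<phi> m =
    (\<Prod>(a, j)\<leftarrow>\<tau>. c j) * fold col_step (map (\<lambda>(a, j). (a, w j)) \<tau>) \<phi> m"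
proof (induction \<tau> arbitrary: m rule: rev_induct)
  case (snoc t \<tau>)
  then show ?case
    by (cases t) (auto simp: col_step_def sum_distrib_left mult_ac intro!: sum.cong)
qed simp

text \<open>Each weight enters linearly. The labels \<open>j\<close> of the columns are distinct, so
  a function on labels chooses the weights of the columns independently.\<close>

lemma fold_col_step_multilinear:
  assumes "distinct (map snd \<tau>)" "\<And>j. finite (B j)"
  shows "(\<Sum>f\<in>(\<Pi>\<^sub>E j\<in>snd ` set \<tau>. B j). fold col_step (map (\<lambda>(a, j). (a, w j (f j))) \<tau>) \<phi> m) =
    fold col_step (map (\<lambda>(a, j). (a, \<lambda>m. \<Sum>t\<in>B j. w j t m)) \<tau>) \<phi> m"
  using assms(1)
proof (induction \<tau> arbitrary: m rule: rev_induct)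
  case (snoc c \<tau>)
  obtain a j where c: "c = (a, j)" by fastforce
  let ?J = "snd ` set \<tau>"
  let ?F = "\<lambda>f. fold col_step (map (\<lambda>(a, j). (a, w j (f j))) \<tau>) \<phi>"
  have j: "j \<notin> ?J" using snoc.prems c by auto
  \<comment> \<open>No earlier column has the label \<open>j\<close>, so the chain over
    \<open>\<tau>\<close> ignores the value chosen there.\<close>
  have upd: "?F (g(j := t)) = ?F g" for g t
  proof -
    have "map (\<lambda>(a, i). (a, w i ((g(j := t)) i))) \<tau> = map (\<lambda>(a, i). (a, w i (g i))) \<tau>"
      by (rule map_cong) (use j in force)+
    then show ?thesis by (simp only:)
  qed
  have fin: "finite (\<Pi>\<^sub>E j\<in>?J. B j)" using assms(2) by (intro finite_PiE) auto
  have "(\<Sum>f\<in>(\<Pi>\<^sub>E j\<in>snd ` set (\<tau> @ [c]). B j). fold col_step (map (\<lambda>(a, j). (a, w j (f j))) (\<tau> @ [c])) \<phi> m)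
      = (\<Sum>f\<in>(\<Pi>\<^sub>E j\<in>insert j ?J. B j). col_step (a, w j (f j)) (?F f) m)"
    by (simp add: c)
  also have "\<dots> = (\<Sum>(t, g)\<in>B j \<times> (\<Pi>\<^sub>E j\<in>?J. B j). col_step (a, w j t) (?F g) m)"
    unfolding PiE_insert_eq
    by (subst sum.reindex) (auto simp: upd inj_combinator j
        simp del: fun_upd_apply simp add: fun_upd_same intro!: sum.cong)
  also have "\<dots> = (\<Sum>t\<in>B j. \<Sum>g\<in>(\<Pi>\<^sub>E j\<in>?J. B j). col_step (a, w j t) (?F g) m)"
    by (simp add: sum.cartesian_product)
  also have "\<dots> = col_step (a, \<lambda>m. \<Sum>t\<in>B j. w j t m) (\<lambda>m. \<Sum>g\<in>(\<Pi>\<^sub>E j\<in>?J. B j). ?F g m) m"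
  proof (cases "m = 0")
    case False
    have "(\<Sum>i<m. (\<Sum>g\<in>(\<Pi>\<^sub>E j\<in>?J. B j). ?F g i) * a ^ (m - i)) =
        (\<Sum>g\<in>(\<Pi>\<^sub>E j\<in>?J. B j). \<Sum>i<m. ?F g i * a ^ (m - i))"
      by (subst sum.swap) (simp add: sum_distrib_right)
    then show ?thesis using False by (simp add: col_step_def sum_product)
  qed (simp add: col_step_def)
  also have "\<dots> = fold col_step (map (\<lambda>(a, j). (a, \<lambda>m. \<Sum>t\<in>B j. w j t m)) (\<tau> @ [c])) \<phi> m"
    using snoc by (simp add: c)
  finally show ?case .
qed simp

text \<open>A subset of a type-class ring instead of a record, so that computations can use the
  arithmetic of the ambient type. Instances are the coefficient ring, the fractions with denominator
  prime to p, and the families of such fractions.\<close>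

locale comm_subring =
  fixes T :: "'k::comm_ring_1 set"
  assumes one_mem: "1 \<in> T"
    and diff_mem: "x \<in> T \<Longrightarrow> y \<in> T \<Longrightarrow> x - y \<in> T"
    and mult_mem: "x \<in> T \<Longrightarrow> y \<in> T \<Longrightarrow> x * y \<in> T"
begin

lemma zero_mem: "0 \<in> T"
  using diff_mem[OF one_mem one_mem] by simp

lemma uminus_mem: "x \<in> T \<Longrightarrow> - x \<in> T"
  using diff_mem[OF zero_mem] by simp

lemma add_mem: "x \<in> T \<Longrightarrow> y \<in> T \<Longrightarrow> x + y \<in> T"
  using diff_mem[OF _ uminus_mem] by fastforce

lemma sum_mem: "(\<And>i. i \<in> I \<Longrightarrow> f i \<in> T) \<Longrightarrow> sum f I \<in> T"
  by (induction I rule: infinite_finite_induct) (auto simp: zero_mem add_mem)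

lemma prod_mem: "(\<And>i. i \<in> I \<Longrightarrow> f i \<in> T) \<Longrightarrow> prod f I \<in> T"
  by (induction I rule: infinite_finite_induct) (auto simp: one_mem mult_mem)

lemma power_mem: "x \<in> T \<Longrightarrow> x ^ n \<in> T"
  by (induction n) (auto simp: one_mem mult_mem)

lemma of_nat_mem: "of_nat n \<in> T"
  by (induction n) (auto simp: zero_mem one_mem add_mem)

lemmas mem_intros = one_mem zero_mem diff_mem uminus_mem add_mem mult_mem sum_mem prod_mem power_mem of_nat_mem

text \<open>The cofactor is taken from \<open>T\<close>: when \<open>T\<close> is
  \<open>localized p\<close>, the integer p > 0 is a unit of the ambient ring, where divisibility by
  its powers would say nothing.\<close>

definition multiples :: "'k \<Rightarrow> 'k set" where
  "multiples q = (*) q ` T"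

lemma multiplesI: "x = q * t \<Longrightarrow> t \<in> T \<Longrightarrow> x \<in> multiples q"
  by (auto simp: multiples_def)

lemma multiples_zero: "0 \<in> multiples q"
  by (rule multiplesI[of _ _ 0]) (simp_all add: zero_mem)

lemma multiples_add: "x \<in> multiples q \<Longrightarrow> y \<in> multiples q \<Longrightarrow> x + y \<in> multiples q"
  unfolding multiples_def by (auto simp: add_mem image_iff intro!: bexI[OF _ add_mem] simp flip: distrib_left)

lemma multiples_mult: "x \<in> multiples q \<Longrightarrow> y \<in> T \<Longrightarrow> x * y \<in> multiples q"
  unfolding multiples_def by (auto simp: image_iff mult.assoc intro!: bexI[OF _ mult_mem])

lemma multiples_sum: "(\<And>i. i \<in> I \<Longrightarrow> f i \<in> multiples q) \<Longrightarrow> sum f I \<in> multiples q"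
  by (induction I rule: infinite_finite_induct) (auto simp: multiples_zero multiples_add)

text \<open>Below p only weights at indices 0 < m < p contribute; this keeps the inverse of p out of
  the truncated sums.\<close>

lemma fold_col_step_mem:
  assumes "\<And>m. m < p \<Longrightarrow> \<phi> m \<in> T" "\<And>a w m. (a, w) \<in> set cols \<Longrightarrow> a \<in> T"
    and "\<And>a w m. (a, w) \<in> set cols \<Longrightarrow> 0 < m \<Longrightarrow> m < p \<Longrightarrow> w m \<in> T" and "m < p"
  shows "fold col_step cols \<phi> m \<in> T"
  using assms
proof (induction cols arbitrary: \<phi>)
  case (Cons c cols)
  obtain a w where c: "c = (a, w)" by fastforce
  have "col_step (a, w) \<phi> m \<in> T" if "m < p" for m
    using that Cons.prems(1) Cons.prems(2)[of a w] Cons.prems(3)[of a w m]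
    by (auto simp: c col_step_def intro!: mem_intros)
  then have "fold col_step cols (col_step (a, w) \<phi>) m \<in> T"
    by (rule Cons.IH) (use Cons.prems(2-4) in \<open>force+\<close>)
  then show ?case by (simp add: c)
qed simp

text \<open>A chain step is the product of a weight and a sum, and congruences pass through it by w
  S - w' S' = (w - w') S + (S - S') w'.\<close>

lemma fold_col_step_congruent:
  assumes "\<And>m. m < p \<Longrightarrow> \<phi> m \<in> T" "\<And>m. m < p \<Longrightarrow> \<phi>' m \<in> T" "\<And>m. m < p \<Longrightarrow> \<phi> m - \<phi>' m \<in> multiples q"
    and "\<And>a j. (a, j) \<in> set \<tau> \<Longrightarrow> a \<in> T"
    and "\<And>a j m. (a, j) \<in> set \<tau> \<Longrightarrow> 0 < m \<Longrightarrow> m < p \<Longrightarrow> w j m \<in> T"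
    and "\<And>a j m. (a, j) \<in> set \<tau> \<Longrightarrow> 0 < m \<Longrightarrow> m < p \<Longrightarrow> w' j m \<in> T"
    and "\<And>a j m. (a, j) \<in> set \<tau> \<Longrightarrow> 0 < m \<Longrightarrow> m < p \<Longrightarrow> w j m - w' j m \<in> multiples q"
    and "m < p"
  shows "fold col_step (map (\<lambda>(a, j). (a, w j)) \<tau>) \<phi> m - fold col_step (map (\<lambda>(a, j). (a, w' j)) \<tau>) \<phi>' m
    \<in> multiples q"
  using assms
proof (induction \<tau> arbitrary: \<phi> \<phi>')
  case (Cons c \<tau>)
  obtain a j where c: "c = (a, j)" by fastforce
  have a: "a \<in> T" and wT: "\<And>m. 0 < m \<Longrightarrow> m < p \<Longrightarrow> w j m \<in> T" "\<And>m. 0 < m \<Longrightarrow> m < p \<Longrightarrow> w' j m \<in> T"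
    "\<And>m. 0 < m \<Longrightarrow> m < p \<Longrightarrow> w j m - w' j m \<in> multiples q"
    using Cons.prems(4)[of a j] Cons.prems(5-7)[of a j] c by auto
  let ?S = "\<lambda>\<phi> m. \<Sum>i<m. \<phi> i * a ^ (m - i)"
  have S: "?S \<phi> m \<in> T" if "m < p" for m
    using that Cons.prems(1) a by (auto intro!: mem_intros)
  have S': "?S \<phi> m - ?S \<phi>' m \<in> multiples q" if "m < p" for m
  proof -
    have "?S \<phi> m - ?S \<phi>' m = (\<Sum>i<m. (\<phi> i - \<phi>' i) * a ^ (m - i))"
      by (simp add: sum_subtractf left_diff_distrib)
    then show ?thesis
      using that Cons.prems(3) a by (auto intro!: multiples_sum multiples_mult mem_intros)
  qed
  have 1: "col_step (a, w j) \<phi> m \<in> T" "col_step (a, w' j) \<phi>' m \<in> T" if "m < p" for m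
    using that a wT Cons.prems(1,2) by (auto simp: col_step_def intro!: mem_intros)
  have 2: "col_step (a, w j) \<phi> m - col_step (a, w' j) \<phi>' m \<in> multiples q" if "m < p" for m
  proof (cases "m = 0")
    case False
    have "col_step (a, w j) \<phi> m - col_step (a, w' j) \<phi>' m =
        (w j m - w' j m) * ?S \<phi> m + (?S \<phi> m - ?S \<phi>' m) * w' j m"
      using False by (simp add: col_step_def algebra_simps)
    then show ?thesis
      using False that S S' wT by (auto intro!: multiples_add multiples_mult)
  qed (simp add: col_step_def multiples_zero)
  have "fold col_step (map (\<lambda>(a, j). (a, w j)) \<tau>) (col_step (a, w j) \<phi>) m -
      fold col_step (map (\<lambda>(a, j). (a, w' j)) \<tau>) (col_step (a, w' j) \<phi>') m \<in> multiples q"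
    by (rule Cons.IH[OF 1 2]) (use Cons.prems(4-8) in \<open>force+\<close>)
  then show ?case by (simp add: c)
qed simp

text \<open>The sum is the truncated series of (1 - q)^(-l), and \<open>U\<close> is the inverse of
  1 - q. In the induction, multiplication by 1 - q lowers the exponent by Pascal's rule and leaves
  one term in q^n.\<close>

lemma negative_binomial_expansion:
  assumes "(1 - q) * U = 1" "q \<in> T" "U \<in> T"
  shows "U ^ l - (\<Sum>f<n. of_nat ((l + f - 1) choose f) * q ^ f) \<in> multiples (q ^ n)"
proof (induction l)
  case 0
  \<comment> \<open>For exponent 0 the truncated subtraction yields \<open>f - 1 choose f\<close>,
    which is 1 for f = 0 and 0 otherwise, as it should be.\<close>
  have "(\<Sum>f<n. of_nat ((0 + f - 1) choose f) * q ^ f) = (\<Sum>f<n. if f = 0 then 1 else 0)"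
    by (intro sum.cong) (auto simp: binomial_eq_0)
  then show ?case
    by (cases n) (auto intro!: multiplesI[of _ _ 1] mem_intros simp: multiples_zero)
next
  case (Suc l)
  have "\<exists>c\<in>T. (1 - q) * (\<Sum>f<n. of_nat ((Suc l + f - 1) choose f) * q ^ f) =
      (\<Sum>f<n. of_nat ((l + f - 1) choose f) * q ^ f) - c * q ^ n" for n
  proof (cases n)
    case (Suc n')
    \<comment> \<open>The telescoping leaves the last binomial coefficient times
      \<open>q ^ Suc n'\<close>.\<close>
    have "(1 - q) * (\<Sum>f<Suc n'. of_nat ((Suc l + f - 1) choose f) * q ^ f) =
      (\<Sum>f<Suc n'. of_nat ((l + f - 1) choose f) * q ^ f) - of_nat ((l + n') choose n') * q ^ Suc n'"
    proof (induction n')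
      case (Suc n')
      have "of_nat (l + Suc n' choose Suc n') =
          (of_nat (l + n' choose n') + of_nat (l + n' choose Suc n') :: 'k)" by simp
      with Suc show ?case
        by (simp only: sum.lessThan_Suc[of _ "Suc n'"] distrib_left) (simp add: algebra_simps)
    qed (simp add: algebra_simps)
    then show ?thesis using Suc of_nat_mem by blast
  qed (auto intro!: bexI[of _ 0] zero_mem)
  then obtain c where c: "c \<in> T" "(1 - q) * (\<Sum>f<n. of_nat ((Suc l + f - 1) choose f) * q ^ f) =
      (\<Sum>f<n. of_nat ((l + f - 1) choose f) * q ^ f) - c * q ^ n" by blast
  obtain t where t: "t \<in> T" "U ^ l - (\<Sum>f<n. of_nat ((l + f - 1) choose f) * q ^ f) = q ^ n * t"
    using Suc by (auto simp: multiples_def)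
  have "U ^ Suc l - (\<Sum>f<n. of_nat ((Suc l + f - 1) choose f) * q ^ f) =
      U * (U ^ l - (1 - q) * (\<Sum>f<n. of_nat ((Suc l + f - 1) choose f) * q ^ f))"
    using assms(1) by (simp add: right_diff_distrib mult.commute flip: mult.assoc)
  also have "\<dots> = U * ((U ^ l - (\<Sum>f<n. of_nat ((l + f - 1) choose f) * q ^ f)) + c * q ^ n)"
    unfolding c(2) by (simp add: algebra_simps)
  also have "\<dots> = q ^ n * (U * (t + c))"
    unfolding t(2) by (simp add: algebra_simps)
  finally show ?case
    using assms(3) t(1) c(1) by (intro multiplesI[of _ _ "U * (t + c)"] mem_intros)
qed

text \<open>Here a = 1/m and b = 1/(p - m), and -b = (1/m) (1 - p/m)^(-1) is expanded in powers of
  p/m.\<close>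

lemma reflected_inverse_expansion:
  assumes "m < p" "of_nat m * a = 1" "of_nat (p - m) * b = 1" "a \<in> T" "b \<in> T"
  shows "(\<Sum>f<n. of_nat ((l + f - 1) choose f) * of_nat p ^ f * a ^ (l + f)) - (- 1) ^ l * b ^ l
    \<in> multiples (of_nat p ^ n)"
proof -
  define q where "q = of_nat p * a"
  \<comment> \<open>\<open>U\<close> is m/(m - p), the inverse of 1 - p/m.\<close>
  define U where "U = - (of_nat m * b)"
  have "(1 - q) * U = (of_nat m * a - q) * U" using assms(2) by simp
  also have "\<dots> = (of_nat m * a) * ((of_nat p - of_nat m) * b)"
    by (simp add: q_def U_def algebra_simps)
  also have "\<dots> = 1" using assms(1-3) by (simp add: of_nat_diff)
  finally have XU: "(1 - q) * U = 1" .
  have b: "- b = a * U" using assms(2) by (simp add: U_def flip: mult.assoc) (simp add: mult.commute)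
  obtain t where t: "t \<in> T" "U ^ l - (\<Sum>f<n. of_nat ((l + f - 1) choose f) * q ^ f) = q ^ n * t"
    using negative_binomial_expansion[OF XU, of l n] assms(4,5)
    by (auto simp: multiples_def q_def U_def mem_intros)
  have "(\<Sum>f<n. of_nat ((l + f - 1) choose f) * of_nat p ^ f * a ^ (l + f)) - (- 1) ^ l * b ^ l =
      (\<Sum>f<n. of_nat ((l + f - 1) choose f) * of_nat p ^ f * a ^ (l + f)) - (- b) ^ l"
    by (simp flip: power_mult_distrib)
  also have "\<dots> = a ^ l * ((\<Sum>f<n. of_nat ((l + f - 1) choose f) * q ^ f) - U ^ l)"
    unfolding b q_def
    by (simp add: power_mult_distrib power_add right_diff_distrib sum_distrib_left mult_ac)
  also have "\<dots> = - (a ^ l * (q ^ n * t))" using t(2) by (simp add: algebra_simps)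
  also have "\<dots> = of_nat p ^ n * - (a ^ l * a ^ n * t)"
    by (simp add: q_def power_mult_distrib mult_ac)
  finally show ?thesis
    using assms(4) t(1) by (intro multiplesI[of _ _ "- (a ^ l * a ^ n * t)"] mem_intros)
qed

end

section \<open>Localization and completion\<close>

text \<open>The bridge from subsets of type-class rings to the ring records of the
  statement.\<close>

definition sub_ring :: "'k::comm_ring_1 set \<Rightarrow> 'k ring" where
  "sub_ring T = \<lparr>carrier = T, mult = (*), one = 1, zero = 0, add = (+)\<rparr>"

lemma sub_ring_simps [simp]:
  "carrier (sub_ring T) = T" "x \<otimes>\<^bsub>sub_ring T\<^esub> y = x * y" "x \<oplus>\<^bsub>sub_ring T\<^esub> y = x + y"
  "\<one>\<^bsub>sub_ring T\<^esub> = 1" "\<zero>\<^bsub>sub_ring T\<^esub> = 0"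
  by (simp_all add: sub_ring_def)

lemma sub_ring_nat_pow [simp]: "x [^]\<^bsub>sub_ring T\<^esub> (n::nat) = x ^ n"
  by (induction n) (simp_all add: mult.commute nat_pow_def)

lemma add_pow_sub_ring [simp]: "[n] \<cdot>\<^bsub>sub_ring T\<^esub> x = of_nat n * x" for n :: nat
  by (induction n) (simp_all add: add_pow_def nat_pow_def algebra_simps)

lemma nat_elt_sub_ring [simp]: "nat_elt (sub_ring T) n = of_nat n"
  by (simp add: nat_elt_def)

context comm_subring
begin

lemma sub_ring_cring: "cring (sub_ring T)"
proof (rule cringI)
  show "abelian_group (sub_ring T)"
    by (rule abelian_groupI)
      (auto simp: zero_mem add_mem algebra_simps intro!: bexI[OF _ uminus_mem])
  show "comm_monoid (sub_ring T)"
    by (rule comm_monoidI) (auto simp: one_mem mult_mem algebra_simps)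
qed (simp add: algebra_simps)

sublocale sub_ring: cring "sub_ring T" by (rule sub_ring_cring)

lemma finsum_sub_ring: "(\<And>i. i \<in> I \<Longrightarrow> f i \<in> T) \<Longrightarrow> finsum (sub_ring T) f I = sum f I"
  by (induction I rule: infinite_finite_induct) (auto simp: Pi_def)

lemma finprod_sub_ring: "(\<And>i. i \<in> I \<Longrightarrow> f i \<in> T) \<Longrightarrow> finprod (sub_ring T) f I = prod f I"
  by (induction I rule: infinite_finite_induct) (auto simp: Pi_def)

lemma inv_sub_ring: "x \<in> T \<Longrightarrow> y \<in> T \<Longrightarrow> x * y = 1 \<Longrightarrow> inv\<^bsub>sub_ring T\<^esub> x = y"
  by (rule sub_ring.comm_inv_char) auto

lemma of_int_mem: "of_int n \<in> T"
  by (cases n rule: int_cases2) (auto simp: of_nat_mem uminus_mem)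

end

lemma nat_elt_hom:
  assumes "ring R" "ring S" "h \<in> ring_hom R S"
  shows "h (nat_elt R n) = nat_elt S n"
proof -
  interpret h: ring_hom_ring R S h by (rule ring_hom_ringI2) fact+
  have "h ([n] \<cdot>\<^bsub>R\<^esub> \<one>\<^bsub>R\<^esub>) = [n] \<cdot>\<^bsub>S\<^esub> \<one>\<^bsub>S\<^esub>"
    by (induction n) (simp_all add: h.R.add.nat_pow_Suc h.S.add.nat_pow_Suc)
  then show ?thesis by (simp add: nat_elt_def)
qed

lemma family_image_cong:
  assumes "\<And>p. p \<in> primes_cong N \<alpha> \<Longrightarrow> c p = d p"
  shows "family_image R N \<alpha> c = family_image R N \<alpha> d"
proof -
  have "prime_of R N \<alpha> a \<in> primes_cong N \<alpha>" if "a \<in> prime_elts R N \<alpha>" for a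
    using that unfolding prime_of_def prime_elts_def by (rule inv_into_into)
  then have "(\<lambda>a\<in>prime_elts R N \<alpha>. c (prime_of R N \<alpha> a)) = (\<lambda>a\<in>prime_elts R N \<alpha>. d (prime_of R N \<alpha> a))"
    using assms by (intro restrict_ext) simp
  then show ?thesis by (simp add: family_image_def)
qed

text \<open>\<open>K\<close> is the coefficient ring and \<open>'k\<close> an ambient ring in which
  positive integers are units. Injectivity of \<open>\<iota>\<close> allows equations between
  fractions to be cleared of denominators and read in \<open>K\<close>.\<close>

locale rational_extension = comm_subring K + nat_inverses iv
  for K :: "'a::comm_ring_1 set" and iv :: "nat \<Rightarrow> 'k::comm_ring_1" +
  fixes \<iota> :: "'a \<Rightarrow> 'k"
  assumes inj_embed: "inj \<iota>" and embed_one: "\<iota> 1 = 1"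
    and embed_diff: "\<iota> (x - y) = \<iota> x - \<iota> y" and embed_mult: "\<iota> (x * y) = \<iota> x * \<iota> y"
begin

abbreviation R where "R \<equiv> sub_ring K"

lemma embed_zero: "\<iota> 0 = 0"
  using embed_diff[of 0 0] by simp

lemma embed_add: "\<iota> (x + y) = \<iota> x + \<iota> y"
  using embed_diff[of x "- y"] embed_diff[of 0 y] embed_zero by simp

lemma embed_of_nat: "\<iota> (of_nat n) = of_nat n"
  by (induction n) (simp_all add: embed_zero embed_one embed_add)

lemma embed_power: "\<iota> (x ^ n) = \<iota> x ^ n"
  by (induction n) (simp_all add: embed_one embed_mult)

text \<open>The fractions with numerator in \<open>K\<close> and denominator prime to p. A fraction
  is expressed by an equation without division, which can be transported to the completion.\<close>

definition localized :: "nat \<Rightarrow> 'k set" where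
  "localized p = {P. \<exists>d c. coprime d p \<and> c \<in> K \<and> of_nat d * P = \<iota> c}"

lemma localizedI: "coprime d p \<Longrightarrow> c \<in> K \<Longrightarrow> of_nat d * P = \<iota> c \<Longrightarrow> P \<in> localized p"
  by (auto simp: localized_def)

lemma localizedE:
  assumes "P \<in> localized p"
  obtains d c where "coprime d p" "c \<in> K" "of_nat d * P = \<iota> c"
  using assms by (auto simp: localized_def)

lemma embed_localized: "c \<in> K \<Longrightarrow> \<iota> c \<in> localized p"
  by (rule localizedI[of 1]) auto

lemma localized_inverse: "prime p \<Longrightarrow> 0 < m \<Longrightarrow> m < p \<Longrightarrow> iv m \<in> localized p"
  by (rule localizedI[of m _ 1])
    (auto simp: of_nat_inverse embed_one one_mem coprime_commute[of m] intro!: prime_imp_coprime dest: dvd_imp_le)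

sublocale localized: comm_subring "localized p" for p
proof
  show "1 \<in> localized p"
    using embed_localized[OF one_mem] by (simp add: embed_one)
next
  fix P Q assume "P \<in> localized p" "Q \<in> localized p"
  then obtain d c e b where *: "coprime d p" "c \<in> K" "of_nat d * P = \<iota> c"
    "coprime e p" "b \<in> K" "of_nat e * Q = \<iota> b"
    by (meson localizedE)
  have "of_nat (d * e) * (P - Q) = of_nat e * (of_nat d * P) - of_nat d * (of_nat e * Q)"
    by (simp add: algebra_simps)
  then show "P - Q \<in> localized p"
    using * by (intro localizedI[of "d * e" _ "of_nat e * c - of_nat d * b"])
      (auto simp: embed_diff embed_mult embed_of_nat intro!: mem_intros)
  have "of_nat (d * e) * (P * Q) = (of_nat d * P) * (of_nat e * Q)"
    by (simp add: algebra_simps)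
  then show "P * Q \<in> localized p"
    using * by (intro localizedI[of "d * e" _ "c * b"]) (auto simp: embed_mult intro!: mem_intros)
qed

section \<open>Fractions in the completion at p\<close>

abbreviation Rp where "Rp p \<equiv> adic_completion R (of_nat p)"
abbreviation \<kappa> where "\<kappa> p \<equiv> to_completion R (of_nat p)"

lemma completion_cring: "cring (Rp p)"
  by (rule sub_ring.adic_completion_cring) (simp add: of_nat_mem)

sublocale completion: cring "Rp p" for p by (rule completion_cring)

lemma completion_hom: "\<kappa> p \<in> ring_hom R (Rp p)"
  by (rule sub_ring.to_completion_hom) (simp add: of_nat_mem)

sublocale to_completion: ring_hom_cring R "Rp p" "\<kappa> p" for p
  by unfold_locales (rule completion_hom)

text \<open>A Bezout relation between d and p^n inverts d modulo p^n; this is done at every level n,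
  and the levelwise inverses assemble to one in the limit.\<close>

lemma coprime_unit:
  assumes "coprime d p"
  shows "\<kappa> p (of_nat d) \<in> Units (Rp p)"
  unfolding adic_completion_def
proof (rule cring_tower.proj_lim_Units[OF sub_ring.completion_tower])
  show "of_nat p \<in> carrier R" by (simp add: of_nat_mem)
  show "\<kappa> p (of_nat d) \<in> carrier (proj_lim_ring (quot_pow R (of_nat p)) (quot_pow_map R (of_nat p)))"
    using to_completion.hom_closed[of "of_nat d" p] by (simp add: adic_completion_def of_nat_mem)
next
  fix n
  let ?Q = "quot_pow R (of_nat p) n" and ?I = "PIdl\<^bsub>R\<^esub> (of_nat p ^ n)"
  have p: "of_nat p \<in> carrier R" by (simp add: of_nat_mem)
  interpret Q: ring_hom_cring R ?Q "(+>\<^bsub>R\<^esub>) ?I"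
    using sub_ring.quot_pow_coset_hom[OF p, of n] sub_ring.quot_pow_cring[OF p, of n]
    by (intro ring_hom_cring.intro ring_hom_cring_axioms.intro sub_ring.is_cring) simp_all
  interpret I: ideal ?I R using sub_ring.pow_ideal[OF p, of n] by simp
  have "coprime (int d) (int p ^ n)" using assms by simp
  then obtain u v where uv: "u * int d + v * int p ^ n = 1"
    using bezout_int[of "int d" "int p ^ n"] by (auto simp: coprime_iff_gcd_eq_1)
  then have 1: "of_int u * of_nat d + of_int v * of_nat p ^ n = (1 :: 'a)"
    by (metis of_int_1 of_int_add of_int_mult of_int_of_nat_eq of_int_power)
  have "of_int v * of_nat p ^ n \<in> ?I"
    by (auto simp: cgenideal_def of_int_mem)
  then have "?I +>\<^bsub>R\<^esub> (of_int v * of_nat p ^ n) = \<zero>\<^bsub>?Q\<^esub>"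
    using I.a_rcos_const by (simp add: quot_pow_def FactRing_def)
  moreover have "?I +>\<^bsub>R\<^esub> (of_int u * of_nat d + of_int v * of_nat p ^ n) =
      (?I +>\<^bsub>R\<^esub> (of_int u * of_nat d)) \<oplus>\<^bsub>?Q\<^esub> (?I +>\<^bsub>R\<^esub> (of_int v * of_nat p ^ n))"
    using Q.hom_add[of "of_int u * of_nat d" "of_int v * of_nat p ^ n"]
    by (simp add: mem_intros of_int_mem)
  ultimately have "(?I +>\<^bsub>R\<^esub> of_int u) \<otimes>\<^bsub>?Q\<^esub> (?I +>\<^bsub>R\<^esub> of_nat d) = \<one>\<^bsub>?Q\<^esub>"
    using 1 Q.hom_one Q.hom_mult[of "of_int u" "of_nat d"] Q.hom_closed[of "of_int u * of_nat d"]
    by (simp add: mem_intros of_int_mem)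
  moreover have u: "?I +>\<^bsub>R\<^esub> of_int u \<in> carrier ?Q" and d: "?I +>\<^bsub>R\<^esub> of_nat d \<in> carrier ?Q"
    by (auto intro!: Q.hom_closed simp: of_int_mem of_nat_mem)
  ultimately have "?I +>\<^bsub>R\<^esub> of_nat d \<in> Units ?Q"
    using Q.S.m_comm[OF u d] unfolding Units_def by auto
  then show "\<kappa> p (of_nat d) n \<in> Units ?Q" by (simp add: to_completion_def)
qed

definition localize :: "nat \<Rightarrow> 'k \<Rightarrow> nat \<Rightarrow> 'a set" where
  "localize p P = (let (d, c) = SOME (d, c). coprime d p \<and> c \<in> K \<and> of_nat d * P = \<iota> c
     in inv\<^bsub>Rp p\<^esub> \<kappa> p (of_nat d) \<otimes>\<^bsub>Rp p\<^esub> \<kappa> p c)"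

text \<open>The chosen fraction c'/d' and the given one c/d satisfy d c' = d' c in \<open>K\<close>,
  by injectivity of \<open>\<iota>\<close>; so the choice made in \<open>localize\<close> does not
  matter.\<close>

lemma
  assumes "coprime d p" "c \<in> K" "of_nat d * P = \<iota> c"
  shows localize_closed: "localize p P \<in> carrier (Rp p)"
    and localize_eq: "\<kappa> p (of_nat d) \<otimes>\<^bsub>Rp p\<^esub> localize p P = \<kappa> p c"
proof -
  let ?sel = "SOME (d, c). coprime d p \<and> c \<in> K \<and> of_nat d * P = \<iota> c"
  obtain d' c' where dc: "?sel = (d', c')" by (rule prod.exhaust)
  have "case ?sel of (d, c) \<Rightarrow> coprime d p \<and> c \<in> K \<and> of_nat d * P = \<iota> c"
    by (rule someI[of _ "(d, c)"]) (use assms in simp)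
  then have *: "coprime d' p \<and> c' \<in> K \<and> of_nat d' * P = \<iota> c'"
    unfolding dc by simp
  have loc: "localize p P = inv\<^bsub>Rp p\<^esub> \<kappa> p (of_nat d') \<otimes>\<^bsub>Rp p\<^esub> \<kappa> p c'"
    unfolding localize_def dc by simp
  have u: "\<kappa> p (of_nat d') \<in> Units (Rp p)" using * by (simp add: coprime_unit)
  have closed: "\<kappa> p (of_nat d) \<in> carrier (Rp p)" "\<kappa> p (of_nat d') \<in> carrier (Rp p)"
    "\<kappa> p c \<in> carrier (Rp p)" "\<kappa> p c' \<in> carrier (Rp p)" "inv\<^bsub>Rp p\<^esub> \<kappa> p (of_nat d') \<in> carrier (Rp p)"
    using * assms u by (auto intro!: to_completion.hom_closed simp: of_nat_mem)
  show "localize p P \<in> carrier (Rp p)" using closed by (simp add: loc)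
  have "\<iota> (of_nat d * c') = of_nat d * (of_nat d' * P)" "\<iota> (of_nat d' * c) = of_nat d' * (of_nat d * P)"
    using * assms by (simp_all add: embed_mult embed_of_nat)
  then have "\<iota> (of_nat d * c') = \<iota> (of_nat d' * c)" by (simp add: algebra_simps)
  then have "of_nat d * c' = of_nat d' * c" using inj_embed by (simp add: inj_eq)
  then have "\<kappa> p (of_nat d) \<otimes>\<^bsub>Rp p\<^esub> \<kappa> p c' = \<kappa> p (of_nat d') \<otimes>\<^bsub>Rp p\<^esub> \<kappa> p c"
    using to_completion.hom_mult[of "of_nat d" c' p] to_completion.hom_mult[of "of_nat d'" c p] * assms
    by (simp add: of_nat_mem)
  then have "\<kappa> p (of_nat d) \<otimes>\<^bsub>Rp p\<^esub> localize p P =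
      inv\<^bsub>Rp p\<^esub> \<kappa> p (of_nat d') \<otimes>\<^bsub>Rp p\<^esub> (\<kappa> p (of_nat d') \<otimes>\<^bsub>Rp p\<^esub> \<kappa> p c)"
    unfolding loc using completion.m_lcomm[OF closed(1,5,4)] by simp
  also have "\<dots> = \<kappa> p c" using closed u by (simp flip: completion.m_assoc)
  finally show "\<kappa> p (of_nat d) \<otimes>\<^bsub>Rp p\<^esub> localize p P = \<kappa> p c" .
qed

text \<open>As the image of d is a unit, the equation determines the value; the homomorphism laws
  can thus be verified after clearing denominators.\<close>

lemma localize_unique:
  assumes "coprime d p" "c \<in> K" "of_nat d * P = \<iota> c"
    and "z \<in> carrier (Rp p)" "\<kappa> p (of_nat d) \<otimes>\<^bsub>Rp p\<^esub> z = \<kappa> p c"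
  shows "localize p P = z"
  using completion.Units_l_cancel[OF coprime_unit[OF assms(1)] localize_closed[OF assms(1-3)] assms(4)]
    localize_eq[OF assms(1-3)] assms(5) by simp

lemma localize_embed: "c \<in> K \<Longrightarrow> localize p (\<iota> c) = \<kappa> p c"
  by (rule localize_unique[of 1 _ c])
    (auto intro!: to_completion.hom_closed completion.l_one simp: to_completion.hom_one[simplified])

lemma localize_hom: "localize p \<in> ring_hom (sub_ring (localized p)) (Rp p)"
proof (rule ring_hom_memI)
  fix P assume "P \<in> carrier (sub_ring (localized p))"
  then obtain d c where P: "coprime d p" "c \<in> K" "of_nat d * P = \<iota> c" by (auto elim: localizedE)
  note lP = localize_closed[OF P] localize_eq[OF P]
  show "localize p P \<in> carrier (Rp p)" by fact
  fix Q assume "Q \<in> carrier (sub_ring (localized p))"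
  then obtain e b where Q: "coprime e p" "b \<in> K" "of_nat e * Q = \<iota> b" by (auto elim: localizedE)
  note lQ = localize_closed[OF Q] localize_eq[OF Q]
  have closed: "\<kappa> p (of_nat d) \<in> carrier (Rp p)" "\<kappa> p (of_nat e) \<in> carrier (Rp p)"
    by (auto intro!: to_completion.hom_closed simp: of_nat_mem)
  have de: "\<kappa> p (of_nat (d * e)) = \<kappa> p (of_nat d) \<otimes>\<^bsub>Rp p\<^esub> \<kappa> p (of_nat e)"
    using to_completion.hom_mult[of "of_nat d" "of_nat e" p] by (simp add: of_nat_mem)
  have cop: "coprime (d * e) p" using P Q by simp
  have "of_nat (d * e) * (P * Q) = (of_nat d * P) * (of_nat e * Q)" by (simp add: algebra_simps)
  then have PQ: "of_nat (d * e) * (P * Q) = \<iota> (c * b)" using P Q by (simp add: embed_mult)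
  have "\<kappa> p (of_nat (d * e)) \<otimes>\<^bsub>Rp p\<^esub> (localize p P \<otimes>\<^bsub>Rp p\<^esub> localize p Q) =
      (\<kappa> p (of_nat d) \<otimes>\<^bsub>Rp p\<^esub> localize p P) \<otimes>\<^bsub>Rp p\<^esub> (\<kappa> p (of_nat e) \<otimes>\<^bsub>Rp p\<^esub> localize p Q)"
    unfolding de using closed lP(1) lQ(1) by (simp add: completion.m_ac)
  then have "\<kappa> p (of_nat (d * e)) \<otimes>\<^bsub>Rp p\<^esub> (localize p P \<otimes>\<^bsub>Rp p\<^esub> localize p Q) = \<kappa> p (c * b)"
    using to_completion.hom_mult[of c b p] P Q lP lQ by simp
  then show "localize p (P \<otimes>\<^bsub>sub_ring (localized p)\<^esub> Q) = localize p P \<otimes>\<^bsub>Rp p\<^esub> localize p Q"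
    using localize_unique[OF cop mult_mem[OF P(2) Q(2)] PQ] lP(1) lQ(1) by simp
  have "of_nat (d * e) * (P + Q) = of_nat e * (of_nat d * P) + of_nat d * (of_nat e * Q)"
    by (simp add: algebra_simps)
  then have PQ: "of_nat (d * e) * (P + Q) = \<iota> (of_nat e * c + of_nat d * b)"
    using P Q by (simp add: embed_mult embed_add embed_of_nat)
  have mem: "of_nat e * c \<in> K" "of_nat d * b \<in> K" using P Q by (auto intro!: mem_intros)
  have "\<kappa> p (of_nat (d * e)) \<otimes>\<^bsub>Rp p\<^esub> (localize p P \<oplus>\<^bsub>Rp p\<^esub> localize p Q) =
      \<kappa> p (of_nat e) \<otimes>\<^bsub>Rp p\<^esub> (\<kappa> p (of_nat d) \<otimes>\<^bsub>Rp p\<^esub> localize p P) \<oplus>\<^bsub>Rp p\<^esub>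
      \<kappa> p (of_nat d) \<otimes>\<^bsub>Rp p\<^esub> (\<kappa> p (of_nat e) \<otimes>\<^bsub>Rp p\<^esub> localize p Q)"
    unfolding de using closed lP(1) lQ(1) by (simp add: completion.r_distr completion.m_ac)
  also have "\<dots> = \<kappa> p (of_nat e * c + of_nat d * b)"
    using to_completion.hom_add[of "of_nat e * c" "of_nat d * b" p] to_completion.hom_mult[of "of_nat e" c p]
      to_completion.hom_mult[of "of_nat d" b p] P Q lP lQ mem by (simp add: of_nat_mem)
  finally show "localize p (P \<oplus>\<^bsub>sub_ring (localized p)\<^esub> Q) = localize p P \<oplus>\<^bsub>Rp p\<^esub> localize p Q"
    using localize_unique[OF cop add_mem[OF mem] PQ] lP(1) lQ(1) by simp
next
  show "localize p \<one>\<^bsub>sub_ring (localized p)\<^esub> = \<one>\<^bsub>Rp p\<^esub>"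
    using localize_embed[OF one_mem, of p] to_completion.hom_one[of p] by (simp add: embed_one)
qed

sublocale localize: ring_hom_cring "sub_ring (localized p)" "Rp p" "localize p" for p
  by unfold_locales (rule localize_hom)

lemma localize_inverse:
  assumes "x \<in> localized p" "y \<in> localized p" "x * y = 1"
  shows "inv\<^bsub>Rp p\<^esub> (localize p x) = localize p y"
  using assms localize.hom_mult[of x p y] localize.hom_one[of p]
  by (intro completion.comm_inv_char localize.hom_closed) simp_all

lemma localize_power: "x \<in> localized p \<Longrightarrow> localize p x [^]\<^bsub>Rp p\<^esub> (n::nat) = localize p (x ^ n)"
proof (induction n)
  case (Suc n)
  then show ?case
    using localize.hom_mult[of "x ^ n" p x]
    by (simp add: localized.power_mem mult.commute)
qed (use localize.hom_one[of p] in simp)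

lemma nat_elt_completion: "nat_elt (Rp p) n = localize p (of_nat n)"
proof -
  have "nat_elt (Rp p) n = \<kappa> p (nat_elt R n)"
    using nat_elt_hom[OF sub_ring.ring_axioms completion.ring_axioms completion_hom] by simp
  then show ?thesis using localize_embed[OF of_nat_mem, of p n] by (simp add: embed_of_nat)
qed

text \<open>All indices lie strictly between 0 and p, so every inverse that occurs is a fraction
  with denominator prime to p, and \<open>localize p\<close> carries the whole sum over to the
  completion.\<close>

lemma polylog_trunc_completion:
  assumes "prime p" "fst ` set \<sigma> \<subseteq> K"
  shows "polylog_trunc (Rp p) p (map (map_prod (\<kappa> p) id) \<sigma>) = localize p (polylog_sum iv \<iota> p \<sigma>)"
    and "polylog_sum iv \<iota> p \<sigma> \<in> localized p"
proof -
  have a: "fst (\<sigma> ! i) \<in> K" if "i < length \<sigma>" for i using assms(2) that by auto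
  let ?t = "\<lambda>ms i. \<iota> (fst (\<sigma> ! i)) ^ (ms ! i - (0 # ms) ! i) * iv (ms ! i) ^ snd (\<sigma> ! i)"
  have m: "0 < ms ! i \<and> ms ! i < p" if "ms \<in> increasing (length \<sigma>) p" "i < length \<sigma>" for ms i
  proof -
    have "ms ! i \<in> set ms" "set ms \<subseteq> {0<..<p}" using that by (auto simp: increasing_def)
    then have "ms ! i \<in> {0<..<p}" by blast
    then show ?thesis by simp
  qed
  have iv: "iv (ms ! i) \<in> localized p" if "ms \<in> increasing (length \<sigma>) p" "i < length \<sigma>" for ms i
    using m[OF that] assms(1) by (auto intro: localized_inverse)
  have t: "?t ms i \<in> localized p" if "ms \<in> increasing (length \<sigma>) p" "i < length \<sigma>" for ms i
    using iv[OF that] a[OF that(2)] by (auto intro!: localized.mem_intros embed_localized)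
  show mem: "polylog_sum iv \<iota> p \<sigma> \<in> localized p"
    unfolding polylog_sum_def by (intro localized.sum_mem localized.prod_mem t) auto
  have factor: "fst (map (map_prod (\<kappa> p) id) \<sigma> ! i) [^]\<^bsub>Rp p\<^esub> (ms ! i - (0 # ms) ! i) \<otimes>\<^bsub>Rp p\<^esub>
      inv\<^bsub>Rp p\<^esub> (nat_elt (Rp p) (ms ! i) [^]\<^bsub>Rp p\<^esub> snd (map (map_prod (\<kappa> p) id) \<sigma> ! i)) = localize p (?t ms i)"
    if "ms \<in> increasing (length \<sigma>) p" "i < length \<sigma>" for ms i
  proof -
    have "of_nat (ms ! i) ^ snd (\<sigma> ! i) * iv (ms ! i) ^ snd (\<sigma> ! i) = (1 :: 'k)"
      using of_nat_inverse m[OF that] by (simp flip: power_mult_distrib)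
    then have "inv\<^bsub>Rp p\<^esub> (nat_elt (Rp p) (ms ! i) [^]\<^bsub>Rp p\<^esub> snd (\<sigma> ! i)) = localize p (iv (ms ! i) ^ snd (\<sigma> ! i))"
      using iv[OF that]
      by (simp add: nat_elt_completion localize_power localized.of_nat_mem localize_inverse localized.power_mem)
    moreover have "\<kappa> p (fst (\<sigma> ! i)) [^]\<^bsub>Rp p\<^esub> (ms ! i - (0 # ms) ! i)
        = localize p (\<iota> (fst (\<sigma> ! i)) ^ (ms ! i - (0 # ms) ! i))"
      using a[OF that(2)] by (simp add: embed_localized flip: localize_embed localize_power)
    ultimately show ?thesis
      using that a[OF that(2)] iv[OF that] localize.hom_mult[of "\<iota> (fst (\<sigma> ! i)) ^ (ms ! i - (0 # ms) ! i)" p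
          "iv (ms ! i) ^ snd (\<sigma> ! i)"]
      by (simp add: embed_localized localized.power_mem)
  qed
  have "localize p (polylog_sum iv \<iota> p \<sigma>) = localize p (finsum (sub_ring (localized p))
      (\<lambda>ms. \<Prod>i<length \<sigma>. ?t ms i) (increasing (length \<sigma>) p))"
    unfolding polylog_sum_def
    by (subst localized.finsum_sub_ring) (intro localized.prod_mem t, auto)
  also have "\<dots> = (\<Oplus>\<^bsub>Rp p\<^esub> ms\<in>increasing (length \<sigma>) p. localize p (\<Prod>i<length \<sigma>. ?t ms i))"
    by (subst localize.hom_finsum) (auto simp: o_def intro!: localized.prod_mem t)
  also have "\<dots> = (\<Oplus>\<^bsub>Rp p\<^esub> ms\<in>increasing (length \<sigma>) p. \<Otimes>\<^bsub>Rp p\<^esub> i\<in>{..<length \<sigma>}. localize p (?t ms i))"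
  proof (intro completion.finsum_cong' refl)
    fix ms assume ms: "ms \<in> increasing (length \<sigma>) p"
    have "localize p (\<Prod>i<length \<sigma>. ?t ms i) = localize p (finprod (sub_ring (localized p)) (?t ms) {..<length \<sigma>})"
      by (subst localized.finprod_sub_ring) (auto intro!: t ms)
    also have "\<dots> = (\<Otimes>\<^bsub>Rp p\<^esub> i\<in>{..<length \<sigma>}. localize p (?t ms i))"
      by (subst localize.hom_finprod) (auto simp: o_def intro!: t ms)
    finally show "localize p (\<Prod>i<length \<sigma>. ?t ms i) = (\<Otimes>\<^bsub>Rp p\<^esub> i\<in>{..<length \<sigma>}. localize p (?t ms i))" .
  qed (intro Pi_I completion.finprod_closed localize.hom_closed, simp add: t)
  also have "\<dots> = polylog_trunc (Rp p) p (map (map_prod (\<kappa> p) id) \<sigma>)"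
    unfolding polylog_trunc_def length_map increasing_def[symmetric]
    by (intro completion.finsum_cong' completion.finprod_cong' refl Pi_I completion.finprod_closed)
      (simp_all only: factor lessThan_iff, simp_all add: t localize.hom_closed)
  finally show "polylog_trunc (Rp p) p (map (map_prod (\<kappa> p) id) \<sigma>) = localize p (polylog_sum iv \<iota> p \<sigma>)" ..
qed

section \<open>Families indexed by primes\<close>

text \<open>Functions on all natural numbers, constrained only at the relevant primes, form a
  subring of a function type with pointwise operations. By \<open>image_hat_cong\<close> the
  remaining values do not affect the image.\<close>

definition families :: "nat \<Rightarrow> int \<Rightarrow> (nat \<Rightarrow> 'k) set" where
  "families N \<alpha> = {P. \<forall>p\<in>primes_cong N \<alpha>. P p \<in> localized p}"

sublocale families: comm_subring "families N \<alpha>" for N \<alpha>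
  by unfold_locales (auto simp: families_def localized.mem_intros)

definition image_hat :: "nat \<Rightarrow> int \<Rightarrow> (nat \<Rightarrow> 'k) \<Rightarrow> nat \<Rightarrow> ('a \<Rightarrow> 'a set) set" where
  "image_hat N \<alpha> P = family_image R N \<alpha> (\<lambda>p. localize p (P p))"

lemma image_hat_cong: "(\<And>p. p \<in> primes_cong N \<alpha> \<Longrightarrow> P p = Q p) \<Longrightarrow> image_hat N \<alpha> P = image_hat N \<alpha> Q"
  unfolding image_hat_def by (rule family_image_cong) simp

lemma prime_elts_subset: "prime_elts R N \<alpha> \<subseteq> carrier R"
  by (auto simp: prime_elts_def of_nat_mem)

lemma prime_of_mem: "a \<in> prime_elts R N \<alpha> \<Longrightarrow> prime_of R N \<alpha> a \<in> primes_cong N \<alpha>"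
  unfolding prime_of_def prime_elts_def by (rule inv_into_into)

lemma of_nat_prime_of: "a \<in> prime_elts R N \<alpha> \<Longrightarrow> of_nat (prime_of R N \<alpha> a) = a"
  unfolding prime_of_def prime_elts_def using f_inv_into_f[of a "nat_elt R" "primes_cong N \<alpha>"] by simp

lemma hat_cring: "cring (Ah R N \<alpha>)"
  by (rule sub_ring.A_hat_cring[OF prime_elts_subset])

sublocale hat: cring "Ah R N \<alpha>" for N \<alpha> by (rule hat_cring)

text \<open>The products in the statement are indexed by the elements p of the ring, not by natural
  numbers; \<open>prime_of\<close> translates, and \<open>of_nat_prime_of\<close> identifies the
  completions.\<close>

lemma image_hat_hom: "image_hat N \<alpha> \<in> ring_hom (sub_ring (families N \<alpha>)) (Ah R N \<alpha>)"
proof -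
  let ?S = "prime_elts R N \<alpha>" and ?p = "prime_of R N \<alpha>"
  let ?L = "\<lambda>P. \<lambda>a\<in>?S. localize (?p a) (P (?p a))"
  have h: "localize (?p a) \<in> ring_hom (sub_ring (localized (?p a))) (adic_completion R a)" if "a \<in> ?S" for a
    using localize_hom[of "?p a"] that by (simp add: of_nat_prime_of)
  have mem: "P (?p a) \<in> carrier (sub_ring (localized (?p a)))" if "a \<in> ?S" "P \<in> families N \<alpha>" for a P
    using that prime_of_mem by (auto simp: families_def)
  have "?L \<in> ring_hom (sub_ring (families N \<alpha>)) (prod_ring ?S (adic_completion R))"
  proof (rule ring_hom_memI)
    fix P assume P: "P \<in> carrier (sub_ring (families N \<alpha>))"
    then show "?L P \<in> carrier (prod_ring ?S (adic_completion R))"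
      using ring_hom_closed[OF h mem] by (simp add: prod_ring_simps PiE_iff)
    fix Q assume Q: "Q \<in> carrier (sub_ring (families N \<alpha>))"
    show "?L (P \<otimes>\<^bsub>sub_ring (families N \<alpha>)\<^esub> Q) = ?L P \<otimes>\<^bsub>prod_ring ?S (adic_completion R)\<^esub> ?L Q"
      using ring_hom_mult[OF h mem mem, of _ P Q] P Q
      by (simp add: prod_ring_simps cong: restrict_cong)
    show "?L (P \<oplus>\<^bsub>sub_ring (families N \<alpha>)\<^esub> Q) = ?L P \<oplus>\<^bsub>prod_ring ?S (adic_completion R)\<^esub> ?L Q"
      using ring_hom_add[OF h mem mem, of _ P Q] P Q
      by (simp add: prod_ring_simps cong: restrict_cong)
  next
    show "?L \<one>\<^bsub>sub_ring (families N \<alpha>)\<^esub> = \<one>\<^bsub>prod_ring ?S (adic_completion R)\<^esub>"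
      using ring_hom_one[OF h] by (simp add: prod_ring_simps cong: restrict_cong)
  qed
  then have "A_proj R ?S \<circ> ?L \<in> ring_hom (sub_ring (families N \<alpha>)) (Ah R N \<alpha>)"
    by (rule ring_hom_trans[OF _ sub_ring.A_proj_hom[OF prime_elts_subset]])
  moreover have "A_proj R ?S \<circ> ?L = image_hat N \<alpha>"
    by (auto simp: image_hat_def family_image_def)
  ultimately show ?thesis by simp
qed

sublocale image_hat: ring_hom_cring "sub_ring (families N \<alpha>)" "Ah R N \<alpha>" "image_hat N \<alpha>" for N \<alpha>
  by unfold_locales (rule image_hat_hom)

lemma image_hat_closed: "P \<in> families N \<alpha> \<Longrightarrow> image_hat N \<alpha> P \<in> carrier (Ah R N \<alpha>)"
  using image_hat.hom_closed[of P] by simp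

lemma image_hat_mult:
  "P \<in> families N \<alpha> \<Longrightarrow> Q \<in> families N \<alpha> \<Longrightarrow>
    image_hat N \<alpha> P \<otimes>\<^bsub>Ah R N \<alpha>\<^esub> image_hat N \<alpha> Q = image_hat N \<alpha> (\<lambda>p. P p * Q p)"
  using image_hat.hom_mult[of P N \<alpha> Q] by (simp add: times_fun_def)

lemma image_hat_add:
  "P \<in> families N \<alpha> \<Longrightarrow> Q \<in> families N \<alpha> \<Longrightarrow>
    image_hat N \<alpha> P \<oplus>\<^bsub>Ah R N \<alpha>\<^esub> image_hat N \<alpha> Q = image_hat N \<alpha> (\<lambda>p. P p + Q p)"
  using image_hat.hom_add[of P N \<alpha> Q] by (simp add: plus_fun_def)

lemma image_hat_zero: "image_hat N \<alpha> (\<lambda>p. 0) = \<zero>\<^bsub>Ah R N \<alpha>\<^esub>"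
  using image_hat.hom_zero[of N \<alpha>] by (simp add: zero_fun_def)

lemma image_hat_one: "image_hat N \<alpha> (\<lambda>p. 1) = \<one>\<^bsub>Ah R N \<alpha>\<^esub>"
  using image_hat.hom_one[of N \<alpha>] by (simp add: one_fun_def)

lemma familiesI: "(\<And>p. p \<in> primes_cong N \<alpha> \<Longrightarrow> P p \<in> localized p) \<Longrightarrow> P \<in> families N \<alpha>"
  by (simp add: families_def)

lemma familiesD: "P \<in> families N \<alpha> \<Longrightarrow> p \<in> primes_cong N \<alpha> \<Longrightarrow> P p \<in> localized p"
  by (simp add: families_def)

lemma image_hat_uminus:
  assumes "P \<in> families N \<alpha>"
  shows "\<ominus>\<^bsub>Ah R N \<alpha>\<^esub> image_hat N \<alpha> P = image_hat N \<alpha> (\<lambda>p. - P p)"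
proof (rule hat.minus_equality)
  have m: "(\<lambda>p. - P p) \<in> families N \<alpha>"
    using assms by (auto simp: families_def localized.uminus_mem)
  show "image_hat N \<alpha> (\<lambda>p. - P p) \<oplus>\<^bsub>Ah R N \<alpha>\<^esub> image_hat N \<alpha> P = \<zero>\<^bsub>Ah R N \<alpha>\<^esub>"
    using assms m by (simp add: image_hat_add image_hat_zero)
qed (use assms in \<open>auto simp: families_def localized.uminus_mem intro!: image_hat_closed\<close>)

lemma image_hat_minus:
  assumes "P \<in> families N \<alpha>" "Q \<in> families N \<alpha>"
  shows "image_hat N \<alpha> P \<ominus>\<^bsub>Ah R N \<alpha>\<^esub> image_hat N \<alpha> Q = image_hat N \<alpha> (\<lambda>p. P p - Q p)"
proof -
  have "(\<lambda>p. - Q p) \<in> families N \<alpha>"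
    using assms by (auto simp: families_def localized.uminus_mem)
  then show ?thesis
    using assms by (simp add: a_minus_def image_hat_uminus image_hat_add)
qed

lemma image_hat_power:
  assumes "P \<in> families N \<alpha>"
  shows "image_hat N \<alpha> P [^]\<^bsub>Ah R N \<alpha>\<^esub> (n::nat) = image_hat N \<alpha> (\<lambda>p. P p ^ n)"
proof (induction n)
  case (Suc n)
  have "(\<lambda>p. P p ^ n) \<in> families N \<alpha>"
    using assms by (auto simp: families_def localized.power_mem)
  then show ?case using assms Suc by (simp add: image_hat_mult mult.commute)
qed (simp add: image_hat_one)

lemma image_hat_add_pow:
  assumes "P \<in> families N \<alpha>"
  shows "[n] \<cdot>\<^bsub>Ah R N \<alpha>\<^esub> image_hat N \<alpha> P = image_hat N \<alpha> (\<lambda>p. of_nat n * P p)"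
proof (induction n)
  case (Suc n)
  have "(\<lambda>p. of_nat n * P p) \<in> families N \<alpha>"
    using assms by (auto simp: families_def localized.mem_intros)
  then show ?case
    using assms Suc by (simp add: hat.add.nat_pow_Suc image_hat_add ring_distribs add.commute)
qed (simp add: image_hat_zero)

lemma image_hat_sum:
  assumes "\<And>i. i \<in> I \<Longrightarrow> P i \<in> families N \<alpha>"
  shows "(\<Oplus>\<^bsub>Ah R N \<alpha>\<^esub> i\<in>I. image_hat N \<alpha> (P i)) = image_hat N \<alpha> (\<lambda>p. \<Sum>i\<in>I. P i p)"
  using assms
proof (induction I rule: infinite_finite_induct)
  case (insert i I)
  have "(\<lambda>p. \<Sum>i\<in>I. P i p) \<in> families N \<alpha>"
    using insert.prems by (auto simp: families_def localized.sum_mem)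
  moreover have "(\<lambda>i. image_hat N \<alpha> (P i)) \<in> I \<rightarrow> carrier (Ah R N \<alpha>)"
    "image_hat N \<alpha> (P i) \<in> carrier (Ah R N \<alpha>)"
    using insert.prems by (auto intro!: image_hat_closed)
  ultimately show ?case
    using insert by (simp add: hat.finsum_insert image_hat_add)
qed (simp_all add: image_hat_zero)

lemma localize_of_nat_power: "localize p (of_nat p ^ n) = \<kappa> p (of_nat p ^ n)"
  using localize_embed[of "of_nat p ^ n" p] by (simp add: embed_power embed_of_nat mem_intros)

lemma bold_p_image: "bold_p R N \<alpha> = image_hat N \<alpha> of_nat"
  unfolding bold_p_def image_hat_def
  by (rule family_image_cong) (use localize_of_nat_power[of _ 1] in simp)

lemma pow_bold_p_image:
  assumes "y \<in> K"
  shows "pow_bold_p R N \<alpha> y = image_hat N \<alpha> (\<lambda>p. \<iota> y ^ p)"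
  unfolding pow_bold_p_def image_hat_def
  by (rule family_image_cong) (use assms in \<open>simp add: localize_embed power_mem flip: embed_power\<close>)

lemma polylog_hat_image:
  assumes "fst ` set \<sigma> \<subseteq> K"
  shows "polylog_hat R N \<alpha> \<sigma> = image_hat N \<alpha> (\<lambda>p. polylog_sum iv \<iota> p \<sigma>)"
  unfolding polylog_hat_def image_hat_def
  by (rule family_image_cong) (use assms in \<open>simp add: primes_cong_def polylog_trunc_completion\<close>)

lemma polylog_sum_family:
  "fst ` set \<sigma> \<subseteq> K \<Longrightarrow> (\<lambda>p. polylog_sum iv \<iota> p \<sigma>) \<in> families N \<alpha>"
  by (simp add: families_def primes_cong_def polylog_trunc_completion)

lemma bold_p_family: "of_nat \<in> families N \<alpha>"
  by (simp add: families_def localized.of_nat_mem)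

section \<open>Separatedness and convergence with respect to the powers of bold p\<close>

lemma hat_level_hom: "(\<lambda>z. z n) \<in> ring_hom (Ah R N \<alpha>) (A_ring R (prime_elts R N \<alpha>) n)"
  unfolding A_hat_def
  by (rule cring_tower.proj_lim_level_hom[OF sub_ring.A_hat_tower[OF prime_elts_subset]])

sublocale hat_level: ring_hom_cring "Ah R N \<alpha>" "A_ring R (prime_elts R N \<alpha>) n" "\<lambda>z. z n" for N \<alpha> n
  using hat_level_hom sub_ring.A_ring_cring[OF prime_elts_subset]
  by (intro ring_hom_cring.intro ring_hom_cring_axioms.intro hat_cring)

text \<open>At the place p the component at level n is the class of p^n modulo p^n, so it vanishes
  at every place.\<close>

lemma bold_p_power_level:
  "(bold_p R N \<alpha> [^]\<^bsub>Ah R N \<alpha>\<^esub> n) n = \<zero>\<^bsub>A_ring R (prime_elts R N \<alpha>) n\<^esub>"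
proof -
  let ?S = "prime_elts R N \<alpha>" and ?p = "prime_of R N \<alpha>"
  interpret P: cring "A_prod R ?S n" by (rule sub_ring.A_prod_cring[OF prime_elts_subset])
  interpret I: ideal "A_sum R ?S n" "A_prod R ?S n" by (rule sub_ring.A_sum_ideal[OF prime_elts_subset])
  have "bold_p R N \<alpha> [^]\<^bsub>Ah R N \<alpha>\<^esub> n = image_hat N \<alpha> (\<lambda>p. of_nat p ^ n)"
    unfolding bold_p_image by (rule image_hat_power[OF bold_p_family])
  moreover have "localize (?p a) (of_nat (?p a) ^ n) n = \<zero>\<^bsub>quot_pow R a n\<^esub>" if "a \<in> ?S" for a
  proof -
    have a: "a \<in> carrier R" using that prime_elts_subset by auto
    interpret J: ideal "PIdl\<^bsub>R\<^esub> (a ^ n)" R using sub_ring.pow_ideal[OF a, of n] by simp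
    have "a ^ n \<in> PIdl\<^bsub>R\<^esub> (a ^ n)"
      using sub_ring.cgenideal_self[of "a ^ n"] a by (simp add: power_mem)
    then have "PIdl\<^bsub>R\<^esub> (a ^ n) +>\<^bsub>R\<^esub> a ^ n = PIdl\<^bsub>R\<^esub> (a ^ n)" by (rule J.a_rcos_const)
    moreover have "localize (?p a) (of_nat (?p a) ^ n) = to_completion R a (a ^ n)"
      using localize_of_nat_power[of "?p a" n] of_nat_prime_of[OF that] by simp
    ultimately show ?thesis by (simp add: to_completion_def quot_pow_def FactRing_def)
  qed
  ultimately have "(bold_p R N \<alpha> [^]\<^bsub>Ah R N \<alpha>\<^esub> n) n =
      A_sum R ?S n +>\<^bsub>A_prod R ?S n\<^esub> \<zero>\<^bsub>A_prod R ?S n\<^esub>"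
    by (simp add: image_hat_def family_image_def A_proj_def A_prod_def prod_ring_simps cong: restrict_cong)
  also have "\<dots> = \<zero>\<^bsub>A_ring R ?S n\<^esub>"
    by (simp add: I.a_rcos_const A_ring_def FactRing_def)
  finally show ?thesis .
qed

lemma bold_p_closed: "bold_p R N \<alpha> \<in> carrier (Ah R N \<alpha>)"
  unfolding bold_p_image by (rule image_hat_closed[OF bold_p_family])

lemma bold_p_ideal_level:
  assumes "z \<in> PIdl\<^bsub>Ah R N \<alpha>\<^esub> (bold_p R N \<alpha> [^]\<^bsub>Ah R N \<alpha>\<^esub> n)"
  shows "z n = \<zero>\<^bsub>A_ring R (prime_elts R N \<alpha>) n\<^esub>"
proof -
  obtain w where w: "w \<in> carrier (Ah R N \<alpha>)" "z = w \<otimes>\<^bsub>Ah R N \<alpha>\<^esub> (bold_p R N \<alpha> [^]\<^bsub>Ah R N \<alpha>\<^esub> n)"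
    using assms unfolding cgenideal_def by blast
  have "bold_p R N \<alpha> [^]\<^bsub>Ah R N \<alpha>\<^esub> n \<in> carrier (Ah R N \<alpha>)"
    using bold_p_closed by (rule hat.nat_pow_closed)
  then have "z n = w n \<otimes>\<^bsub>A_ring R (prime_elts R N \<alpha>) n\<^esub> (bold_p R N \<alpha> [^]\<^bsub>Ah R N \<alpha>\<^esub> n) n"
    unfolding w(2) by (rule ring_hom_mult[OF hat_level_hom w(1)])
  then show ?thesis
    using hat_level.hom_closed[OF w(1), of n] hat_level.S.r_null by (simp add: bold_p_power_level)
qed

text \<open>Two sums of the same series agree at each level n, because the ideal generated by the
  n-th power of \<open>bold_p\<close> vanishes there; and an element is determined by its levels.
  This justifies the description in \<open>adic_sum\<close>.\<close>

lemma adic_has_sum_unique: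
  assumes "adic_has_sum (Ah R N \<alpha>) (bold_p R N \<alpha>) g I s" "adic_has_sum (Ah R N \<alpha>) (bold_p R N \<alpha>) g I s'"
  shows "s = s'"
proof
  fix n
  let ?A = "Ah R N \<alpha>" and ?An = "A_ring R (prime_elts R N \<alpha>) n"
  have level: "\<exists>F0\<subseteq>I. finite F0 \<and> (\<forall>F. finite F \<and> F0 \<subseteq> F \<and> F \<subseteq> I \<longrightarrow> (\<Oplus>\<^bsub>?A\<^esub> f\<in>F. g f) n = s n)"
    if sum: "adic_has_sum ?A (bold_p R N \<alpha>) g I s" for s
  proof -
    have g: "g \<in> I \<rightarrow> carrier ?A" and s: "s \<in> carrier ?A" using sum by (auto simp: adic_has_sum_def)
    obtain F0 where F0: "F0 \<subseteq> I" "finite F0" "\<And>F. finite F \<Longrightarrow> F0 \<subseteq> F \<Longrightarrow> F \<subseteq> I \<Longrightarrow>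
        (\<Oplus>\<^bsub>?A\<^esub> f\<in>F. g f) \<ominus>\<^bsub>?A\<^esub> s \<in> PIdl\<^bsub>?A\<^esub> (bold_p R N \<alpha> [^]\<^bsub>?A\<^esub> n)"
      using sum unfolding adic_has_sum_def by metis
    have "(\<Oplus>\<^bsub>?A\<^esub> f\<in>F. g f) n = s n" if F: "finite F" "F0 \<subseteq> F" "F \<subseteq> I" for F
    proof -
      let ?t = "\<Oplus>\<^bsub>?A\<^esub> f\<in>F. g f"
      have t: "?t \<in> carrier ?A" using g F by (intro hat.finsum_closed) auto
      have "(?t \<oplus>\<^bsub>?A\<^esub> (\<ominus>\<^bsub>?A\<^esub> s)) n = \<zero>\<^bsub>?An\<^esub>"
        using bold_p_ideal_level[OF F0(3)[OF F]] by (simp add: a_minus_def)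
      then have "?t n \<oplus>\<^bsub>?An\<^esub> (\<ominus>\<^bsub>?An\<^esub> s n) = \<zero>\<^bsub>?An\<^esub>"
        using ring_hom_add[OF hat_level_hom t hat.a_inv_closed[OF s], of n] hat_level.hom_a_inv[OF s, of n] by simp
      then have "\<ominus>\<^bsub>?An\<^esub> (\<ominus>\<^bsub>?An\<^esub> s n) = ?t n"
        by (rule hat_level.S.minus_equality)
          (intro hat_level.S.a_inv_closed hat_level.hom_closed s t)+
      then show ?thesis
        using hat_level.S.minus_minus[OF hat_level.hom_closed[OF s]] by simp
    qed
    then show ?thesis using F0(1,2) by blast
  qed
  obtain F0 where F0: "F0 \<subseteq> I" "finite F0" "\<And>F. finite F \<Longrightarrow> F0 \<subseteq> F \<Longrightarrow> F \<subseteq> I \<Longrightarrow> (\<Oplus>\<^bsub>?A\<^esub> f\<in>F. g f) n = s n"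
    using level[OF assms(1)] by meson
  obtain F1 where F1: "F1 \<subseteq> I" "finite F1" "\<And>F. finite F \<Longrightarrow> F1 \<subseteq> F \<Longrightarrow> F \<subseteq> I \<Longrightarrow> (\<Oplus>\<^bsub>?A\<^esub> f\<in>F. g f) n = s' n"
    using level[OF assms(2)] by meson
  show "s n = s' n" using F0(3)[of "F0 \<union> F1"] F1(3)[of "F0 \<union> F1"] F0(1,2) F1(1,2) by simp
qed

text \<open>\<open>F0\<close> is not allowed to depend on the prime. Then the cofactors chosen at
  the individual primes form a family, and the error is its image times a power of
  \<open>bold_p\<close>.\<close>

lemma adic_has_sum_image:
  assumes G: "\<And>i. i \<in> I \<Longrightarrow> G i \<in> families N \<alpha>" and S: "S \<in> families N \<alpha>"
    and conv: "\<And>n. \<exists>F0\<subseteq>I. finite F0 \<and> (\<forall>F. finite F \<longrightarrow> F0 \<subseteq> F \<longrightarrow> F \<subseteq> I \<longrightarrow>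
      (\<forall>p\<in>primes_cong N \<alpha>. (\<Sum>i\<in>F. G i p) - S p \<in> localized.multiples p (of_nat p ^ n)))"
  shows "adic_has_sum (Ah R N \<alpha>) (bold_p R N \<alpha>) (\<lambda>i. image_hat N \<alpha> (G i)) I (image_hat N \<alpha> S)"
  unfolding adic_has_sum_def
proof (intro conjI allI)
  let ?A = "Ah R N \<alpha>"
  fix n
  obtain F0 where F0: "F0 \<subseteq> I" "finite F0" and
    conv': "\<forall>F. finite F \<longrightarrow> F0 \<subseteq> F \<longrightarrow> F \<subseteq> I \<longrightarrow>
      (\<forall>p\<in>primes_cong N \<alpha>. (\<Sum>i\<in>F. G i p) - S p \<in> localized.multiples p (of_nat p ^ n))"
    using conv[of n] by (elim exE conjE)
  have mult: "(\<Sum>i\<in>F. G i p) - S p \<in> localized.multiples p (of_nat p ^ n)"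
    if "finite F" "F0 \<subseteq> F" "F \<subseteq> I" "p \<in> primes_cong N \<alpha>" for F p
    using conv' that by blast
  have "(\<Oplus>\<^bsub>?A\<^esub> i\<in>F. image_hat N \<alpha> (G i)) \<ominus>\<^bsub>?A\<^esub> image_hat N \<alpha> S \<in> PIdl\<^bsub>?A\<^esub> (bold_p R N \<alpha> [^]\<^bsub>?A\<^esub> n)"
    if F: "finite F" "F0 \<subseteq> F" "F \<subseteq> I" for F
  proof -
    have "\<forall>p\<in>primes_cong N \<alpha>. \<exists>t\<in>localized p. (\<Sum>i\<in>F. G i p) - S p = of_nat p ^ n * t"
      using mult[OF F] unfolding localized.multiples_def by blast
    then obtain t where t: "\<And>p. p \<in> primes_cong N \<alpha> \<Longrightarrow> t p \<in> localized p"
      "\<And>p. p \<in> primes_cong N \<alpha> \<Longrightarrow> (\<Sum>i\<in>F. G i p) - S p = of_nat p ^ n * t p"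
      by metis
    have tf: "t \<in> families N \<alpha>" using t(1) by (rule familiesI)
    have pf: "(\<lambda>p. of_nat p ^ n) \<in> families N \<alpha>"
      by (auto intro!: familiesI localized.power_mem localized.of_nat_mem)
    have sf: "(\<lambda>p. \<Sum>i\<in>F. G i p) \<in> families N \<alpha>"
      using F(3) familiesD[OF G] by (auto intro!: familiesI localized.sum_mem)
    have "(\<Oplus>\<^bsub>?A\<^esub> i\<in>F. image_hat N \<alpha> (G i)) \<ominus>\<^bsub>?A\<^esub> image_hat N \<alpha> S = image_hat N \<alpha> (\<lambda>p. (\<Sum>i\<in>F. G i p) - S p)"
      using F G by (subst image_hat_sum) (auto simp: image_hat_minus[OF sf S])
    also have "\<dots> = image_hat N \<alpha> (\<lambda>p. t p * of_nat p ^ n)"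
      by (rule image_hat_cong) (simp add: t(2) mult.commute)
    also have "\<dots> = image_hat N \<alpha> t \<otimes>\<^bsub>?A\<^esub> (bold_p R N \<alpha> [^]\<^bsub>?A\<^esub> n)"
      unfolding bold_p_image image_hat_power[OF bold_p_family] by (rule image_hat_mult[OF tf pf, symmetric])
    finally show ?thesis
      using image_hat_closed[OF tf] unfolding cgenideal_def by blast
  qed
  then show "\<exists>F0\<subseteq>I. finite F0 \<and> (\<forall>F. finite F \<and> F0 \<subseteq> F \<and> F \<subseteq> I \<longrightarrow>
      (\<Oplus>\<^bsub>?A\<^esub> f\<in>F. image_hat N \<alpha> (G f)) \<ominus>\<^bsub>?A\<^esub> image_hat N \<alpha> S \<in> PIdl\<^bsub>?A\<^esub> (bold_p R N \<alpha> [^]\<^bsub>?A\<^esub> n))"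
    using F0 by blast
qed (use G S in \<open>auto intro!: image_hat_closed\<close>)

end

section \<open>Linear extension to the shuffle of two symbols\<close>

text \<open>Turns repetition in a list into multiplicity, the form in which coefficients enter
  \<open>polylog_hat_lin\<close>.\<close>

lemma sum_list_count:
  assumes "finite A" "set ws \<subseteq> A"
  shows "(\<Sum>w\<leftarrow>ws. f w :: 'k::comm_ring_1) = (\<Sum>w\<in>A. of_nat (count_list ws w) * f w)"
  using assms(2)
proof (induction ws)
  case (Cons v ws)
  have "(\<Sum>w\<in>A. of_nat (count_list (v # ws) w) * f w) =
      (\<Sum>w\<in>A. (if v = w then f w else 0) + of_nat (count_list ws w) * f w)"
    by (intro sum.cong) (auto simp: algebra_simps)
  also have "\<dots> = f v + (\<Sum>w\<in>A. of_nat (count_list ws w) * f w)"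
    using Cons.prems assms(1) by (simp add: sum.distrib sum.delta)
  finally show ?case using Cons by simp
qed simp

definition list_poly :: "'z list list \<Rightarrow> 'z ncpoly" where
  "list_poly ws = (\<Sum>w\<leftarrow>ws. word_mono (Word (rev w)))"

lemma lookup_list_poly: "Poly_Mapping.lookup (list_poly ws) (Word (rev w)) = of_nat (count_list ws w)"
  by (induction ws) (auto simp: list_poly_def lookup_add lookup_single word_mono_def when_def)

text \<open>Coefficients are counts, so no listed word is lost by cancellation in the
  rationals.\<close>

lemma keys_list_poly: "Poly_Mapping.keys (list_poly ws) = (\<lambda>w. Word (rev w)) ` set ws"
proof (intro equalityI subsetI)
  fix v assume v: "v \<in> Poly_Mapping.keys (list_poly ws)"
  obtain w where w: "v = Word (rev w)" by (metis rev_rev_ident word.exhaust)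
  have "count_list ws w \<noteq> 0" using v unfolding w in_keys_iff lookup_list_poly by simp
  then show "v \<in> (\<lambda>w. Word (rev w)) ` set ws" unfolding w by (auto simp: count_list_0_iff)
next
  fix v assume "v \<in> (\<lambda>w. Word (rev w)) ` set ws"
  then obtain w where "v = Word (rev w)" "w \<in> set ws" by blast
  then show "v \<in> Poly_Mapping.keys (list_poly ws)"
    by (simp add: in_keys_iff lookup_list_poly count_list_0_iff)
qed

lemma shuffle_symbol_poly:
  "shuffle (symbol_poly \<sigma>) (symbol_poly \<tau>) =
    list_poly (shuffle_list (rev (letters (symbol_word \<sigma>))) (rev (letters (symbol_word \<tau>))))"
proof -
  have "Poly_Mapping.single 0 (1 * 1) = (1 :: 'a ncpoly)" by simp
  then show ?thesis
    by (simp add: shuffle_def symbol_poly_def word_mono_def shuffle_words_def shuffle_rev_list list_poly_def)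
qed

lemma last_rev_symbol_word:
  assumes "\<sigma> \<in> symbols"
  shows "rev (letters (symbol_word \<sigma>)) = [] \<or> last (rev (letters (symbol_word \<sigma>))) \<noteq> 0"
  using assms by (cases \<sigma>) (auto simp: symbol_word_def symbols_def last_rev)

text \<open>Makes \<open>word_symbol\<close>, an inverse chosen on an image, meaningful for words
  that do not start with e_0. Reading from the left, a nonzero letter opens a column with exponent
  1, and a zero letter raises the exponent of the last column.\<close>

lemma symbols_surj:
  assumes "v = [] \<or> hd v \<noteq> 0"
  shows "Word v \<in> symbol_word ` symbols"
  using assms
proof (induction v rule: rev_induct)
  case Nil
  show ?case by (rule image_eqI[of _ _ "[]"]) (simp_all add: symbol_word_def symbols_def)
next
  case (snoc z v)
  then have "v = [] \<or> hd v \<noteq> 0" by (cases v) auto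
  then obtain \<sigma> where \<sigma>: "\<sigma> \<in> symbols" "symbol_word \<sigma> = Word v"
    using snoc.IH by (metis imageE)
  show ?case
  proof (cases "z = 0")
    case False
    then show ?thesis
      using \<sigma> by (intro image_eqI[of _ _ "\<sigma> @ [(z, 1)]"]) (auto simp: symbols_def symbol_word_def)
  next
    case True
    \<comment> \<open>The word does not start with 0, so the final 0 has a column before it to
      extend.\<close>
    with snoc.prems have "v \<noteq> []" by auto
    with \<sigma>(2) obtain \<tau> a k where \<tau>: "\<sigma> = \<tau> @ [(a, k)]"
      by (cases \<sigma> rule: rev_cases) (auto simp: symbol_word_def)
    with \<sigma>(1) obtain k' where k: "k = Suc k'" by (auto simp: symbols_def gr0_conv_Suc)
    have "symbol_word (\<tau> @ [(a, Suc k)]) = Word (v @ [z])"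
      using \<sigma>(2) True by (auto simp: \<tau> k symbol_word_def replicate_append_same[symmetric])
    moreover have "\<tau> @ [(a, Suc k)] \<in> symbols" using \<sigma>(1) by (auto simp: \<tau> symbols_def)
    ultimately show ?thesis by (metis imageI)
  qed
qed

lemma set_symbol_word:
  "fst ` set \<sigma> \<subseteq> set (letters (symbol_word \<sigma>))"
  "set (letters (symbol_word \<sigma>)) \<subseteq> insert 0 (fst ` set \<sigma>)"
  by (induction \<sigma>) (force simp: symbol_word_def)+

text \<open>The denominator is 1, so the equation in the description determines its solution without
  any division in \<open>A\<close>. This covers the shuffle of two symbols, whose coefficients are
  multiplicities.\<close>

lemma rat_scale_of_nat:
  assumes "cring A" "z \<in> carrier A"
  shows "rat_scale A (of_nat n) z = [n] \<cdot>\<^bsub>A\<^esub> z"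
proof -
  interpret A: cring A by fact
  have "quotient_of (of_nat n) = (int n, 1)"
    by (simp add: of_nat_rat quotient_of_Fract)
  moreover have "[(1::int)] \<cdot>\<^bsub>A\<^esub> u = u" if "u \<in> carrier A" for u
    using A.add.int_pow_1[of u] that by simp
  moreover have "[int n] \<cdot>\<^bsub>A\<^esub> z = [n] \<cdot>\<^bsub>A\<^esub> z"
    by (simp add: add_pow_def int_pow_int)
  ultimately show ?thesis
    using assms(2) by (auto simp: rat_scale_def intro!: the_equality)
qed

context rational_extension
begin

text \<open>The symbol chosen by \<open>word_symbol\<close> enters only through its word, since its
  truncated sum is a sum of coefficients of that word.\<close>

lemma polylog_hat_lin_list_poly:
  assumes "\<And>w. w \<in> set ws \<Longrightarrow> w = [] \<or> last w \<noteq> 0" "\<And>w. w \<in> set ws \<Longrightarrow> set w \<subseteq> K"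
  shows "polylog_hat_lin R N \<alpha> (list_poly ws) = image_hat N \<alpha> (\<lambda>p. \<Sum>w\<leftarrow>ws. \<Sum>m<p. wcoef iv \<iota> w m)"
proof -
  let ?f = "\<lambda>w p. polylog_sum iv \<iota> p (word_symbol (Word (rev w)))"
  have sym: "word_symbol (Word (rev w)) \<in> symbols" "symbol_word (word_symbol (Word (rev w))) = Word (rev w)"
    if "w \<in> set ws" for w
  proof -
    have "Word (rev w) \<in> symbol_word ` symbols"
      using assms(1)[OF that] by (intro symbols_surj) (auto simp: hd_rev)
    then show "word_symbol (Word (rev w)) \<in> symbols" "symbol_word (word_symbol (Word (rev w))) = Word (rev w)"
      unfolding word_symbol_def by (auto intro: inv_into_into f_inv_into_f)
  qed
  have K: "fst ` set (word_symbol (Word (rev w))) \<subseteq> K" if "w \<in> set ws" for w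
    using set_symbol_word(1)[of "word_symbol (Word (rev w))"] assms(2)[OF that] sym(2)[OF that] by auto
  have f: "?f w \<in> families N \<alpha>" if "w \<in> set ws" for w
    using polylog_sum_family[OF K[OF that]] .
  have inj: "inj_on (\<lambda>w. Word (rev w)) (set ws)" by (auto simp: inj_on_def)
  have "polylog_hat_lin R N \<alpha> (list_poly ws) =
      (\<Oplus>\<^bsub>Ah R N \<alpha>\<^esub> w\<in>set ws. rat_scale (Ah R N \<alpha>) (of_nat (count_list ws w))
          (polylog_hat R N \<alpha> (word_symbol (Word (rev w)))))"
    unfolding polylog_hat_lin_def keys_list_poly
    by (subst hat.add.finprod_reindex[OF _ inj])
      (use f K in \<open>auto simp: lookup_list_poly polylog_hat_image rat_scale_of_nat[OF hat_cring]
          intro!: image_hat_closed\<close>)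
  also have "\<dots> = (\<Oplus>\<^bsub>Ah R N \<alpha>\<^esub> w\<in>set ws. image_hat N \<alpha> (\<lambda>p. of_nat (count_list ws w) * ?f w p))"
    using f K by (intro hat.finsum_cong')
      (auto simp: polylog_hat_image rat_scale_of_nat[OF hat_cring] image_hat_closed image_hat_add_pow
        intro!: image_hat_closed familiesI localized.mult_mem localized.of_nat_mem dest: familiesD)
  also have "\<dots> = image_hat N \<alpha> (\<lambda>p. \<Sum>w\<in>set ws. of_nat (count_list ws w) * ?f w p)"
    using f by (intro image_hat_sum familiesI localized.mult_mem localized.of_nat_mem) (auto dest: familiesD)
  also have "\<dots> = image_hat N \<alpha> (\<lambda>p. \<Sum>w\<leftarrow>ws. ?f w p)"
    by (simp add: sum_list_count[of "set ws"])
  also have "\<dots> = image_hat N \<alpha> (\<lambda>p. \<Sum>w\<leftarrow>ws. \<Sum>m<p. wcoef iv \<iota> w m)"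
  proof (intro image_hat_cong arg_cong[where f = sum_list] map_cong refl)
    fix p w assume p: "p \<in> primes_cong N \<alpha>" and w: "w \<in> set ws"
    have "0 < p" using p by (auto simp: primes_cong_def prime_gt_0_nat)
    then show "?f w p = (\<Sum>m<p. wcoef iv \<iota> w m)"
      using wcoef_symbol[OF sym(1)[OF w], of iv \<iota>] by (simp add: polylog_sum_chain sym(2)[OF w])
  qed
  finally show ?thesis .
qed

text \<open>The gap base is 1 because the region i + j < p carries no weight of its own.\<close>

lemma polylog_hat_shuffle:
  assumes "\<sigma> \<in> symbols" "\<tau> \<in> symbols" "fst ` set \<sigma> \<subseteq> K" "fst ` set \<tau> \<subseteq> K"
  shows "polylog_hat_lin R N \<alpha> (shuffle (symbol_poly \<sigma>) (symbol_poly \<tau>)) =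
    image_hat N \<alpha> (\<lambda>p. paired_sum p 1 (fold col_step (symbol_cols iv \<iota> \<sigma>) delta)
        (fold col_step (symbol_cols iv \<iota> \<tau>) delta))"
proof -
  let ?u = "rev (letters (symbol_word \<sigma>))" and ?v = "rev (letters (symbol_word \<tau>))"
  note u = last_rev_symbol_word[OF assms(1)] and v = last_rev_symbol_word[OF assms(2)]
  have "set w \<subseteq> K" if "w \<in> set (shuffle_list ?u ?v)" for w
  proof -
    have "set (letters (symbol_word \<rho>)) \<subseteq> K" if "fst ` set \<rho> \<subseteq> K" for \<rho>
      using set_symbol_word(2)[of \<rho>] that zero_mem by (meson insert_subset order_trans)
    then show ?thesis
      using assms(3,4) by (simp add: set_shuffle_list[OF that])
  qed
  then have "polylog_hat_lin R N \<alpha> (shuffle (symbol_poly \<sigma>) (symbol_poly \<tau>)) =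
      image_hat N \<alpha> (\<lambda>p. \<Sum>w\<leftarrow>shuffle_list ?u ?v. \<Sum>m<p. wcoef iv \<iota> w m)"
    unfolding shuffle_symbol_poly
    by (intro polylog_hat_lin_list_poly last_shuffle_list[OF u v])
  then show ?thesis
    unfolding sum_wcoef_shuffle[OF u v] wcoef_symbol[OF assms(1)] wcoef_symbol[OF assms(2)]
    by (simp add: paired_sum_def)
qed

end

section \<open>The shuffle relation\<close>

text \<open>Reflection pairs the exponent of column j with the base of column j + 1; for j = s there
  is no such base, and \<open>c\<close> takes its place.\<close>

lemma zip_reflected:
  assumes "1 \<le> s" "b = (\<lambda>j. if j = s then c else y (j + 1))"
  shows "zip (c # map y (rev [2..<s + 1])) (map e (rev [1..<s + 1])) = map (\<lambda>j. (b j, e j)) (rev [1..<s + 1])"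
proof -
  obtain s' where s: "s = Suc s'" using assms(1) by (cases s) auto
  have "map y [2..<s + 1] = map (\<lambda>j. y (Suc j)) [1..<s]"
    using map_Suc_upt[of 1 s] by (simp add: numeral_2_eq_2 flip: map_map[of y Suc, unfolded o_def])
  also have "\<dots> = map b [1..<s]"
    using assms(2) by auto
  finally have "c # map y (rev [2..<s + 1]) = map b (rev [1..<s + 1])"
    using assms(2) by (simp add: s flip: rev_map)
  then show ?thesis by (simp add: zip_map_map zip_same_conv_map del: upt_Suc)
qed

context rational_extension
begin

text \<open>The reflection identity is exact, before any expansion. The sign is moved into the
  weights, which for 0 < m < p become (m - p)^(-l), the form that the binomial series expands; taken
  out again it is squared and disappears.\<close>

lemma shuffle_relation_embedded:
  assumes "1 \<le> s" "p > 0" "y 1 * c = 1"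
  shows "paired_sum p 1 (fold col_step (map (\<lambda>i. (x i, \<lambda>m. iv m ^ k i)) [1..<r + 1]) delta)
      (fold col_step (map (\<lambda>j. (y j, \<lambda>m. iv m ^ l j)) [1..<s + 1]) delta) =
    (- 1) ^ (\<Sum>i = 1..s. l i) * y 1 ^ p * (\<Sum>i<p. fold col_step
      (map (\<lambda>(a, j). (a, \<lambda>m. (- 1) ^ l j * iv (p - m) ^ l j))
        (map (\<lambda>j. ((if j = s then 1 else y (j + 1)) * c, j)) (rev [1..<s + 1])))
      (fold col_step (map (\<lambda>i. (x i * c, \<lambda>m. iv m ^ k i)) [1..<r + 1]) delta) i)"
proof -
  let ?\<tau> = "map (\<lambda>j. ((if j = s then 1 else y (j + 1)) * c, j)) (rev [1..<s + 1])"
  let ?\<phi> = "fold col_step (map (\<lambda>i. (x i * c, \<lambda>m. iv m ^ k i)) [1..<r + 1]) delta"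
  have sign: "(\<Prod>(a, j)\<leftarrow>?\<tau>. (- 1) ^ l j) = ((- 1) ^ (\<Sum>i = 1..s. l i) :: 'k)"
  proof -
    have "(\<Prod>(a, j)\<leftarrow>?\<tau>. (- 1) ^ l j) = (\<Prod>j\<leftarrow>rev [1..<s + 1]. (- 1) ^ l j :: 'k)"
      by (simp add: o_def del: upt_Suc)
    also have "\<dots> = (\<Prod>j\<in>set (rev [1..<s + 1]). (- 1) ^ l j)"
      by (rule prod.distinct_set_conv_list[symmetric]) simp
    also have "set (rev [1..<s + 1]) = {1..s}" by auto
    finally show ?thesis by (simp add: power_sum)
  qed
  have "fold col_step (map (\<lambda>(a, j). (a, \<lambda>m. (- 1) ^ l j * iv (p - m) ^ l j)) ?\<tau>) ?\<phi> i =
      (- 1) ^ (\<Sum>i = 1..s. l i) * fold col_step (map (\<lambda>(a, j). (a, \<lambda>m. iv (p - m) ^ l j)) ?\<tau>) ?\<phi> i" for i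
    using fold_col_step_scale[of "\<lambda>j. (- 1) ^ l j" "\<lambda>j m. iv (p - m) ^ l j" ?\<tau> ?\<phi> i] unfolding sign .
  then have "(- 1) ^ (\<Sum>i = 1..s. l i) * y 1 ^ p *
      (\<Sum>i<p. fold col_step (map (\<lambda>(a, j). (a, \<lambda>m. (- 1) ^ l j * iv (p - m) ^ l j)) ?\<tau>) ?\<phi> i) =
      ((- 1) ^ (\<Sum>i = 1..s. l i) * (- 1) ^ (\<Sum>i = 1..s. l i)) * y 1 ^ p *
      (\<Sum>i<p. fold col_step (map (\<lambda>(a, j). (a, \<lambda>m. iv (p - m) ^ l j)) ?\<tau>) ?\<phi> i)"
    by (simp only: sum_distrib_left[symmetric] mult_ac)
  also have "(- 1) ^ (\<Sum>i = 1..s. l i) * (- 1) ^ (\<Sum>i = 1..s. l i) = (1 :: 'k)"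
    by (simp flip: power_mult_distrib)
  finally show ?thesis
    unfolding paired_sum_chain_rescale[where y = y and s = s and w = "\<lambda>j m. iv m ^ l j", OF assms(1,3)]
    by (simp add: o_def fold_append del: upt_Suc)
qed

text \<open>Over the box of all f with entries below n the sum becomes, by multilinearity, a single
  chain whose weights are truncated binomial series; these are congruent to the reflected weights
  modulo p^n. An f outside the box has an entry of at least n and therefore brings a factor
  p^n.\<close>

lemma reflected_sum_expansion:
  fixes b :: "nat \<Rightarrow> 'k"
  assumes "prime p"
    and b: "\<And>j. j \<in> {1..s} \<Longrightarrow> b j \<in> localized p" and \<phi>: "\<And>m. m < p \<Longrightarrow> \<phi> m \<in> localized p"
    and F: "finite F" "({1..s} \<rightarrow>\<^sub>E {..<n}) \<subseteq> F" "F \<subseteq> ({1..s} \<rightarrow>\<^sub>E UNIV)"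
  defines "\<tau> \<equiv> map (\<lambda>j. (b j, j)) (rev [1..<s + 1])"
  shows "(\<Sum>f\<in>F. of_nat (\<Prod>i = 1..s. (l i + f i - 1) choose f i) *
        (\<Sum>i<p. fold col_step (map (\<lambda>(a, j). (a, \<lambda>m. iv m ^ (l j + f j))) \<tau>) \<phi> i) * of_nat p ^ (\<Sum>i = 1..s. f i)) -
      (\<Sum>i<p. fold col_step (map (\<lambda>(a, j). (a, \<lambda>m. (- 1) ^ l j * iv (p - m) ^ l j)) \<tau>) \<phi> i)
    \<in> localized.multiples p (of_nat p ^ n)"
proof -
  let ?B = "{1..s} \<rightarrow>\<^sub>E {..<n}"
  let ?chain = "\<lambda>f i. fold col_step (map (\<lambda>(a, j). (a, \<lambda>m. iv m ^ (l j + f j))) \<tau>) \<phi> i"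
  let ?G = "\<lambda>f. of_nat (\<Prod>i = 1..s. (l i + f i - 1) choose f i) * (\<Sum>i<p. ?chain f i) * of_nat p ^ (\<Sum>i = 1..s. f i)"
  let ?S = "\<Sum>i<p. fold col_step (map (\<lambda>(a, j). (a, \<lambda>m. (- 1) ^ l j * iv (p - m) ^ l j)) \<tau>) \<phi> i"
  \<comment> \<open>\<open>w j t\<close> is the term of degree t in the expansion of the reflected
    weight of column j, and \<open>c j t\<close> is its part independent of the summation
    index.\<close>
  define c :: "nat \<Rightarrow> nat \<Rightarrow> 'k" where "c j t = of_nat ((l j + t - 1) choose t) * of_nat p ^ t" for j t
  define w where "w j t m = c j t * iv m ^ (l j + t)" for j t m
  have \<tau>_mem: "j \<in> {1..s} \<and> a \<in> localized p" if "(a, j) \<in> set \<tau>" for a j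
    using that b by (auto simp: \<tau>_def simp del: upt_Suc)
  have snd_\<tau>: "map snd \<tau> = rev [1..<s + 1]" by (simp add: \<tau>_def o_def del: upt_Suc)
  then have "snd ` set \<tau> = set (rev [1..<s + 1])" by (metis set_map)
  then have \<tau>: "distinct (map snd \<tau>)" "snd ` set \<tau> = {1..s}"
    unfolding snd_\<tau> by auto
  have iv: "iv m \<in> localized p" if "0 < m" "m < p" for m
    using localized_inverse assms(1) that by blast
  have chain_mem: "?chain f i \<in> localized p" if "i < p" for f i
    using that \<tau>_mem iv \<phi>
    by (intro localized.fold_col_step_mem[where p = p and m = i]) (auto intro!: localized.power_mem)
  have tail: "?G f \<in> localized.multiples p (of_nat p ^ n)" if "f \<in> F - ?B" for f
  proof -
    have "\<exists>j\<in>{1..s}. n \<le> f j"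
    proof (rule ccontr)
      assume "\<not> ?thesis"
      then have "f \<in> ?B" using that F(3) by (auto simp: PiE_iff not_le subset_iff)
      then show False using that by simp
    qed
    then obtain j where j: "j \<in> {1..s}" "n \<le> f j" by blast
    have "f j \<le> (\<Sum>i = 1..s. f i)" using j by (intro member_le_sum) auto
    with j have "of_nat p ^ (\<Sum>i = 1..s. f i) = (of_nat p ^ n * of_nat p ^ ((\<Sum>i = 1..s. f i) - n) :: 'k)"
      by (simp flip: power_add)
    then show ?thesis
      using chain_mem
      by (intro localized.multiplesI[of _ _ "of_nat (\<Prod>i = 1..s. (l i + f i - 1) choose f i) * (\<Sum>i<p. ?chain f i) *
          of_nat p ^ ((\<Sum>i = 1..s. f i) - n)"])
        (auto simp: mult_ac intro!: localized.mult_mem localized.power_mem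
            localized.of_nat_mem localized.sum_mem localized.prod_mem)
  qed
  have G: "?G f = (\<Sum>i<p. fold col_step (map (\<lambda>(a, j). (a, w j (f j))) \<tau>) \<phi> i)" for f
  proof -
    have "(\<Prod>(a, j)\<leftarrow>\<tau>. c j (f j)) = (\<Prod>j\<leftarrow>rev [1..<s + 1]. c j (f j))"
      by (simp add: \<tau>_def o_def del: upt_Suc)
    also have "\<dots> = (\<Prod>j\<in>set (rev [1..<s + 1]). c j (f j))"
      by (rule prod.distinct_set_conv_list[symmetric]) simp
    also have "set (rev [1..<s + 1]) = {1..s}" by auto
    finally have "(\<Prod>(a, j)\<leftarrow>\<tau>. c j (f j)) =
        of_nat (\<Prod>i = 1..s. (l i + f i - 1) choose f i) * of_nat p ^ (\<Sum>i = 1..s. f i)"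
      by (simp add: c_def prod.distrib power_sum)
    moreover have "fold col_step (map (\<lambda>(a, j). (a, w j (f j))) \<tau>) \<phi> i = (\<Prod>(a, j)\<leftarrow>\<tau>. c j (f j)) * ?chain f i" for i
      using fold_col_step_scale[of "\<lambda>j. c j (f j)" "\<lambda>j m. iv m ^ (l j + f j)" \<tau> \<phi> i]
      by (simp add: w_def[abs_def])
    ultimately show ?thesis by (simp add: sum_distrib_left mult_ac)
  qed
  have "(\<Sum>f\<in>?B. ?G f) = (\<Sum>i<p. \<Sum>f\<in>?B. fold col_step (map (\<lambda>(a, j). (a, w j (f j))) \<tau>) \<phi> i)"
    unfolding G by (rule sum.swap)
  also have "\<dots> = (\<Sum>i<p. fold col_step (map (\<lambda>(a, j). (a, \<lambda>m. \<Sum>t<n. w j t m)) \<tau>) \<phi> i)"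
    using fold_col_step_multilinear[OF \<tau>(1), of "\<lambda>_. {..<n}" w \<phi>] by (simp add: \<tau>(2))
  finally have "(\<Sum>f\<in>?B. ?G f) - ?S = (\<Sum>i<p. fold col_step (map (\<lambda>(a, j). (a, \<lambda>m. \<Sum>t<n. w j t m)) \<tau>) \<phi> i -
      fold col_step (map (\<lambda>(a, j). (a, \<lambda>m. (- 1) ^ l j * iv (p - m) ^ l j)) \<tau>) \<phi> i)"
    by (simp only: sum_subtractf)
  \<comment> \<open>The congruence is checked for one weight at a time, where it is the binomial
    expansion.\<close>
  also have "\<dots> \<in> localized.multiples p (of_nat p ^ n)"
  proof (intro localized.multiples_sum localized.fold_col_step_congruent[where p = p])
    fix a j m assume aj: "(a, j) \<in> set \<tau>" and m: "0 < m" "m < p"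
    show "(\<Sum>t<n. w j t m) \<in> localized p"
      using iv[OF m] unfolding w_def c_def by (intro localized.mem_intros)
    show "(- 1) ^ l j * iv (p - m) ^ l j \<in> localized p"
      using iv[of "p - m"] m by (intro localized.mem_intros) auto
    show "(\<Sum>t<n. w j t m) - (- 1) ^ l j * iv (p - m) ^ l j \<in> localized.multiples p (of_nat p ^ n)"
      unfolding w_def c_def
      by (rule localized.reflected_inverse_expansion[OF m(2) of_nat_inverse[OF m(1)] of_nat_inverse iv[OF m] iv])
        (use m in auto)
  qed (use \<tau>_mem \<phi> localized.multiples_zero in auto)
  finally have box: "(\<Sum>f\<in>?B. ?G f) - ?S \<in> localized.multiples p (of_nat p ^ n)" .
  have split: "(\<Sum>f\<in>F. ?G f) - ?S = ((\<Sum>f\<in>?B. ?G f) - ?S) + (\<Sum>f\<in>F - ?B. ?G f)"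
    using F by (simp add: sum.subset_diff[of ?B F])
  have "(\<Sum>f\<in>F - ?B. ?G f) \<in> localized.multiples p (of_nat p ^ n)"
    by (rule localized.multiples_sum[OF tail])
  then show ?thesis unfolding split by (rule localized.multiples_add[OF box])
qed

text \<open>Over an abstract coefficient ring all that is used of the indeterminates is that they
  are nonzero, 0 being the index of e_0, and that y_1 has an inverse \<open>yi\<close>.\<close>

lemma shuffle_relation:
  fixes x y :: "nat \<Rightarrow> 'a" and yi :: 'a and N r s :: nat and \<alpha> :: int and k l :: "nat \<Rightarrow> nat"
  assumes s: "1 \<le> s" and yi: "yi \<in> K" "y 1 * yi = 1"
    and x: "\<And>i. i \<in> {1..r} \<Longrightarrow> x i \<in> K \<and> x i \<noteq> 0 \<and> 1 \<le> k i"
    and y: "\<And>j. j \<in> {1..s} \<Longrightarrow> y j \<in> K \<and> y j \<noteq> 0 \<and> 1 \<le> l j"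
  defines "g \<equiv> \<lambda>f :: nat \<Rightarrow> nat.
      ([(\<Prod>i = 1..s. (l i + f i - 1) choose f i)] \<cdot>\<^bsub>Ah R N \<alpha>\<^esub>
        polylog_hat R N \<alpha>
          (zip (map (\<lambda>i. x i * yi) [1..<r + 1] @ [yi] @ map (\<lambda>j. y j * yi) (rev [2..<s + 1]))
               (map k [1..<r + 1] @ map (\<lambda>i. l i + f i) (rev [1..<s + 1]))))
      \<otimes>\<^bsub>Ah R N \<alpha>\<^esub> bold_p R N \<alpha> [^]\<^bsub>Ah R N \<alpha>\<^esub> (\<Sum>i = 1..s. f i)"
  shows "adic_summable (Ah R N \<alpha>) (bold_p R N \<alpha>) g ({1..s} \<rightarrow>\<^sub>E UNIV)
    \<and> polylog_hat_lin R N \<alpha>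
        (shuffle (symbol_poly (zip (map x [1..<r + 1]) (map k [1..<r + 1])))
                 (symbol_poly (zip (map y [1..<s + 1]) (map l [1..<s + 1]))))
      = (\<ominus>\<^bsub>Ah R N \<alpha>\<^esub> \<one>\<^bsub>Ah R N \<alpha>\<^esub>) [^]\<^bsub>Ah R N \<alpha>\<^esub> (\<Sum>i = 1..s. l i)
          \<otimes>\<^bsub>Ah R N \<alpha>\<^esub> pow_bold_p R N \<alpha> (y 1)
          \<otimes>\<^bsub>Ah R N \<alpha>\<^esub> adic_sum (Ah R N \<alpha>) (bold_p R N \<alpha>) g ({1..s} \<rightarrow>\<^sub>E UNIV)"
proof -
  let ?A = "Ah R N \<alpha>" and ?I = "{1..s} \<rightarrow>\<^sub>E (UNIV :: nat set)"
  define b where "b j = (if j = s then 1 else y (j + 1)) * yi" for j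
  define \<tau> where "\<tau> = map (\<lambda>j. (\<iota> (b j), j)) (rev [1..<s + 1])"
  define \<phi> where "\<phi> = fold col_step (map (\<lambda>i. (\<iota> (x i * yi), \<lambda>m. iv m ^ k i)) [1..<r + 1]) delta"
  define \<sigma> where "\<sigma> f = map (\<lambda>i. (x i * yi, k i)) [1..<r + 1] @ map (\<lambda>j. (b j, l j + f j)) (rev [1..<s + 1])" for f
  define G where "G f p = of_nat (\<Prod>i = 1..s. (l i + f i - 1) choose f i) * polylog_sum iv \<iota> p (\<sigma> f)
      * of_nat p ^ (\<Sum>i = 1..s. f i)" for f p
  \<comment> \<open>The limit of the series: at each prime the exact reflected sum, before
    expansion. Its initial chain \<open>\<phi>\<close> is the one of the x_i/y_1.\<close>
  define S where "S p = (\<Sum>i<p. fold col_step (map (\<lambda>(a, j). (a, \<lambda>m. (- 1) ^ l j * iv (p - m) ^ l j)) \<tau>) \<phi> i)" for p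
  have b: "b j \<in> K" if "j \<in> {1..s}" for j
    using that yi y[of "j + 1"] by (auto simp: b_def intro!: mem_intros)
  have x': "x i \<in> K" "x i \<noteq> 0" "0 < k i" if "i \<in> {1..r}" for i
    using x[OF that] by auto
  have y': "y j \<in> K" "y j \<noteq> 0" "0 < l j" if "j \<in> {1..s}" for j
    using y[OF that] by auto
  have xK: "x i * yi \<in> K" if "i \<in> {1..r}" for i
    using x[OF that] yi by (auto intro: mult_mem)
  have \<sigma>K: "fst ` set (\<sigma> f) \<subseteq> K" for f
    using b xK by (auto simp: \<sigma>_def simp del: upt_Suc)
  have "zip (map (\<lambda>i. x i * yi) [1..<r + 1] @ [yi] @ map (\<lambda>j. y j * yi) (rev [2..<s + 1]))
      (map k [1..<r + 1] @ map (\<lambda>i. l i + f i) (rev [1..<s + 1])) = \<sigma> f" for f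
  proof -
    have "zip (yi # map (\<lambda>j. y j * yi) (rev [2..<s + 1])) (map (\<lambda>i. l i + f i) (rev [1..<s + 1])) =
        map (\<lambda>j. (b j, l j + f j)) (rev [1..<s + 1])"
      by (rule zip_reflected[OF s]) (auto simp: b_def)
    then show ?thesis by (simp add: \<sigma>_def zip_map_map zip_same_conv_map del: upt_Suc)
  qed
  then have g: "g = (\<lambda>f. ([(\<Prod>i = 1..s. (l i + f i - 1) choose f i)] \<cdot>\<^bsub>?A\<^esub> polylog_hat R N \<alpha> (\<sigma> f))
      \<otimes>\<^bsub>?A\<^esub> bold_p R N \<alpha> [^]\<^bsub>?A\<^esub> (\<Sum>i = 1..s. f i))"
    unfolding g_def by simp
  have g_image: "g f = image_hat N \<alpha> (G f)" for f
  proof -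
    have 1: "(\<lambda>p. of_nat n * polylog_sum iv \<iota> p (\<sigma> f)) \<in> families N \<alpha>" for n
      using familiesD[OF polylog_sum_family[OF \<sigma>K]]
      by (intro familiesI localized.mult_mem localized.of_nat_mem)
    have 2: "(\<lambda>p. of_nat p ^ n) \<in> families N \<alpha>" for n
      by (intro familiesI localized.power_mem localized.of_nat_mem)
    show ?thesis
      unfolding g G_def[abs_def] polylog_hat_image[OF \<sigma>K] bold_p_image image_hat_power[OF bold_p_family]
        image_hat_add_pow[OF polylog_sum_family[OF \<sigma>K]] image_hat_mult[OF 1 2] ..
  qed
  have Gf: "G f \<in> families N \<alpha>" for f
    unfolding G_def[abs_def] using familiesD[OF polylog_sum_family[OF \<sigma>K]]
    by (intro familiesI localized.mult_mem localized.power_mem localized.of_nat_mem)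
  have prime: "prime p" if "p \<in> primes_cong N \<alpha>" for p
    using that by (simp add: primes_cong_def)
  have \<phi>_mem: "\<phi> m \<in> localized p" if "prime p" "m < p" for p m
    unfolding \<phi>_def using that xK
    by (intro localized.fold_col_step_mem[where p = p and m = m])
      (auto intro!: localized.mem_intros embed_localized localized_inverse)
  have \<tau>_mem: "a \<in> localized p" if "(a, j) \<in> set \<tau>" for a j p
    using that b by (auto simp: \<tau>_def intro!: embed_localized simp del: upt_Suc)
  have Sf: "S \<in> families N \<alpha>"
  proof (rule familiesI)
    fix p assume "p \<in> primes_cong N \<alpha>"
    then have p: "prime p" by (rule prime)
    show "S p \<in> localized p"
      unfolding S_def using p \<phi>_mem[OF p] \<tau>_mem
      by (intro localized.sum_mem localized.fold_col_step_mem[where p = p])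
        (auto intro!: localized.mem_intros localized_inverse)
  qed
  have has_sum: "adic_has_sum ?A (bold_p R N \<alpha>) g ?I (image_hat N \<alpha> S)"
    unfolding g_image[abs_def]
  proof (rule adic_has_sum_image[OF Gf Sf])
    fix n
    have "(\<Sum>f\<in>F. G f p) - S p \<in> localized.multiples p (of_nat p ^ n)"
      if F: "finite F" "({1..s} \<rightarrow>\<^sub>E {..<n}) \<subseteq> F" "F \<subseteq> ?I" and p: "p \<in> primes_cong N \<alpha>" for F p
    proof -
      have sum: "polylog_sum iv \<iota> p (\<sigma> f) =
          (\<Sum>i<p. fold col_step (map (\<lambda>(a, j). (a, \<lambda>m. iv m ^ (l j + f j))) \<tau>) \<phi> i)" for f
        using prime[OF p]
        by (simp add: polylog_sum_chain prime_gt_0_nat \<sigma>_def \<tau>_def \<phi>_def o_def fold_append del: upt_Suc)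
      show ?thesis
        unfolding G_def S_def sum \<tau>_def
        by (rule reflected_sum_expansion) (use prime[OF p] b \<phi>_mem F in \<open>auto intro: embed_localized\<close>)
    qed
    then show "\<exists>F0\<subseteq>?I. finite F0 \<and> (\<forall>F. finite F \<longrightarrow> F0 \<subseteq> F \<longrightarrow> F \<subseteq> ?I \<longrightarrow>
        (\<forall>p\<in>primes_cong N \<alpha>. (\<Sum>f\<in>F. G f p) - S p \<in> localized.multiples p (of_nat p ^ n)))"
      \<comment> \<open>The box depends on \<open>n\<close> only, as uniformity in the primes
        demands.\<close>
      by (intro exI[of _ "{1..s} \<rightarrow>\<^sub>E {..<n}"]) (auto simp: PiE_iff intro!: finite_PiE)
  qed
  then have sum: "adic_sum ?A (bold_p R N \<alpha>) g ?I = image_hat N \<alpha> S"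
    unfolding adic_sum_def by (intro the_equality) (auto intro: adic_has_sum_unique)
  have minus_one: "(\<ominus>\<^bsub>?A\<^esub> \<one>\<^bsub>?A\<^esub>) [^]\<^bsub>?A\<^esub> n = image_hat N \<alpha> (\<lambda>p. (- 1) ^ n)" for n :: nat
  proof -
    have 1: "(\<lambda>p. 1) \<in> families N \<alpha>" "(\<lambda>p. - 1) \<in> families N \<alpha>"
      by (intro familiesI localized.mem_intros)+
    show ?thesis
      unfolding image_hat_one[symmetric] image_hat_uminus[OF 1(1)] image_hat_power[OF 1(2)] ..
  qed
  have y1: "y 1 \<in> K" using y[of 1] s by simp
  have fam: "(\<lambda>p. (- 1) ^ n) \<in> families N \<alpha>" "(\<lambda>p. \<iota> (y 1) ^ p) \<in> families N \<alpha>"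
    "(\<lambda>p. (- 1) ^ n * \<iota> (y 1) ^ p) \<in> families N \<alpha>" for n :: nat
    using y1 by (auto intro!: familiesI localized.mem_intros embed_localized)
  have sym: "zip (map x [1..<r + 1]) (map k [1..<r + 1]) = map (\<lambda>i. (x i, k i)) [1..<r + 1]"
    "zip (map y [1..<s + 1]) (map l [1..<s + 1]) = map (\<lambda>j. (y j, l j)) [1..<s + 1]"
    by (simp_all add: zip_map_map zip_same_conv_map del: upt_Suc)
  have "polylog_hat_lin R N \<alpha>
      (shuffle (symbol_poly (zip (map x [1..<r + 1]) (map k [1..<r + 1])))
               (symbol_poly (zip (map y [1..<s + 1]) (map l [1..<s + 1])))) =
      image_hat N \<alpha> (\<lambda>p. paired_sum p 1 (fold col_step (map (\<lambda>i. (\<iota> (x i), \<lambda>m. iv m ^ k i)) [1..<r + 1]) delta)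
        (fold col_step (map (\<lambda>j. (\<iota> (y j), \<lambda>m. iv m ^ l j)) [1..<s + 1]) delta))"
    unfolding sym
    using x' y' by (subst polylog_hat_shuffle) (auto simp: symbols_def o_def simp del: upt_Suc)
  \<comment> \<open>This equality holds prime by prime without error; the infinite series has
    already been absorbed into \<open>S\<close>.\<close>
  also have "\<dots> = image_hat N \<alpha> (\<lambda>p. (- 1) ^ (\<Sum>i = 1..s. l i) * \<iota> (y 1) ^ p * S p)"
  proof (rule image_hat_cong)
    fix p assume "p \<in> primes_cong N \<alpha>"
    then have p: "0 < p" using prime by (simp add: prime_gt_0_nat)
    have "\<iota> (y 1) * \<iota> yi = 1" using yi(2) by (simp add: embed_one flip: embed_mult)
    moreover have "\<tau> = map (\<lambda>j. ((if j = s then 1 else \<iota> (y (j + 1))) * \<iota> yi, j)) (rev [1..<s + 1])"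
      unfolding \<tau>_def b_def by (simp add: embed_mult embed_one if_distrib[of \<iota>] del: upt_Suc cong: if_cong)
    ultimately show "paired_sum p 1 (fold col_step (map (\<lambda>i. (\<iota> (x i), \<lambda>m. iv m ^ k i)) [1..<r + 1]) delta)
        (fold col_step (map (\<lambda>j. (\<iota> (y j), \<lambda>m. iv m ^ l j)) [1..<s + 1]) delta) =
        (- 1) ^ (\<Sum>i = 1..s. l i) * \<iota> (y 1) ^ p * S p"
      unfolding S_def \<phi>_def embed_mult
      using shuffle_relation_embedded[OF s p, of "\<lambda>j. \<iota> (y j)" "\<iota> yi" "\<lambda>i. \<iota> (x i)" k r l] by simp
  qed
  also have "\<dots> = image_hat N \<alpha> (\<lambda>p. (- 1) ^ (\<Sum>i
      = 1..s. l i)) \<otimes>\<^bsub>?A\<^esub> image_hat N \<alpha> (\<lambda>p. \<iota> (y 1) ^ p) \<otimes>\<^bsub>?A\<^esub> image_hat N \<alpha> S"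
    unfolding image_hat_mult[OF fam(1,2)] image_hat_mult[OF fam(3) Sf] ..
  finally show ?thesis
    unfolding sum minus_one pow_bold_p_image[OF y1] using has_sum by (auto simp: adic_summable_def)
qed

end

section \<open>The coefficient ring\<close>

definition rational_laurent :: "('m \<Rightarrow>\<^sub>0 int) \<Rightarrow> 'm \<Rightarrow>\<^sub>0 rat" where
  "rational_laurent P = Poly_Mapping.map of_int P"

lemma lookup_rational_laurent:
  "Poly_Mapping.lookup (rational_laurent P) m = of_int (Poly_Mapping.lookup P m)"
  by (simp add: rational_laurent_def map.rep_eq when_def)

text \<open>\<open>of_int\<close> is injective into the rationals, so both sums run over the same
  support; if that is infinite, both are 0.\<close>

lemma Sum_any_of_int: "Sum_any (\<lambda>a. rat_of_int (f a)) = of_int (Sum_any f)"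
  by (simp add: Sum_any.expand_set)

lemma rational_laurent_mult:
  fixes P Q :: "'m::monoid_add \<Rightarrow>\<^sub>0 int"
  shows "rational_laurent (P * Q) = rational_laurent P * rational_laurent Q"
proof (rule poly_mapping_eqI)
  fix m
  have "(rat_of_int a when b) = of_int (a when b)" for a b by (simp add: when_def)
  then show "Poly_Mapping.lookup (rational_laurent (P * Q)) m =
      Poly_Mapping.lookup (rational_laurent P * rational_laurent Q) m"
    by (simp add: lookup_rational_laurent lookup_mult Sum_any_of_int flip: of_int_mult)
qed

definition coeff_set :: "nat \<Rightarrow> nat \<Rightarrow> laurent set" where
  "coeff_set r s = carrier (coeff_ring r s)"

lemma coeff_ring_sub_ring: "coeff_ring r s = sub_ring (coeff_set r s)"
  by (simp add: coeff_set_def coeff_ring_def sub_ring_def)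

lemma coeff_set_iff:
  "P \<in> coeff_set r s \<longleftrightarrow> (\<forall>m\<in>Poly_Mapping.keys P.
    Poly_Mapping.keys m \<subseteq> X ` {1..r} \<union> Y ` {1..s} \<and> (\<forall>v. v \<noteq> Y 1 \<longrightarrow> 0 \<le> Poly_Mapping.lookup m v))"
  by (simp add: coeff_set_def coeff_ring_def)

text \<open>Exponent vectors in a product are sums of exponent vectors of the factors, which keeps
  the permitted variables and the nonnegativity away from \<open>Y 1\<close>.\<close>

lemma comm_subring_coeff_set: "comm_subring (coeff_set r s)"
proof
  show "1 \<in> coeff_set r s" by (simp add: coeff_set_iff)
next
  fix P Q assume P: "P \<in> coeff_set r s" and Q: "Q \<in> coeff_set r s"
  have "Poly_Mapping.keys (P - Q) \<subseteq> Poly_Mapping.keys P \<union> Poly_Mapping.keys Q"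
    by (auto simp: in_keys_iff lookup_minus)
  with P Q show "P - Q \<in> coeff_set r s" unfolding coeff_set_iff by blast
  show "P * Q \<in> coeff_set r s"
    unfolding coeff_set_iff
  proof
    fix m assume "m \<in> Poly_Mapping.keys (P * Q)"
    then obtain a b where m: "m = a + b" "a \<in> Poly_Mapping.keys P" "b \<in> Poly_Mapping.keys Q"
      using keys_mult[of P Q] by blast
    then have "Poly_Mapping.keys a \<union> Poly_Mapping.keys b \<subseteq> X ` {1..r} \<union> Y ` {1..s}"
      "\<forall>v. v \<noteq> Y 1 \<longrightarrow> 0 \<le> Poly_Mapping.lookup a v \<and> 0 \<le> Poly_Mapping.lookup b v"
      using P Q unfolding coeff_set_iff by blast+
    then show "Poly_Mapping.keys m \<subseteq> X ` {1..r} \<union> Y ` {1..s} \<and> (\<forall>v. v \<noteq> Y 1 \<longrightarrow> 0 \<le> Poly_Mapping.lookup m v)"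
      using keys_add[of a b] unfolding m(1) lookup_add by (meson add_nonneg_nonneg order_trans)
  qed
qed

text \<open>The ambient ring is that of Laurent polynomials with rational coefficients, in which the
  constant 1/m inverts m.\<close>

lemma rational_extension_coeff_set:
  "rational_extension (coeff_set r s) (\<lambda>m. Poly_Mapping.single 0 (1 / of_nat m)) rational_laurent"
proof (intro rational_extension.intro comm_subring_coeff_set nat_inverses.intro rational_extension_axioms.intro)
  fix m :: nat assume "0 < m"
  then show "of_nat m * Poly_Mapping.single 0 (1 / of_nat m) = (1 :: (var \<Rightarrow>\<^sub>0 int) \<Rightarrow>\<^sub>0 rat)"
    by (simp add: mult_single flip: single_of_nat)
next
  show "inj (rational_laurent :: laurent \<Rightarrow> _)"
    by (rule injI, rule poly_mapping_eqI) (metis lookup_rational_laurent of_int_eq_iff)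
next
  show "rational_laurent (1 :: laurent) = 1"
    by (rule poly_mapping_eqI) (simp add: lookup_rational_laurent lookup_one when_def)
next
  fix P Q :: laurent
  show "rational_laurent (P - Q) = rational_laurent P - rational_laurent Q"
    by (rule poly_mapping_eqI) (simp add: lookup_rational_laurent lookup_minus)
qed (rule rational_laurent_mult)

lemma var_nonzero: "var v \<noteq> 0"
  by (metis var_def keys_single keys_zero insert_not_empty zero_neq_one)

lemma var_X_mem: "i \<in> {1..r} \<Longrightarrow> var (X i) \<in> coeff_set r s"
  by (auto simp: coeff_set_iff var_def lookup_single when_def)

lemma var_Y_mem: "j \<in> {1..s} \<Longrightarrow> var (Y j) \<in> coeff_set r s"
  by (auto simp: coeff_set_iff var_def lookup_single when_def)

theorem theorem4p9:
  fixes N r s :: nat and \<alpha> :: int and k l :: "nat \<Rightarrow> nat"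
  defines "R \<equiv> coeff_ring r s"
  defines "A \<equiv> Ah R N \<alpha>"
  defines "x \<equiv> \<lambda>i. var (X i)" and "y \<equiv> \<lambda>j. var (Y j)"
  defines "g \<equiv> \<lambda>f :: nat \<Rightarrow> nat.
      ([(\<Prod>i = 1..s. (l i + f i - 1) choose f i)] \<cdot>\<^bsub>A\<^esub>
        polylog_hat R N \<alpha>
          (zip (map (\<lambda>i. x i \<otimes>\<^bsub>R\<^esub> inv\<^bsub>R\<^esub> y 1) [1..<r + 1] @ [inv\<^bsub>R\<^esub> y 1]
                 @ map (\<lambda>j. y j \<otimes>\<^bsub>R\<^esub> inv\<^bsub>R\<^esub> y 1) (rev [2..<s + 1]))
               (map k [1..<r + 1] @ map (\<lambda>i. l i + f i) (rev [1..<s + 1]))))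
      \<otimes>\<^bsub>A\<^esub> bold_p R N \<alpha> [^]\<^bsub>A\<^esub> (\<Sum>i = 1..s. f i)"
  assumes "N \<ge> 1" and "s \<ge> 1"
    and "\<And>i. i \<in> {1..r} \<Longrightarrow> k i \<ge> 1" and "\<And>i. i \<in> {1..s} \<Longrightarrow> l i \<ge> 1"
  shows "adic_summable A (bold_p R N \<alpha>) g ({1..s} \<rightarrow>\<^sub>E UNIV)
    \<and> polylog_hat_lin R N \<alpha>
        (shuffle (symbol_poly (zip (map x [1..<r + 1]) (map k [1..<r + 1])))
                 (symbol_poly (zip (map y [1..<s + 1]) (map l [1..<s + 1]))))
      = (\<ominus>\<^bsub>A\<^esub> \<one>\<^bsub>A\<^esub>) [^]\<^bsub>A\<^esub> (\<Sum>i = 1..s. l i) \<otimes>\<^bsub>A\<^esub> pow_bold_p R N \<alpha> (y 1)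
          \<otimes>\<^bsub>A\<^esub> adic_sum A (bold_p R N \<alpha>) g ({1..s} \<rightarrow>\<^sub>E UNIV)"
proof -
  \<comment> \<open>The inverse of y_1 is available because negative exponents of \<open>Y 1\<close>
    are permitted and \<open>s \<ge> 1\<close> makes \<open>Y 1\<close> one of the
    variables.\<close>
  let ?yi = "Poly_Mapping.single (Poly_Mapping.single (Y 1) (- 1)) 1 :: laurent"
  interpret E: rational_extension "coeff_set r s" "\<lambda>m. Poly_Mapping.single 0 (1 / of_nat m)" rational_laurent
    by (rule rational_extension_coeff_set)
  have yi: "?yi \<in> coeff_set r s"
    using assms(7) by (auto simp: coeff_set_iff lookup_single when_def)
  have y_yi: "y 1 * ?yi = 1"
    by (simp add: y_def var_def mult_single flip: single_add single_one)
  have R: "R = sub_ring (coeff_set r s)"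
    by (simp add: R_def coeff_ring_sub_ring)
  have inv: "inv\<^bsub>R\<^esub> (y 1) = ?yi"
    unfolding R using y_yi yi assms(7) by (intro E.inv_sub_ring) (auto simp: y_def var_Y_mem)
  show ?thesis
    unfolding A_def g_def inv unfolding R sub_ring_simps
    by (rule E.shuffle_relation)
      (use assms(7-9) yi y_yi in \<open>auto simp: x_def y_def var_X_mem var_Y_mem var_nonzero\<close>)
qed

end
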